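(* Let $m\in\{0,1\}$ and let $s_{h,m}$ be the nodal stabilization form $$s_{h,m}(v,w)=\sum_{i\in I^S}\tau h^{\alpha_m}\varphi_{i,T_i}^*([v]_{T_i,S_h(T_i)})\,\varphi_{i,T_i}^*([w]_{T_i,S_h(T_i)}),\qquad \alpha_m=d-2m,$$ and suppose Assumptions A2 and A3 (given in the context) hold. Then there is a constant $C$ (independent of $v$, of $h$ and of the position of $\Omega$ relative to the mesh; it may depend on $\tau$) such that $$\|\nabla^mv\|_{\Omega_h}^2\le C\left(\|\nabla^mv\|_\Omega^2+\|v\|_{s_{h,m}}^2\right)\qquad\text{for all }v\in V_h,$$ where $\|v\|_{s_{h,m}}^2=s_{h,m}(v,v)$.
   Context: Mesh and spaces. $\mathcal T_{h,0}$, $h\in(0,h_0]$, is a family of quasiuniform (in particular shape regular) meshes of closed simplices with mesh parameter $h$ on a closed polygonal domain $\Omega_0\subset\mathbb R^d$, and $V_{h,0}=\{v\in C^0(\Omega_0): v|_T\in\mathbb P_k(T)\ \forall T\in\mathcal T_{h,0}\}$, where $\mathbb P_k$ denotes polynomials of degree at most $k$, $k\ge1$. $\Omega\subset\Omega_0$ is a given closed domain, $\mathcal T_h=\{T\in\mathcal T_{h,0}:T\cap\Omega\ne\emptyset\}$, $\Omega_h=\bigcup_{T\in\mathcal T_h}T$, and $V_h=V_{h,0}|_{\Omega_h}$. $\|\cdot\|_X$ is the $L^2(X)$ norm; $\nabla^0v=v$, $\nabla^1v=\nabla v$. $\{\varphi_i\}_{i\in I}$ is the standard (nodal) finite element basis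 of $V_h$, and for $T\in\mathcal T_h$ with $T\subset\mathrm{supp}(\varphi_i)$, $\varphi_{i,T}^*$ are the element degrees of freedom (dual to the element basis, $\varphi_{j,T}^*(\varphi_i|_T)=\delta_{ij}$); $\varphi_{i,T}^*(p)$ for $p\in\mathbb P_k(\mathbb R^d)$ means $\varphi_{i,T}^*(p|_T)$. Large and small elements. For a fixed $\gamma\in(0,1]$, $\mathcal T_h^L=\{T\in\mathcal T_h:|T\cap\Omega|\ge\gamma|T|\}$ and $\mathcal T_h^S=\mathcal T_h\setminus\mathcal T_h^L$. $S_h:\mathcal T_h^S\to\mathcal T_h^L$ is a given map. For a polynomial $p$ on an element, $p^e\in\mathbb P_k(\mathbb R^d)$ is its canonical extension. For $T_1,T_2\in\mathcal T_h$ and $v\in V_h$, $[v]_{T_1,T_2}=(v|_{T_1})^e-(v|_{T_2})^e$. Nodal stabilization. $I^S\subset I$ is the set of indices $i$ such that $\mathrm{supp}(\varphi_i)$ contains no large element (no element of $\mathcal T_h^L$), and $I^L=I\setminus I^S$. For each $i\in I^S$, $T_i\in\mathcal T_h$ is a chosen element with $T_i\subset\mathrm{supp}(\varphi_i)$ (so $T_i\in\mathcal T_h^S$). $\tau>0$ is a parameter. Assumptions (a path is a finite sequence of elements of $\mathcal T_h$ in which consecutive elements share a face): A2: for each $T\in\mathcal T_h^S$ there is a path $\mathcal P_h(T,S_h(T))$ from $T$ to $S_h(T)$ of uniformly bounded length. A3: for elements $T_1,T_2\in\mathcal T_h^S$ contained in $\mathrm{supp}(\varphi_i)$ there is a path $\mathcal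 P_h(S_h(T_1),S_h(T_2))$ of uniformly bounded length consisting only of elements in $\mathcal T_h^L$; for $T_1\in\mathcal T_h^L$ and $T_2\in\mathcal T_h^S$ contained in $\mathrm{supp}(\varphi_i)$ there is a path $\mathcal P_h(T_1,S_h(T_2))$ of uniformly bounded length consisting only of elements in $\mathcal T_h^L$. *)

theory Defs
  imports "HOL-Analysis.Analysis"
begin

definition closed_domain :: "(real^'n) set \<Rightarrow> bool" where
  "closed_domain D \<longleftrightarrow> (\<exists>U. open U \<and> connected U \<and> U \<noteq> {} \<and> D = closure U)"

definition Pk :: "nat \<Rightarrow> (real^'n \<Rightarrow> real) set" where
  "Pk k = {p. \<exists>c :: ('n \<Rightarrow> nat) \<Rightarrow> real.
     p = (\<lambda>x. \<Sum>\<alpha> | (\<Sum>j\<in>UNIV. \<alpha> j) \<le> k. c \<alpha> * (\<Prod>j\<in>UNIV. (x $ j) ^ \<alpha> j))}"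

definition L2_norm :: "(real^'n) set \<Rightarrow> (real^'n \<Rightarrow> 'b::real_normed_vector) \<Rightarrow> real" where
  "L2_norm X f = sqrt (LINT x:X|lebesgue. (norm (f x))\<^sup>2)"

text \<open>Finite element functions are differentiable off the element boundaries, hence almost
  everywhere, and there this pointwise gradient agrees with the weak one.  Its value on the
  remaining null set does not affect the integrals below.\<close>

definition grad :: "(real^'n \<Rightarrow> real) \<Rightarrow> real^'n \<Rightarrow> real^'n" where
  "grad v x = (\<chi> j. frechet_derivative v (at x) (axis j 1))"

text \<open>The \<open>L\<^sup>2(X)\<close> norm of the \<open>m\<close>-th gradient of \<open>v\<close>; only \<open>m = 0\<close> and \<open>m = 1\<close> are meaningful.\<close>

definition nabla_norm :: "nat \<Rightarrow> (real^'n) set \<Rightarrow> (real^'n \<Rightarrow> real) \<Rightarrow> real" where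
  "nabla_norm m X v = (if m = 0 then L2_norm X v else L2_norm X (grad v))"

definition supp :: "(real^'n \<Rightarrow> real) \<Rightarrow> (real^'n) set" where
  "supp f = closure {x. f x \<noteq> 0}"

text \<open>The library's \<^const>\<open>triangulation\<close> supplies finiteness and conformity (two elements meet in
  a common, possibly empty, face).  A domain covered by such a mesh is automatically bounded and
  polygonal.  The first two bounds are quasiuniformity with respect to the mesh parameter \<open>h\<close>, the
  inscribed ball is shape regularity; the constants do not depend on \<open>h\<close>.\<close>

definition quasiuniform_family ::
    "real \<Rightarrow> (real^'n) set \<Rightarrow> (real \<Rightarrow> (real^'n) set set) \<Rightarrow> bool" where
  "quasiuniform_family h0 \<Omega>0 \<T>0 \<longleftrightarrow>
     (\<forall>h\<in>{0<..h0}. triangulation (\<T>0 h) \<and> (\<forall>T\<in>\<T>0 h. int CARD('n) simplex T) \<and> \<Union>(\<T>0 h) = \<Omega>0) \<and>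
     (\<exists>c1>0. \<exists>c2>0. \<exists>\<sigma>>0. \<forall>h\<in>{0<..h0}. \<forall>T\<in>\<T>0 h.
        c1 * h \<le> diameter T \<and> diameter T \<le> c2 * h \<and> (\<exists>x. cball x (\<sigma> * diameter T) \<subseteq> T))"

definition fe_space :: "nat \<Rightarrow> (real^'n) set set \<Rightarrow> (real^'n \<Rightarrow> real) set" where
  "fe_space k \<T> = {v. continuous_on (\<Union>\<T>) v \<and> (\<forall>T\<in>\<T>. \<exists>p\<in>Pk k. \<forall>x\<in>T. v x = p x)}"

definition active_mesh :: "(real^'n) set set \<Rightarrow> (real^'n) set \<Rightarrow> (real^'n) set set" where
  "active_mesh \<T> \<Omega> = {T\<in>\<T>. T \<inter> \<Omega> \<noteq> {}}"

definition active_domain :: "(real^'n) set set \<Rightarrow> (real^'n) set \<Rightarrow> (real^'n) set" where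
  "active_domain \<T> \<Omega> = \<Union>(active_mesh \<T> \<Omega>)"

text \<open>A function on the active domain is represented by its extension by zero, so that equality
  of representatives is equality on the active domain.\<close>

definition active_space ::
    "nat \<Rightarrow> (real^'n) set set \<Rightarrow> (real^'n) set \<Rightarrow> (real^'n \<Rightarrow> real) set" where
  "active_space k \<T> \<Omega> =
     {v. \<exists>w\<in>fe_space k \<T>. v = (\<lambda>x. if x \<in> active_domain \<T> \<Omega> then w x else 0)}"

text \<open>The principal lattice of order \<open>k\<close>: the points whose barycentric coordinates with respect to
  the vertices of \<open>T\<close> are multiples of \<open>1/k\<close>.\<close>

definition lagrange_nodes :: "nat \<Rightarrow> (real^'n) set \<Rightarrow> (real^'n) set" where
  "lagrange_nodes k T =
     {x. \<exists>\<beta> :: real^'n \<Rightarrow> nat. (\<Sum>a | a extreme_point_of T. \<beta> a) = k \<and>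
        x = (\<Sum>a | a extreme_point_of T. (real (\<beta> a) / real k) *\<^sub>R a)}"

text \<open>The index set \<open>I\<close>: a basis function is indexed by its node.\<close>

definition node_set :: "nat \<Rightarrow> (real^'n) set set \<Rightarrow> (real^'n) set \<Rightarrow> (real^'n) set" where
  "node_set k \<T> \<Omega> = (\<Union>T\<in>active_mesh \<T> \<Omega>. lagrange_nodes k T)"

definition fe_basis ::
    "nat \<Rightarrow> (real^'n) set set \<Rightarrow> (real^'n) set \<Rightarrow> real^'n \<Rightarrow> (real^'n \<Rightarrow> real)" where
  "fe_basis k \<T> \<Omega> i = (THE v. v \<in> active_space k \<T> \<Omega> \<and>
     (\<forall>j\<in>node_set k \<T> \<Omega>. v j = (if j = i then 1 else 0)))"

definition elem_indices ::
    "nat \<Rightarrow> (real^'n) set set \<Rightarrow> (real^'n) set \<Rightarrow> (real^'n) set \<Rightarrow> (real^'n) set" where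
  "elem_indices k \<T> \<Omega> T = {j\<in>node_set k \<T> \<Omega>. T \<subseteq> supp (fe_basis k \<T> \<Omega> j)}"

text \<open>The functional dual to the element basis: the coefficient of the \<open>i\<close>-th basis function in the
  expansion of \<open>p\<close> restricted to \<open>T\<close>.  Meaningful for \<open>i\<close> in \<^term>\<open>elem_indices k \<T> \<Omega> T\<close>.\<close>

definition elem_dof ::
    "nat \<Rightarrow> (real^'n) set set \<Rightarrow> (real^'n) set \<Rightarrow> real^'n \<Rightarrow> (real^'n) set \<Rightarrow>
     (real^'n \<Rightarrow> real) \<Rightarrow> real" where
  "elem_dof k \<T> \<Omega> i T p = (THE c. \<exists>a. a i = c \<and>
     (\<forall>x\<in>T. p x = (\<Sum>j\<in>elem_indices k \<T> \<Omega> T. a j * fe_basis k \<T> \<Omega> j x)))"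

definition poly_ext :: "nat \<Rightarrow> (real^'n) set \<Rightarrow> (real^'n \<Rightarrow> real) \<Rightarrow> (real^'n \<Rightarrow> real)" where
  "poly_ext k T v = (THE p. p \<in> Pk k \<and> (\<forall>x\<in>T. p x = v x))"

definition elem_jump ::
    "nat \<Rightarrow> (real^'n \<Rightarrow> real) \<Rightarrow> (real^'n) set \<Rightarrow> (real^'n) set \<Rightarrow> (real^'n \<Rightarrow> real)" where
  "elem_jump k v T1 T2 = (\<lambda>x. poly_ext k T1 v x - poly_ext k T2 v x)"

definition large_elems :: "real \<Rightarrow> (real^'n) set set \<Rightarrow> (real^'n) set \<Rightarrow> (real^'n) set set" where
  "large_elems \<gamma> \<T> \<Omega> =
     {T\<in>active_mesh \<T> \<Omega>. measure lebesgue (T \<inter> \<Omega>) \<ge> \<gamma> * measure lebesgue T}"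

definition small_elems :: "real \<Rightarrow> (real^'n) set set \<Rightarrow> (real^'n) set \<Rightarrow> (real^'n) set set" where
  "small_elems \<gamma> \<T> \<Omega> = active_mesh \<T> \<Omega> - large_elems \<gamma> \<T> \<Omega>"

definition small_indices ::
    "nat \<Rightarrow> real \<Rightarrow> (real^'n) set set \<Rightarrow> (real^'n) set \<Rightarrow> (real^'n) set" where
  "small_indices k \<gamma> \<T> \<Omega> =
     {i\<in>node_set k \<T> \<Omega>. \<not> (\<exists>T\<in>large_elems \<gamma> \<T> \<Omega>. T \<subseteq> supp (fe_basis k \<T> \<Omega> i))}"

definition nodal_stab ::
    "nat \<Rightarrow> real \<Rightarrow> real \<Rightarrow> (real^'n) set set \<Rightarrow> (real^'n) set \<Rightarrow>
     ((real^'n) set \<Rightarrow> (real^'n) set) \<Rightarrow> (real^'n \<Rightarrow> (real^'n) set) \<Rightarrow> real \<Rightarrow> nat \<Rightarrow>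
     (real^'n \<Rightarrow> real) \<Rightarrow> (real^'n \<Rightarrow> real) \<Rightarrow> real" where
  "nodal_stab k \<gamma> \<tau> \<T> \<Omega> S Ti h m v w =
     (\<Sum>i\<in>small_indices k \<gamma> \<T> \<Omega>.
        \<tau> * h powi (int CARD('n) - 2 * int m)
          * elem_dof k \<T> \<Omega> i (Ti i) (elem_jump k v (Ti i) (S (Ti i)))
          * elem_dof k \<T> \<Omega> i (Ti i) (elem_jump k w (Ti i) (S (Ti i))))"

text \<open>A path in \<open>\<M>\<close> from \<open>T\<close> to \<open>T'\<close> with at most \<open>N\<close> elements.  A face means a face of
  codimension one.\<close>

definition elem_path ::
    "(real^'n) set set \<Rightarrow> nat \<Rightarrow> (real^'n) set \<Rightarrow> (real^'n) set \<Rightarrow> (real^'n) set list \<Rightarrow> bool" where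
  "elem_path \<M> N T T' P \<longleftrightarrow>
     P \<noteq> [] \<and> set P \<subseteq> \<M> \<and> hd P = T \<and> last P = T' \<and> length P \<le> N \<and>
     successively (\<lambda>K K'. \<exists>F. F facet_of K \<and> F facet_of K') P"

definition assumption_A2 ::
    "nat \<Rightarrow> real \<Rightarrow> (real^'n) set set \<Rightarrow> (real^'n) set \<Rightarrow>
     ((real^'n) set \<Rightarrow> (real^'n) set) \<Rightarrow> bool" where
  "assumption_A2 N \<gamma> \<T> \<Omega> S \<longleftrightarrow>
     (\<forall>T\<in>small_elems \<gamma> \<T> \<Omega>. \<exists>P. elem_path (active_mesh \<T> \<Omega>) N T (S T) P)"

definition assumption_A3 ::
    "nat \<Rightarrow> nat \<Rightarrow> real \<Rightarrow> (real^'n) set set \<Rightarrow> (real^'n) set \<Rightarrow>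
     ((real^'n) set \<Rightarrow> (real^'n) set) \<Rightarrow> bool" where
  "assumption_A3 N k \<gamma> \<T> \<Omega> S \<longleftrightarrow>
     (\<forall>i\<in>node_set k \<T> \<Omega>.
        (\<forall>T1\<in>small_elems \<gamma> \<T> \<Omega>. \<forall>T2\<in>small_elems \<gamma> \<T> \<Omega>.
           T1 \<subseteq> supp (fe_basis k \<T> \<Omega> i) \<and> T2 \<subseteq> supp (fe_basis k \<T> \<Omega> i) \<longrightarrow>
           (\<exists>P. elem_path (large_elems \<gamma> \<T> \<Omega>) N (S T1) (S T2) P)) \<and>
        (\<forall>T1\<in>large_elems \<gamma> \<T> \<Omega>. \<forall>T2\<in>small_elems \<gamma> \<T> \<Omega>.
           T1 \<subseteq> supp (fe_basis k \<T> \<Omega> i) \<and> T2 \<subseteq> supp (fe_basis k \<T> \<Omega> i) \<longrightarrow>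
           (\<exists>P. elem_path (large_elems \<gamma> \<T> \<Omega>) N T1 (S T2) P)))"

end

theory Submission imports Defs begin

text \<open>On a small element \<open>T\<close> the polynomial \<open>v\<close> is controlled by its nodal values, after subtraction of the value
  of \<open>v\<close> at a point of \<open>S T\<close> if \<open>m = 1\<close>.  A node of \<open>T\<close> lies in a large element, or \<open>v\<close> is there the sum of
  the stabilized quantity and of the extension of \<open>v\<close> from a large element.  In both cases a path of large
  elements of bounded length leads to \<open>S T\<close>, and \<open>v\<close> is continuous along it, so it suffices to bound a
  polynomial and its increments near a large element \<open>K\<close> by its norm on \<open>K \<inter> \<Omega>\<close>.  As nothing is known about
  the shape of \<open>K \<inter> \<Omega>\<close>, this takes a Remez inequality.  Only boundedly many elements are involved
  in each local estimate, so the local estimates can be summed.\<close>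

section \<open>Polynomials of bounded degree\<close>

text \<open>The sets \<open>K \<inter> \<Omega>\<close> have no common reference shape, so nothing
  is scaled to a reference element. Every polynomial estimate is made for a set \<open>A\<close> of
  which only \<open>thick R \<mu> h z A\<close> is known; its constant depends on \<open>R\<close>,
  \<open>\<mu>\<close>, the degree and the dimension. The point of evaluation ranges over the whole
  ball and not over \<open>A\<close>, so the same estimate covers the extension of a polynomial from
  a large element to a node outside it. For m = 0 the norm on \<open>K \<inter> \<Omega>\<close>
  bounds values, and each node of a small element can be treated by itself. For m = 1 it bounds
  increments only, and the gradient is blind to constants: all nodal values of an element must be
  compared with one number, whichever large elements they come from. The paths of A3 serve this
  comparison; those of A2 bound the distance from a stabilized node i to \<open>S (Ti i)\<close>.
  The weight h^(d-2m) is the volume scale of an element, divided for m = 1 by the square of the h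
  lost in the inverse inequality.\<close>

lemma finite_multi_indices: "finite {\<alpha>::'n::finite \<Rightarrow> nat. (\<Sum>j\<in>UNIV. \<alpha> j) \<le> k}"
proof (rule finite_subset)
  show "{\<alpha>::'n \<Rightarrow> nat. (\<Sum>j\<in>UNIV. \<alpha> j) \<le> k} \<subseteq> {\<alpha>. \<forall>i. (i \<in> UNIV \<longrightarrow> \<alpha> i \<in> {..k}) \<and> (i \<notin> UNIV \<longrightarrow> \<alpha> i = 0)}"
  proof clarsimp
    fix \<alpha> :: "'n \<Rightarrow> nat" and i assume "sum \<alpha> UNIV \<le> k"
    then show "\<alpha> i \<le> k" using member_le_sum[of i UNIV \<alpha>] by simp
  qed
qed (rule finite_set_of_finite_funs; simp)

lemma Pk_add: "p \<in> Pk k \<Longrightarrow> q \<in> Pk k \<Longrightarrow> (\<lambda>x. p x + q x) \<in> Pk k"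
proof -
  assume "p \<in> Pk k" "q \<in> Pk k"
  then obtain c d where "p = (\<lambda>x. \<Sum>\<alpha> | (\<Sum>j\<in>UNIV. \<alpha> j) \<le> k. c \<alpha> * (\<Prod>j\<in>UNIV. (x $ j) ^ \<alpha> j))"
    "q = (\<lambda>x. \<Sum>\<alpha> | (\<Sum>j\<in>UNIV. \<alpha> j) \<le> k. d \<alpha> * (\<Prod>j\<in>UNIV. (x $ j) ^ \<alpha> j))"
    unfolding Pk_def by blast
  then show ?thesis
    unfolding Pk_def
    by (auto simp: sum.distrib ring_distribs intro!: exI[of _ "\<lambda>\<alpha>. c \<alpha> + d \<alpha>"])
qed

lemma Pk_monomial:
  assumes "(\<Sum>j\<in>UNIV. \<alpha> j) \<le> k"
  shows "(\<lambda>x::real^'n. c * (\<Prod>j\<in>UNIV. (x $ j) ^ \<alpha> j)) \<in> Pk k"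
proof -
  have "(\<Sum>\<beta> | (\<Sum>j\<in>UNIV. \<beta> j) \<le> k. (if \<beta> = \<alpha> then c else 0) * (\<Prod>j\<in>UNIV. (x $ j) ^ \<beta> j))
      = c * (\<Prod>j\<in>UNIV. (x $ j) ^ \<alpha> j)" for x :: "real^'n"
    using assms finite_multi_indices[of k]
    by (subst sum.mono_neutral_right[where S="{\<alpha>}"]) auto
  then show ?thesis
    unfolding Pk_def by (auto intro!: exI[of _ "\<lambda>\<beta>. if \<beta> = \<alpha> then c else 0"])
qed

lemma Pk_const: "(\<lambda>_. c) \<in> Pk k"
  using Pk_monomial[of "\<lambda>_. 0" k c] by simp

lemma Pk_sum: "(\<And>i. i \<in> I \<Longrightarrow> f i \<in> Pk k) \<Longrightarrow> (\<lambda>x. \<Sum>i\<in>I. f i x) \<in> Pk k"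
  by (induction I rule: infinite_finite_induct) (auto intro: Pk_add Pk_const)

lemma Pk_coord_mult: 
  assumes "p \<in> Pk k" shows "(\<lambda>x::real^'n. x $ i * p x) \<in> Pk (Suc k)"
proof -
  from assms obtain c where c: "p = (\<lambda>x. \<Sum>\<alpha> | (\<Sum>j\<in>UNIV. \<alpha> j) \<le> k. c \<alpha> * (\<Prod>j\<in>UNIV. (x $ j) ^ \<alpha> j))"
    unfolding Pk_def by blast
  have eq: "x $ i * p x = (\<Sum>\<alpha> | (\<Sum>j\<in>UNIV. \<alpha> j) \<le> k. c \<alpha> * (\<Prod>j\<in>UNIV. (x $ j) ^ (\<alpha>(i := Suc (\<alpha> i))) j))" 
    for x :: "real^'n"
  proof -
    have "(\<Prod>j\<in>UNIV. (x $ j) ^ (\<alpha>(i := Suc (\<alpha> i))) j) = x $ i * (\<Prod>j\<in>UNIV. (x $ j) ^ \<alpha> j)" for \<alpha>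
    proof -
      have "(\<Prod>j\<in>UNIV - {i}. (x $ j) ^ (\<alpha>(i := Suc (\<alpha> i))) j) = (\<Prod>j\<in>UNIV - {i}. (x $ j) ^ \<alpha> j)"
        by (rule prod.cong) auto
      then show ?thesis by (simp add: prod.remove[of UNIV i])
    qed
    then show ?thesis by (simp add: c sum_distrib_left mult_ac)
  qed
  have "(\<Sum>j\<in>UNIV. (\<alpha>(i := Suc (\<alpha> i))) j) = Suc (\<Sum>j\<in>UNIV. \<alpha> j)" for \<alpha> :: "'n \<Rightarrow> nat"
  proof -
    have "(\<Sum>j\<in>UNIV - {i}. (\<alpha>(i := Suc (\<alpha> i))) j) = (\<Sum>j\<in>UNIV - {i}. \<alpha> j)"
      by (rule sum.cong) auto
    then show ?thesis by (simp add: sum.remove[of UNIV i])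
  qed
  then show ?thesis unfolding eq by (intro Pk_sum Pk_monomial) auto
qed

text \<open>Constants, sums and multiplication by a coordinate generate all polynomials: a
  nonconstant monomial splits off one coordinate. The degree bound varies in the induction, so
  \<open>Q\<close> may depend on it. Products, restrictions to lines, differences and gradients are
  all treated by these three cases.\<close>

lemma Pk_induct [consumes 1, case_names const add coord]:
  fixes Q :: "nat \<Rightarrow> (real^'n \<Rightarrow> real) \<Rightarrow> bool"
  assumes "p \<in> Pk k"
    and const: "\<And>k c. Q k (\<lambda>_. c)"
    and add: "\<And>k p q. p \<in> Pk k \<Longrightarrow> q \<in> Pk k \<Longrightarrow> Q k p \<Longrightarrow> Q k q \<Longrightarrow> Q k (\<lambda>x. p x + q x)"
    and coord: "\<And>k p j. p \<in> Pk k \<Longrightarrow> Q k p \<Longrightarrow> Q (Suc k) (\<lambda>x. x $ j * p x)"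
  shows "Q k p"
proof -
  have mono: "Q k (\<lambda>x. c * (\<Prod>j\<in>UNIV. (x $ j) ^ \<alpha> j))" if "(\<Sum>j\<in>UNIV. \<alpha> j) \<le> k" for c \<alpha> k
    using that
  proof (induction k arbitrary: \<alpha>)
    case 0
    then have "\<alpha> = (\<lambda>_. 0)" by auto
    then show ?case using const by simp
  next
    case (Suc k)
    show ?case
    proof (cases "\<alpha> = (\<lambda>_. 0)")
      case True
      then show ?thesis using const by simp
    next
      case False
      then obtain i where i: "\<alpha> i \<noteq> 0" by auto
      define \<beta> where "\<beta> = \<alpha>(i := \<alpha> i - 1)"
      have "(\<Sum>j\<in>UNIV - {i}. \<beta> j) = (\<Sum>j\<in>UNIV - {i}. \<alpha> j)"
        by (rule sum.cong) (auto simp: \<beta>_def)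
      then have "(\<Sum>j\<in>UNIV. \<beta> j) \<le> k"
        using Suc.prems i by (simp add: sum.remove[of UNIV i] \<beta>_def)
      then have IH: "Q (Suc k) (\<lambda>x. x $ i * (c * (\<Prod>j\<in>UNIV. (x $ j) ^ \<beta> j)))"
        by (intro coord Pk_monomial Suc.IH)
      have "x $ i * (c * (\<Prod>j\<in>UNIV. (x $ j) ^ \<beta> j)) = c * (\<Prod>j\<in>UNIV. (x $ j) ^ \<alpha> j)" for x :: "real^'n"
      proof -
        have "(\<Prod>j\<in>UNIV - {i}. (x $ j) ^ \<beta> j) = (\<Prod>j\<in>UNIV - {i}. (x $ j) ^ \<alpha> j)"
          by (rule prod.cong) (auto simp: \<beta>_def)
        moreover have "x $ i * (x $ i) ^ \<beta> i = (x $ i) ^ \<alpha> i"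
          using i by (cases "\<alpha> i") (auto simp: \<beta>_def)
        ultimately show ?thesis by (simp add: prod.remove[of UNIV i] mult_ac)
      qed
      then show ?thesis using IH by presburger
    qed
  qed
  obtain c where c: "p = (\<lambda>x. \<Sum>\<alpha> | (\<Sum>j\<in>UNIV. \<alpha> j) \<le> k. c \<alpha> * (\<Prod>j\<in>UNIV. (x $ j) ^ \<alpha> j))"
    using assms(1) unfolding Pk_def by blast
  have "Q k (\<lambda>x. \<Sum>\<alpha>\<in>I. c \<alpha> * (\<Prod>j\<in>UNIV. (x $ j) ^ \<alpha> j))"
    if "I \<subseteq> {\<alpha>. (\<Sum>j\<in>UNIV. \<alpha> j) \<le> k}" for I
    using finite_subset[OF that finite_multi_indices] that
  proof (induction I rule: finite_induct)
    case (insert \<alpha> I)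
    then show ?case
      by simp (intro add Pk_sum Pk_monomial mono; auto)
  qed (simp add: const)
  then show ?thesis unfolding c by blast
qed

lemma Pk_Suc: "p \<in> Pk k \<Longrightarrow> p \<in> Pk (Suc k)"
  by (induction rule: Pk_induct) (auto intro: Pk_const Pk_add Pk_coord_mult)

lemma Pk_mono: "p \<in> Pk k \<Longrightarrow> k \<le> l \<Longrightarrow> p \<in> Pk l"
  by (induction l) (auto simp: le_Suc_eq intro: Pk_Suc)

lemma Pk_mult:
  assumes "p \<in> Pk a" "q \<in> Pk b" shows "(\<lambda>x. p x * q x) \<in> Pk (a + b)"
  using assms(1)
proof (induction rule: Pk_induct)
  case (const k c)
  have "(\<lambda>x. c * q x) \<in> Pk b"
    using assms(2) 
  proof -
    obtain d where "q = (\<lambda>x. \<Sum>\<alpha> | (\<Sum>j\<in>UNIV. \<alpha> j) \<le> b. d \<alpha> * (\<Prod>j\<in>UNIV. (x $ j) ^ \<alpha> j))"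
      using assms(2) unfolding Pk_def by blast
    then have "(\<lambda>x. c * q x) = (\<lambda>x. \<Sum>\<alpha> | (\<Sum>j\<in>UNIV. \<alpha> j) \<le> b. (c * d \<alpha>) * (\<Prod>j\<in>UNIV. (x $ j) ^ \<alpha> j))"
      by (simp add: sum_distrib_left mult.assoc)
    then show ?thesis unfolding Pk_def by (auto intro!: exI[of _ "\<lambda>\<alpha>. c * d \<alpha>"])
  qed
  then show ?case by (rule Pk_mono) simp
next
  case (add k p r)
  then show ?case using Pk_add by (simp add: ring_distribs)
next
  case (coord k p j)
  then show ?case using Pk_coord_mult by (simp add: mult.assoc)
qed

lemma Pk_cmult: "p \<in> Pk k \<Longrightarrow> (\<lambda>x. c * p x) \<in> Pk k"
  using Pk_mult[OF Pk_const[of c 0]] by simp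

lemma Pk_diff: "p \<in> Pk k \<Longrightarrow> q \<in> Pk k \<Longrightarrow> (\<lambda>x. p x - q x) \<in> Pk k"
  using Pk_add[of p k "\<lambda>x. -1 * q x"] Pk_cmult[of q k "-1"] by simp

lemma Pk_prod:
  assumes "finite I" "\<And>i. i \<in> I \<Longrightarrow> f i \<in> Pk (n i)"
  shows "(\<lambda>x. \<Prod>i\<in>I. f i x) \<in> Pk (\<Sum>i\<in>I. n i)"
  using assms by (induction I) (auto intro: Pk_mult Pk_const)

lemma Pk_affine: "(\<lambda>x::real^'n. w \<bullet> x + c) \<in> Pk 1"
proof -
  have "(\<lambda>x::real^'n. x $ j * w $ j) \<in> Pk 1" for j
    using Pk_coord_mult[OF Pk_const[of "w $ j" 0]] by simp
  then show ?thesis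
    unfolding inner_vec_def by (auto intro!: Pk_add Pk_const Pk_sum simp: mult.commute)
qed

lemma Pk_0_const: "p \<in> Pk 0 \<Longrightarrow> p x = p y"
proof -
  have "k = 0 \<longrightarrow> p x = p y" if "p \<in> Pk k" for k using that
    by (induction rule: Pk_induct) auto
  then show "p \<in> Pk 0 \<Longrightarrow> p x = p y" by blast
qed

lemma Pk_continuous: "p \<in> Pk k \<Longrightarrow> continuous_on X p"
  by (induction rule: Pk_induct) (auto intro!: continuous_intros)

text \<open>The bridge to univariate polynomials, where root counting and interpolation are
  available.\<close>

lemma Pk_line:
  assumes "p \<in> Pk k"
  shows "\<exists>q::real poly. degree q \<le> k \<and> (\<forall>t. p (x + t *\<^sub>R u) = poly q t)"
  using assms
proof (induction rule: Pk_induct)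
  case (const k c)
  show ?case by (rule exI[of _ "[:c:]"]) simp
next
  case (add k p r)
  then obtain q q' where "degree q \<le> k" "\<forall>t. p (x + t *\<^sub>R u) = poly q t"
     "degree q' \<le> k" "\<forall>t. r (x + t *\<^sub>R u) = poly q' t" by auto
  then show ?case by (intro exI[of _ "q + q'"]) (auto intro: degree_add_le)
next
  case (coord k p j)
  then obtain q where q: "degree q \<le> k" "\<forall>t. p (x + t *\<^sub>R u) = poly q t" by auto
  have "degree ([:x $ j, u $ j:] * q) \<le> degree [:x $ j, u $ j:] + degree q"
    by (rule degree_mult_le)
  also have "\<dots> \<le> Suc k" using q(1) by (auto intro: order_trans[of _ 1])
  finally show ?case using q(2)
    by (intro exI[of _ "[:x $ j, u $ j:] * q"]) (auto simp: algebra_simps)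
qed

text \<open>The first conclusion is the aim; the induction carries the other two. The shifted
  polynomial appears in the discrete product rule, and for \<open>k = 0\<close> the truncated
  \<open>k - 1\<close> gives only a constant difference, whose product with a coordinate would have
  degree 1 where degree 0 is claimed. So the difference must be known to vanish there.\<close>

lemma Pk_difference:
  assumes "p \<in> Pk k"
  shows "(\<lambda>x. p (x + u) - p x) \<in> Pk (k - 1) \<and> (\<lambda>x. p (x + u)) \<in> Pk k \<and> (k = 0 \<longrightarrow> (\<forall>x. p (x + u) = p x))"
  using assms
proof (induction rule: Pk_induct)
  case (add k p q)
  have "(\<lambda>x. p (x + u) + q (x + u) - (p x + q x)) = (\<lambda>x. (p (x + u) - p x) + (q (x + u) - q x))"
    by (simp add: algebra_simps)
  then show ?case using add by (auto intro: Pk_add)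
next
  case (coord k p j)
  \<comment> \<open>The product rule for differences.\<close>
  have eq: "(x + u) $ j * p (x + u) - x $ j * p x = x $ j * (p (x + u) - p x) + u $ j * p (x + u)"
    "(x + u) $ j * p (x + u) = x $ j * p (x + u) + u $ j * p (x + u)" for x
    by (simp_all add: algebra_simps)
  have "(\<lambda>x. x $ j * (p (x + u) - p x)) \<in> Pk k"
  proof (cases k)
    case 0
    then show ?thesis using coord Pk_const[of 0] by simp
  next
    case (Suc l)
    then show ?thesis using coord Pk_coord_mult by auto
  qed
  then have "(\<lambda>x. x $ j * (p (x + u) - p x) + u $ j * p (x + u)) \<in> Pk (Suc k - 1)"
    using coord by (auto intro: Pk_add Pk_cmult)
  then have "(\<lambda>x. (x + u) $ j * p (x + u) - x $ j * p x) \<in> Pk (Suc k - 1)"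
    unfolding eq(1) .
  moreover have "(\<lambda>x. x $ j * p (x + u) + u $ j * p (x + u)) \<in> Pk (Suc k)"
    by (intro Pk_add Pk_cmult Pk_coord_mult Pk_Suc) (use coord in auto)
  ultimately show ?case unfolding eq(2) by simp
qed (auto intro: Pk_const)

text \<open>The bound \<open>k\<close> for the partial derivatives avoids truncated subtraction and
  is good enough to apply Remez-type estimates to them.\<close>

lemma Pk_has_gradient:
  fixes p :: "real^'n \<Rightarrow> real"
  assumes "p \<in> Pk k"
  shows "\<exists>g. (\<forall>j. (\<lambda>x. g x $ j) \<in> Pk k) \<and> (\<forall>x. (p has_derivative (\<lambda>v. g x \<bullet> v)) (at x))"
  using assms
proof (induction rule: Pk_induct)
  case (const k c)
  show ?case by (rule exI[of _ "\<lambda>x. 0"]) (auto intro: Pk_const)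
next
  case (add k p q)
  then obtain g f where "\<forall>j. (\<lambda>x. g x $ j) \<in> Pk k" "\<forall>x. (p has_derivative (\<lambda>v. g x \<bullet> v)) (at x)"
    "\<forall>j. (\<lambda>x. f x $ j) \<in> Pk k" "\<forall>x. (q has_derivative (\<lambda>v. f x \<bullet> v)) (at x)" by auto
  then show ?case
    by (intro exI[of _ "\<lambda>x. g x + f x"])
      (auto intro!: Pk_add derivative_eq_intros simp: inner_add_left)
next
  case (coord k p j)
  then obtain g where g: "\<forall>j. (\<lambda>x. g x $ j) \<in> Pk k" "\<forall>x. (p has_derivative (\<lambda>v. g x \<bullet> v)) (at x)"
    by auto
  have "(\<lambda>x. x $ j * g x $ i + axis j 1 $ i * p x) \<in> Pk (Suc k)" for i
    using g(1) coord(1) by (auto intro!: Pk_add Pk_cmult Pk_coord_mult intro: Pk_Suc)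
  moreover have "((\<lambda>x. x $ j * p x) has_derivative (\<lambda>v. (x $ j *\<^sub>R g x + p x *\<^sub>R axis j 1) \<bullet> v)) (at x)" for x
    using g(2)[rule_format, of x]
    by (auto intro!: derivative_eq_intros simp: inner_add_left inner_axis' bounded_linear_imp_has_derivative bounded_linear_vec_nth)
  ultimately show ?case
    by (intro exI[of _ "\<lambda>x. x $ j *\<^sub>R g x + p x *\<^sub>R axis j 1"]) (auto simp: mult_ac)
qed

lemma grad_eqI: "(p has_derivative (\<lambda>v. g \<bullet> v)) (at x) \<Longrightarrow> grad p x = g"
  by (simp add: grad_def frechet_derivative_at[symmetric] vec_eq_iff inner_axis)

lemma Pk_grad: "p \<in> Pk k \<Longrightarrow> (\<lambda>x. grad p x $ j) \<in> Pk k"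
  using Pk_has_gradient[of p k] grad_eqI[of p] by (metis (no_types, lifting) ext)

lemma Pk_has_derivative: "p \<in> Pk k \<Longrightarrow> (p has_derivative (\<lambda>v. grad p x \<bullet> v)) (at x)"
  using Pk_has_gradient[of p k] grad_eqI[of p] by metis

section \<open>Remez inequality\<close>

text \<open>The difference \<open>e\<close> of both sides has degree less than \<open>card S\<close>
  and vanishes on \<open>S\<close>.\<close>

lemma lagrange_interpolation:
  fixes q :: "real poly"
  assumes S: "finite S" "degree q < card S"
  shows "q = (\<Sum>s\<in>S. smult (poly q s) (\<Prod>r\<in>S - {s}. smult (inverse (s - r)) [:- r, 1:]))"
proof (rule ccontr)
  define L where "L s = (\<Prod>r\<in>S - {s}. smult (inverse (s - r)) [:- r, 1:])" for s
  define e where "e = q - (\<Sum>s\<in>S. smult (poly q s) (L s))"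
  assume "\<not> ?thesis"
  then have "e \<noteq> 0" by (auto simp: e_def L_def)
  have deg_L: "degree (L s) \<le> card S - 1" if "s \<in> S" for s
  proof -
    have "degree (L s) \<le> (\<Sum>r\<in>S - {s}. degree (smult (inverse (s - r)) [:- r, 1:]))"
      unfolding L_def using S by (intro degree_prod_sum_le[unfolded o_def]) auto
    also have "\<dots> \<le> (\<Sum>r\<in>S - {s}. 1)"
      by (intro sum_mono order_trans[OF degree_smult_le]) auto
    finally show ?thesis using S that by simp
  qed
  then have "degree e \<le> card S - 1"
    unfolding e_def using S by (intro degree_diff_le degree_sum_le order_trans[OF degree_smult_le]) auto
  moreover have "S \<subseteq> {x. poly e x = 0}"
  proof
    fix t assume t: "t \<in> S"
    have "poly (L s) t = (if s = t then 1 else 0)" if "s \<in> S" for s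
    proof (cases "s = t")
      case True
      have "inverse (t - r) * (t - r) = 1" if "r \<in> S - {t}" for r using that by simp
      then show ?thesis using True by (auto simp: L_def poly_prod algebra_simps intro!: prod.neutral)
    next
      case False
      then show ?thesis using S t by (auto simp: L_def poly_prod intro!: bexI[of _ t])
    qed
    then have "(\<Sum>s\<in>S. poly q s * poly (L s) t) = (\<Sum>s\<in>S. if s = t then poly q t else 0)"
      by (intro sum.cong) auto
    then show "t \<in> {x. poly e x = 0}" using t S by (simp add: e_def poly_sum)
  qed
  ultimately have "card S \<le> card S - 1"
    using card_poly_roots_bound[OF \<open>e \<noteq> 0\<close>] card_mono[OF poly_roots_finite[OF \<open>e \<noteq> 0\<close>]]
    by (meson le_trans)
  then show False using S by simp
qed

text \<open>The one-dimensional core of the inverse inequality: a derivative is bounded by values at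
  \<open>k + 1\<close> equally spaced points, through the derivatives of the Lagrange polynomials at
  0.\<close>

lemma pderiv_bound_nodes:
  "\<exists>C>0. \<forall>q::real poly. \<forall>M. degree q \<le> k \<and> (\<forall>i\<le>k. \<bar>poly q (real i)\<bar> \<le> M) \<longrightarrow> \<bar>poly (pderiv q) 0\<bar> \<le> C * M"
proof -
  define S where "S = real ` {..k}"
  define L where "L s = (\<Prod>r\<in>S - {s}. smult (inverse (s - r)) [:- r, 1:])" for s
  define C where "C = (\<Sum>s\<in>S. \<bar>poly (pderiv (L s)) 0\<bar>)"
  have S: "finite S" "card S = Suc k" by (auto simp: S_def card_image)
  \<comment> \<open>\<open>C\<close> vanishes for \<open>k = 0\<close>; adding 1 makes the constant
    positive.\<close>
  have "\<bar>poly (pderiv q) 0\<bar> \<le> (1 + C) * M"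
    if q: "degree q \<le> k" "\<forall>i\<le>k. \<bar>poly q (real i)\<bar> \<le> M" for q :: "real poly" and M
  proof -
    have "q = (\<Sum>s\<in>S. smult (poly q s) (L s))"
      unfolding L_def by (rule lagrange_interpolation) (use q S in auto)
    then have "pderiv q = (\<Sum>s\<in>S. smult (poly q s) (pderiv (L s)))"
      using higher_pderiv_sum[of 1 "\<lambda>s. smult (poly q s) (L s)" S] by (simp add: pderiv_smult)
    then have "\<bar>poly (pderiv q) 0\<bar> = \<bar>\<Sum>s\<in>S. poly q s * poly (pderiv (L s)) 0\<bar>"
      by (simp add: poly_sum)
    also have "\<dots> \<le> (\<Sum>s\<in>S. M * \<bar>poly (pderiv (L s)) 0\<bar>)"
      by (intro order_trans[OF sum_abs] sum_mono) (use q in \<open>auto simp: abs_mult S_def intro!: mult_right_mono\<close>)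
    also have "\<dots> = C * M" by (simp add: C_def sum_distrib_left mult.commute)
    also have "\<dots> \<le> (1 + C) * M" using q(2)[rule_format, of 0] by (simp add: algebra_simps)
    finally show ?thesis .
  qed
  moreover have "1 + C > 0" unfolding C_def by (intro add_pos_nonneg sum_nonneg) auto
  ultimately show ?thesis by blast
qed

text \<open>At 0 each Lagrange polynomial is a product of \<open>k\<close> factors of size |r| / |s
  - r|, and each factor is at most \<open>B\<close>.\<close>

lemma poly_0_bound_nodes:
  fixes q :: "real poly" and M B :: real
  assumes S: "finite S" "card S = Suc k" "degree q \<le> k" and M: "\<And>s. s \<in> S \<Longrightarrow> \<bar>poly q s\<bar> \<le> M"
    and B: "\<And>s. s \<in> S \<Longrightarrow> \<bar>s\<bar> \<le> 1" "\<And>r s. r \<in> S \<Longrightarrow> s \<in> S \<Longrightarrow> r \<noteq> s \<Longrightarrow> 1 / B \<le> \<bar>s - r\<bar>" "B > 0"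
  shows "\<bar>poly q 0\<bar> \<le> real (Suc k) * B ^ k * M"
proof -
  define L where "L s = (\<Prod>r\<in>S - {s}. smult (inverse (s - r)) [:- r, 1:])" for s
  have "M \<ge> 0" using S M by (metis abs_ge_zero card_0_eq ex_in_conv nat.simps(3) order_trans)
  have L: "\<bar>poly (L s) 0\<bar> \<le> B ^ k" if "s \<in> S" for s
  proof -
    have "\<bar>poly (L s) 0\<bar> = (\<Prod>r\<in>S - {s}. \<bar>r\<bar> / \<bar>s - r\<bar>)"
      by (auto simp: L_def poly_prod abs_prod divide_inverse abs_mult mult.commute intro!: prod.cong)
    also have "\<dots> \<le> (\<Prod>r\<in>S - {s}. B)"
    proof (rule prod_mono)
      fix r assume r: "r \<in> S - {s}"
      then have "1 / B \<le> \<bar>s - r\<bar>" "\<bar>r\<bar> \<le> 1" using B that by auto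
      moreover from this have "\<bar>s - r\<bar> > 0" using B(3) by (metis order_less_le_trans zero_less_divide_1_iff)
      ultimately show "0 \<le> \<bar>r\<bar> / \<bar>s - r\<bar> \<and> \<bar>r\<bar> / \<bar>s - r\<bar> \<le> B"
        using B(3) by (auto simp: divide_simps mult.commute intro: order_trans[of _ 1])
    qed
    finally show ?thesis using S that by simp
  qed
  have "q = (\<Sum>s\<in>S. smult (poly q s) (L s))"
    unfolding L_def by (rule lagrange_interpolation) (use S in auto)
  then have "\<bar>poly q 0\<bar> = \<bar>\<Sum>s\<in>S. poly q s * poly (L s) 0\<bar>"
    by (metis (no_types, lifting) poly_smult poly_sum sum.cong)
  also have "\<dots> \<le> (\<Sum>s\<in>S. M * B ^ k)"
    by (intro order_trans[OF sum_abs] sum_mono) (use M L \<open>M \<ge> 0\<close> in \<open>auto simp: abs_mult intro!: mult_mono\<close>)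
  finally show ?thesis using S by (simp add: mult_ac)
qed

section \<open>Dilates and overlapping sets\<close>

text \<open>The preimage under the contraction towards \<open>x\<close> is the dilate of
  \<open>A\<close> by 1/s, so its measure is that of \<open>A\<close> times s^(-d), a factor of at
  least 1.\<close>

lemma affine_preimage_lmeasurable:
  fixes A :: "(real^'n) set"
  assumes A: "A \<in> lmeasurable" "0 < s" "s \<le> 1"
  shows "{y. x + s *\<^sub>R (y - x) \<in> A} \<in> lmeasurable" 
    "measure lebesgue A \<le> measure lebesgue {y. x + s *\<^sub>R (y - x) \<in> A}"
proof -
  let ?T = "\<lambda>y. (1 / s) *\<^sub>R y + (x - (1 / s) *\<^sub>R x)"
  have eq: "{y. x + s *\<^sub>R (y - x) \<in> A} = ?T ` A"
  proof safe
    fix y assume "x + s *\<^sub>R (y - x) \<in> A"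
    then show "y \<in> ?T ` A" using assms by (intro image_eqI[of _ _ "x + s *\<^sub>R (y - x)"]) (auto simp: algebra_simps)
  next
    fix y assume "y \<in> A"
    then show "x + s *\<^sub>R (?T y - x) \<in> A" using assms by (simp add: algebra_simps)
  qed
  have "(\<lambda>y. (s *\<^sub>R x - x) + y) ` A \<in> sets lebesgue"
    using A by (intro lebesgue_sets_translation) auto
  then have "((*\<^sub>R) s) -` ((\<lambda>y. (s *\<^sub>R x - x) + y) ` A) \<inter> space lebesgue \<in> sets lebesgue"
    by (intro measurable_sets[OF lebesgue_measurable_scaling])
  moreover have "((*\<^sub>R) s) -` ((\<lambda>y. (s *\<^sub>R x - x) + y) ` A) = {y. x + s *\<^sub>R (y - x) \<in> A}"
    by (force simp: algebra_simps image_iff)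
  ultimately have "{y. x + s *\<^sub>R (y - x) \<in> A} \<in> sets lebesgue" by simp
  moreover have "emeasure lebesgue {y. x + s *\<^sub>R (y - x) \<in> A} < \<infinity>"
    unfolding eq emeasure_lebesgue_affine using A by (auto simp: fmeasurable_def ennreal_mult_less_top)
  ultimately show "{y. x + s *\<^sub>R (y - x) \<in> A} \<in> lmeasurable" by (simp add: fmeasurable_def)
  have "1 \<le> \<bar>1 / s\<bar> ^ CARD('n)" using A by (intro one_le_power) auto
  then show "measure lebesgue A \<le> measure lebesgue {y. x + s *\<^sub>R (y - x) \<in> A}"
    unfolding eq measure_lebesgue_affine by (simp add: mult_le_cancel_right1 DIM_cart mult_right_mono[of 1, simplified])
qed

text \<open>The continuous pigeonhole principle: if no point lay in more than \<open>k\<close> of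
  the sets, the sum of the indicators would be at most \<open>k\<close> on \<open>D\<close> and 0
  elsewhere. Integrate this.\<close>

lemma overlapping_point:
  fixes A :: "'i \<Rightarrow> (real^'n) set"
  assumes "finite I" "\<And>i. i \<in> I \<Longrightarrow> A i \<in> lmeasurable" "\<And>i. i \<in> I \<Longrightarrow> A i \<subseteq> D" "D \<in> lmeasurable"
    and "(\<Sum>i\<in>I. measure lebesgue (A i)) > k * measure lebesgue D"
  shows "\<exists>y. card {i\<in>I. y \<in> A i} > k"
proof (rule ccontr)
  assume neg: "\<not> ?thesis"
  have le: "(\<Sum>i\<in>I. indicat_real (A i) y) \<le> k * indicat_real D y" for y
  proof (cases "y \<in> D")
    case True
    have "(\<Sum>i\<in>I. indicat_real (A i) y) = card {i\<in>I. y \<in> A i}"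
      using assms(1) by (simp add: indicator_def sum.If_cases Int_def)
    then show ?thesis using True neg by (auto simp: not_less)
  next
    case False
    then have "(\<Sum>i\<in>I. indicat_real (A i) y) = 0"
      using assms(3) by (intro sum.neutral) (auto simp: indicator_def)
    then show ?thesis by simp
  qed
  have int: "integrable lebesgue (indicat_real S)" if "S \<in> lmeasurable" for S :: "(real^'n) set"
    using that by (intro integrable_real_indicator) (auto simp: fmeasurable_def)
  have "(\<Sum>i\<in>I. measure lebesgue (A i)) = (LINT y|lebesgue. (\<Sum>i\<in>I. indicat_real (A i) y))"
    using int[OF assms(2)] by (subst Bochner_Integration.integral_sum) auto
  also have "\<dots> \<le> (LINT y|lebesgue. k * indicat_real D y)"
    by (rule integral_mono)
      (use int[OF assms(2)] int[OF assms(4)] le in \<open>auto intro!: Bochner_Integration.integrable_sum\<close>)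
  also have "\<dots> = k * measure lebesgue D" by simp
  finally show False using assms(5) by simp
qed

text \<open>All that the polynomial estimates know about \<open>A\<close>. The condition is
  invariant under scaling, does not look at the shape of \<open>A\<close>, and is inherited with
  \<mu>/2 when at most half of the guaranteed volume is removed.\<close>

definition thick :: "real \<Rightarrow> real \<Rightarrow> real \<Rightarrow> real^'n \<Rightarrow> (real^'n) set \<Rightarrow> bool" where
  "thick R \<mu> h z A \<longleftrightarrow> 0 < h \<and> A \<in> lmeasurable \<and> A \<subseteq> cball z (R * h) \<and>
     \<mu> * h ^ CARD('n) \<le> measure lebesgue A"

text \<open>A Remez inequality.  The dilates of \<open>A\<close> with centre \<open>x\<close> and factors in \<open>[1, 2]\<close> all have at least
  the measure of \<open>A\<close> and lie in a fixed ball, so if there are many of them, some point lies in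
  more than \<open>k\<close>.  Hence some line through \<open>x\<close> meets \<open>A\<close> in \<open>k + 1\<close> points that are well separated
  from each other, and the restriction of \<open>p\<close> to this line is bounded by interpolation.\<close>

lemma Remez:
  fixes R \<mu> :: real and k :: nat
  assumes "0 < R" "0 < \<mu>"
  shows "\<exists>C>0. \<forall>h z x p A M. thick R \<mu> h (z::real^'n) A \<and> p \<in> Pk k \<and> x \<in> cball z (R * h) \<and> (\<forall>y\<in>A. \<bar>p y\<bar> \<le> M) \<longrightarrow> \<bar>p x\<bar> \<le> C * M"
proof -
  define V where "V = unit_ball_vol (real CARD('n))"
  \<comment> \<open>The number of dilates. Their total measure, at least
    \<open>m * \<mu> * h ^ CARD('n)\<close>, has to exceed \<open>k\<close> times the volume of a
    ball of radius \<open>4 * R * h\<close>.\<close>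
  define m where "m = Suc (nat \<lceil>k * (V * (4 * R) ^ CARD('n)) / \<mu>\<rceil>)"
  have m: "m > 0" "k * (V * (4 * R) ^ CARD('n)) < m * \<mu>"
  proof -
    have "k * (V * (4 * R) ^ CARD('n)) / \<mu> < m" unfolding m_def by linarith
    then show "k * (V * (4 * R) ^ CARD('n)) < m * \<mu>" using assms by (simp add: pos_divide_less_eq)
  qed (simp add: m_def)
  \<comment> \<open>Reciprocals of the dilation factors: \<open>m\<close> equally spaced numbers in
    [1/2, 1). On the line through \<open>x\<close> they become the parameters of the points in
    \<open>A\<close>, so their spacing is the separation required for interpolation.\<close>
  define s where "s i = 1 / 2 + real i / (2 * m)" for i
  have s: "1 / 2 \<le> s i" "s i \<le> 1" if "i < m" for i
    using that m by (auto simp: s_def field_simps)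
  have sep: "1 / (2 * m) \<le> \<bar>s i - s j\<bar>" if "i \<noteq> j" for i j
  proof -
    have "s i - s j = (real i - real j) / (2 * m)" by (simp add: s_def diff_divide_distrib)
    moreover have "1 \<le> \<bar>real i - real j\<bar>" using that by linarith
    ultimately show ?thesis using m by (simp add: divide_right_mono)
  qed
  have inj: "inj s" using m by (auto simp: inj_def s_def)
  \<comment> \<open>The bound of \<open>poly_0_bound_nodes\<close> with \<open>B = 2 * m\<close>,
    the reciprocal of the separation \<open>sep\<close>.\<close>
  define C where "C = Suc k * (2 * real m) ^ k"
  have "\<bar>p x\<bar> \<le> C * M" if thick: "thick R \<mu> h z A" and p: "p \<in> Pk k" and x: "x \<in> cball z (R * h)" and M: "\<forall>y\<in>A. \<bar>p y\<bar> \<le> M"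
   for h z x p M and A :: "(real^'n) set"
  proof -
    have h: "0 < h" and A: "A \<in> lmeasurable" "A \<subseteq> cball z (R * h)" "\<mu> * h ^ CARD('n) \<le> measure lebesgue A"
      using thick by (auto simp: thick_def)
    define As where "As i = {y. x + s i *\<^sub>R (y - x) \<in> A}" for i
    \<comment> \<open>Points of \<open>A\<close> are within \<open>2 * R * h\<close> of
      \<open>x\<close>, and the dilation at most doubles this distance.\<close>
    have D: "measure lebesgue (cball x (4 * R * h)) = V * (4 * R) ^ CARD('n) * h ^ CARD('n)"
      using content_cball[of "4 * R * h" x] assms h by (simp add: V_def power_mult_distrib)
    have "\<exists>y. card {i\<in>{..<m}. y \<in> As i} > k"
    proof (rule overlapping_point)
      fix i assume i: "i \<in> {..<m}"
      then have si: "1 / 2 \<le> s i" "s i \<le> 1" using s by auto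
      then show "As i \<in> lmeasurable" unfolding As_def using A by (intro affine_preimage_lmeasurable) auto
      show "As i \<subseteq> cball x (4 * R * h)"
      proof
        fix y assume "y \<in> As i"
        then have "dist z (x + s i *\<^sub>R (y - x)) \<le> R * h" "dist z x \<le> R * h" using A x by (auto simp: As_def)
        then have "dist x (x + s i *\<^sub>R (y - x)) \<le> 2 * (R * h)" 
          using dist_triangle3[of x "x + s i *\<^sub>R (y - x)" z] by linarith
        then have "s i * norm (y - x) \<le> 2 * (R * h)" using si by (simp add: dist_norm)
        moreover have "1 / 2 * norm (y - x) \<le> s i * norm (y - x)" using si by (intro mult_right_mono) auto
        ultimately show "y \<in> cball x (4 * R * h)" by (simp add: dist_norm norm_minus_commute)
      qed
    next
      have "k * measure lebesgue (cball x (4 * R * h)) < m * \<mu> * h ^ CARD('n)"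
        using mult_strict_right_mono[OF m(2), of "h ^ CARD('n)"] h unfolding D by (simp add: mult_ac)
      also have "\<dots> = (\<Sum>i<m. \<mu> * h ^ CARD('n))" by simp
      also have "\<dots> \<le> (\<Sum>i<m. measure lebesgue (As i))"
      proof (rule sum_mono)
        fix i assume "i \<in> {..<m}"
        then have "1 / 2 \<le> s i" "s i \<le> 1" using s by auto
        then have "measure lebesgue A \<le> measure lebesgue (As i)"
          unfolding As_def using A by (intro affine_preimage_lmeasurable) auto
        then show "\<mu> * h ^ CARD('n) \<le> measure lebesgue (As i)" using A by linarith
      qed
      finally show "k * measure lebesgue (cball x (4 * R * h)) < (\<Sum>i<m. measure lebesgue (As i))" .
    qed auto
    then obtain y J where J: "J \<subseteq> {i\<in>{..<m}. y \<in> As i}" "card J = Suc k" "finite J"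
      by (meson Suc_leI obtain_subset_with_card_n)
    obtain q where q: "degree q \<le> k" "\<And>t. p (x + t *\<^sub>R (y - x)) = poly q t"
      using Pk_line[OF p] by metis
    have "\<bar>poly q 0\<bar> \<le> Suc k * (2 * real m) ^ k * M"
    proof (rule poly_0_bound_nodes)
      show "finite (s ` J)" "card (s ` J) = Suc k"
        using J by (auto simp: card_image inj_on_subset[OF inj])
      show "\<bar>poly q t\<bar> \<le> M" if "t \<in> s ` J" for t
        using that J M by (auto simp: q(2)[symmetric] As_def)
      show "\<bar>t\<bar> \<le> 1" if "t \<in> s ` J" for t
        using that J s by fastforce
      show "1 / (2 * real m) \<le> \<bar>t - r\<bar>" if rt: "r \<in> s ` J" "t \<in> s ` J" "r \<noteq> t" for r t
      proof -
        obtain i j where "r = s i" "t = s j" using rt by blast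
        then show ?thesis using sep[of j i] rt(3) by auto
      qed
    qed (use m q in auto)
    then show ?thesis using q(2)[of 0] by (simp add: C_def)
  qed
  moreover have "C > 0" using m by (simp add: C_def)
  ultimately show ?thesis by blast
qed

section \<open>Norm equivalences and inverse inequality\<close>

lemma continuous_absolutely_integrable_on_bounded:
  fixes f :: "real^'n \<Rightarrow> real"
  assumes "continuous_on UNIV f" "A \<in> lmeasurable" "bounded A"
  shows "f absolutely_integrable_on A"
proof -
  obtain a b where "A \<subseteq> cbox a b" using bounded_subset_cbox_symmetric[OF assms(3)] by blast
  moreover have "f absolutely_integrable_on cbox a b"
    by (intro absolutely_integrable_continuous continuous_on_subset[OF assms(1)]) auto
  ultimately show ?thesis using assms(2) by (auto intro: set_integrable_subset)
qed

text \<open>Chebyshev's inequality reduces this to the maximum norm: with a threshold of twice the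
  mean-square level, the part \<open>B\<close> of \<open>A\<close> where \<open>p\<close> is larger
  takes at most half of the guaranteed volume. On the rest \<open>p\<close> is bounded, and the rest
  is still thick with \<mu>/2.\<close>

lemma Remez_L2:
  fixes R \<mu> :: real and k :: nat
  assumes "0 < R" "0 < \<mu>"
  shows "\<exists>C>0. \<forall>h z x p A. thick R \<mu> h (z::real^'n) A \<and> p \<in> Pk k \<and> x \<in> cball z (R * h) \<longrightarrow>
     (p x)\<^sup>2 \<le> C / h ^ CARD('n) * integral A (\<lambda>y. (p y)\<^sup>2)"
proof -
  obtain C where C: "C > 0" "\<And>h z x p A M. thick R (\<mu> / 2) h (z::real^'n) A \<Longrightarrow> p \<in> Pk k \<Longrightarrow> x \<in> cball z (R * h) \<Longrightarrow> (\<forall>y\<in>A. \<bar>p y\<bar> \<le> M) \<Longrightarrow> \<bar>p x\<bar> \<le> C * M"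
    using Remez[of R "\<mu> / 2" k, where ?'n = 'n] assms by auto
  define C' where "C' = C\<^sup>2 * 2 / \<mu>"
  have "(p x)\<^sup>2 \<le> C' / h ^ CARD('n) * integral A (\<lambda>y. (p y)\<^sup>2)"
    if thick: "thick R \<mu> h z A" and p: "p \<in> Pk k" and x: "x \<in> cball z (R * h)"
   for h z x p and A :: "(real^'n) set"
  proof -
    have h: "0 < h" and A: "A \<in> lmeasurable" "A \<subseteq> cball z (R * h)" "\<mu> * h ^ CARD('n) \<le> measure lebesgue A"
      using thick by (auto simp: thick_def)
    define I where "I = integral A (\<lambda>y. (p y)\<^sup>2)"
    have cont: "continuous_on UNIV (\<lambda>y. (p y)\<^sup>2)"
      using Pk_continuous[OF p] by (auto intro: continuous_intros)
    have int: "(\<lambda>y. (p y)\<^sup>2) absolutely_integrable_on A"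
      using A cont bounded_subset by (intro continuous_absolutely_integrable_on_bounded) auto
    have "I \<ge> 0" unfolding I_def using int by (intro integral_nonneg absolutely_integrable_on_def[THEN iffD1, THEN conjunct1]) auto
    have "(p x)\<^sup>2 \<le> C' / h ^ CARD('n) * (I + e)" if e: "e > 0" for e
    proof -
      \<comment> \<open>The summand \<open>e\<close> keeps the threshold positive when the integral
        vanishes; it is sent to 0 at the end.\<close>
      define t where "t = 2 * (I + e) / (\<mu> * h ^ CARD('n))"
      have t: "t > 0" using e h assms \<open>I \<ge> 0\<close> by (auto simp: t_def)
      define B where "B = A \<inter> {y. (p y)\<^sup>2 > t}"
      have "open {y. (p y)\<^sup>2 > t}" using cont by (intro open_Collect_less continuous_on_const) auto
      then have B: "B \<in> lmeasurable" unfolding B_def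
        by (intro fmeasurable_Int_fmeasurable A) auto
      have "t * measure lebesgue B = integral B (\<lambda>y. t)"
        using lmeasure_integral[OF B] integral_mult_right[of B t "\<lambda>_. 1"] by simp
      also have "\<dots> \<le> integral B (\<lambda>y. (p y)\<^sup>2)"
      proof (rule integral_le)
        show "(\<lambda>y. t) integrable_on B" using B by (rule integrable_on_const)
        show "(\<lambda>y. (p y)\<^sup>2) integrable_on B"
          using set_integrable_subset[OF int] B by (auto simp: B_def absolutely_integrable_on_def)
      qed (auto simp: B_def)
      also have "\<dots> \<le> I" unfolding I_def
        using set_integrable_subset[OF int] B int
        by (intro integral_subset_le) (auto simp: B_def absolutely_integrable_on_def)
      finally have "t * measure lebesgue B \<le> I + e" using e by simp
      then have "measure lebesgue B \<le> (I + e) / t" using t by (simp add: pos_le_divide_eq mult.commute)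
      also have "(I + e) / t = \<mu> / 2 * h ^ CARD('n)" using h e \<open>I \<ge> 0\<close> assms by (simp add: t_def field_simps)
      finally have mB: "measure lebesgue B \<le> \<mu> / 2 * h ^ CARD('n)" .
      have "measure lebesgue (A - B) = measure lebesgue A - measure lebesgue B"
        using A B by (intro measurable_measure_Diff) (auto simp: B_def)
      then have "\<mu> / 2 * h ^ CARD('n) \<le> measure lebesgue (A - B)" using mB A(3) by linarith
      moreover have "\<forall>y\<in>A - B. \<bar>p y\<bar> \<le> sqrt t"
        by (auto simp: B_def real_le_rsqrt not_less)
      ultimately have "\<bar>p x\<bar> \<le> C * sqrt t"
        using A x h p B by (intro C(2)[of h z "A - B" p x]) (auto simp: thick_def intro: fmeasurable.Diff)
      then have "(p x)\<^sup>2 \<le> (C * sqrt t)\<^sup>2" by (metis abs_ge_zero power2_abs power_mono)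
      also have "\<dots> = C\<^sup>2 * t" using t by (simp add: power_mult_distrib)
      also have "\<dots> = C' / h ^ CARD('n) * (I + e)" using h assms by (simp add: t_def C'_def field_simps)
      finally show ?thesis .
    qed
    then have bnd: "(p x)\<^sup>2 \<le> C' / h ^ CARD('n) * I + C' / h ^ CARD('n) * e" if "e > 0" for e
      using that by (simp add: distrib_left)
    have c: "C' / h ^ CARD('n) > 0" using C(1) h assms by (simp add: C'_def)
    have "(p x)\<^sup>2 \<le> C' / h ^ CARD('n) * I"
    proof (rule field_le_epsilon)
      fix e :: real assume "e > 0"
      then show "(p x)\<^sup>2 \<le> C' / h ^ CARD('n) * I + e"
        using bnd[of "e / (C' / h ^ CARD('n))"] c C(1) assms h by (simp add: C'_def)
    qed
    then show ?thesis by (simp add: I_def)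
  qed
  moreover have "C' > 0" using C(1) assms by (simp add: C'_def)
  ultimately show ?thesis by blast
qed

text \<open>The integrand in the square of \<open>nabla_norm\<close>, so that both values of
  \<open>m\<close> share the integration lemmas.\<close>

definition energy :: "nat \<Rightarrow> (real^'n \<Rightarrow> real) \<Rightarrow> real^'n \<Rightarrow> real" where
  "energy m v x = (if m = 0 then (v x)\<^sup>2 else (norm (grad v x))\<^sup>2)"

lemma energy_nonneg: "energy m v x \<ge> 0"
  by (simp add: energy_def)

lemma norm_grad_sq: "(norm (grad v x))\<^sup>2 = (\<Sum>j\<in>UNIV. (grad v x $ j)\<^sup>2)"
  by (simp add: norm_vec_def L2_set_def sum_nonneg)

lemma energy_continuous: "p \<in> Pk k \<Longrightarrow> continuous_on X (energy m p)"
proof (cases "m = 0")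
  case True
  then show "p \<in> Pk k \<Longrightarrow> continuous_on X (energy m p)"
    unfolding energy_def[abs_def] by (auto intro!: continuous_on_power intro: Pk_continuous)
next
  case False
  assume "p \<in> Pk k"
  then have "continuous_on X (\<lambda>x. \<Sum>j\<in>UNIV. (grad p x $ j)\<^sup>2)"
    by (intro continuous_on_sum continuous_on_power Pk_continuous[OF Pk_grad])
  then show "continuous_on X (energy m p)"
    using False unfolding energy_def[abs_def] by (simp add: norm_grad_sq)
qed

lemma energy_integrable:
  "p \<in> Pk k \<Longrightarrow> A \<in> lmeasurable \<Longrightarrow> bounded A \<Longrightarrow> energy m p absolutely_integrable_on A"
  by (rule continuous_absolutely_integrable_on_bounded[OF energy_continuous])

text \<open>For the gradient, \<open>Remez_L2\<close> is applied to each partial derivative, which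
  is again a polynomial.\<close>

lemma energy_bound:
  fixes R \<mu> :: real and k :: nat
  assumes "0 < R" "0 < \<mu>"
  shows "\<exists>C>0. \<forall>h z x p A. thick R \<mu> h (z::real^'n) A \<and> p \<in> Pk k \<and> x \<in> cball z (R * h) \<longrightarrow>
     energy m p x \<le> C / h ^ CARD('n) * integral A (energy m p)"
proof -
  obtain C where C: "C > 0" "\<And>h z x p A. thick R \<mu> h (z::real^'n) A \<Longrightarrow> p \<in> Pk k \<Longrightarrow> x \<in> cball z (R * h) \<Longrightarrow> (p x)\<^sup>2 \<le> C / h ^ CARD('n) * integral A (\<lambda>y. (p y)\<^sup>2)"
    using Remez_L2[of R \<mu> k, where ?'n = 'n] assms by auto
  have "energy m p x \<le> C / h ^ CARD('n) * integral A (energy m p)"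
    if thick: "thick R \<mu> h z A" and p: "p \<in> Pk k" and x: "x \<in> cball z (R * h)"
   for h z x p and A :: "(real^'n) set"
  proof (cases "m = 0")
    case True
    then show ?thesis using C(2)[OF that] by (simp add: energy_def[abs_def])
  next
    case False
    have A: "A \<in> lmeasurable" "A \<subseteq> cball z (R * h)" using thick by (auto simp: thick_def)
    have "(\<lambda>y. (grad p y $ j)\<^sup>2) absolutely_integrable_on A" for j
      using A bounded_subset
      by (intro continuous_absolutely_integrable_on_bounded) (auto intro!: continuous_intros Pk_continuous[OF Pk_grad[OF p]])
    then have int: "(\<lambda>y. (grad p y $ j)\<^sup>2) integrable_on A" for j
      by (simp add: absolutely_integrable_on_def)
    have "energy m p x = (\<Sum>j\<in>UNIV. (grad p x $ j)\<^sup>2)" using False by (simp add: energy_def norm_grad_sq)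
    also have "\<dots> \<le> (\<Sum>j\<in>UNIV. C / h ^ CARD('n) * integral A (\<lambda>y. (grad p y $ j)\<^sup>2))"
      by (intro sum_mono C(2)[OF thick Pk_grad[OF p] x])
    also have "\<dots> = C / h ^ CARD('n) * integral A (energy m p)"
      using False int by (simp add: energy_def[abs_def] norm_grad_sq integral_sum sum_distrib_left)
    finally show ?thesis .
  qed
  then show ?thesis using C(1) by blast
qed

lemma Pk_mean_value:
  fixes p :: "real^'n \<Rightarrow> real"
  assumes "p \<in> Pk k" "convex S" "x \<in> S" "y \<in> S" "\<And>w. w \<in> S \<Longrightarrow> norm (grad p w) \<le> B"
  shows "\<bar>p x - p y\<bar> \<le> B * norm (x - y)"
proof -
  have "norm (p x - p y) \<le> B * norm (x - y)"
  proof (rule differentiable_bound[OF assms(2)])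
    show "(p has_derivative (\<lambda>v. grad p w \<bullet> v)) (at w within S)" for w
      using Pk_has_derivative[OF assms(1)] by (rule has_derivative_at_withinI)
    show "onorm (\<lambda>v. grad p w \<bullet> v) \<le> B" if "w \<in> S" for w
      using assms(5)[OF that]
      by (intro onorm_le, unfold real_norm_def)
        (intro order_trans[OF Cauchy_Schwarz_ineq2] mult_right_mono, auto)
  qed (use assms in auto)
  then show ?thesis by simp
qed

text \<open>The gradient is bounded on the whole ball, which is convex, so the mean value inequality
  applies wherever \<open>x\<close> and \<open>y\<close> lie relative to \<open>A\<close>. The
  factor \<open>h\<^sup>2\<close> is the squared distance.\<close>

lemma increment_bound:
  fixes R \<mu> :: real and k :: nat
  assumes "0 < R" "0 < \<mu>"
  shows "\<exists>C>0. \<forall>h z x y p A. thick R \<mu> h (z::real^'n) A \<and> p \<in> Pk k \<and> x \<in> cball z (R * h) \<and> y \<in> cball z (R * h) \<longrightarrow>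
     (p x - p y)\<^sup>2 \<le> C * h\<^sup>2 / h ^ CARD('n) * integral A (energy 1 p)"
proof -
  obtain C where C: "C > 0" "\<And>h z x p A. thick R \<mu> h (z::real^'n) A \<Longrightarrow> p \<in> Pk k \<Longrightarrow> x \<in> cball z (R * h) \<Longrightarrow> energy 1 p x \<le> C / h ^ CARD('n) * integral A (energy 1 p)"
    using energy_bound[of R \<mu> k 1, where ?'n = 'n] assms by auto
  have "(p x - p y)\<^sup>2 \<le> C * (2 * R)\<^sup>2 * h\<^sup>2 / h ^ CARD('n) * integral A (energy 1 p)"
    if thick: "thick R \<mu> h z A" and p: "p \<in> Pk k" and xy: "x \<in> cball z (R * h)" "y \<in> cball z (R * h)"
   for h z x y p and A :: "(real^'n) set"
  proof -
    have h: "0 < h" using thick by (simp add: thick_def)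
    define B where "B = C / h ^ CARD('n) * integral A (energy 1 p)"
    have B: "energy 1 p w \<le> B" if "w \<in> cball z (R * h)" for w
      using C(2)[OF thick p that] by (simp add: B_def)
    then have "B \<ge> 0" using xy energy_nonneg order_trans by blast
    have "\<bar>p x - p y\<bar> \<le> sqrt B * norm (x - y)"
      using B by (intro Pk_mean_value[OF p convex_cball xy]) (auto simp: energy_def real_le_rsqrt)
    also have "\<dots> \<le> sqrt B * (2 * (R * h))"
    proof -
      have "dist x y \<le> 2 * (R * h)" using xy dist_triangle3[of x y z] by (simp add: dist_commute)
      then show ?thesis using \<open>B \<ge> 0\<close> by (intro mult_left_mono) (auto simp: dist_norm)
    qed
    finally have "\<bar>p x - p y\<bar>\<^sup>2 \<le> (sqrt B * (2 * (R * h)))\<^sup>2" by (intro power_mono) auto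
    also have "\<dots> = C * (2 * R)\<^sup>2 * h\<^sup>2 / h ^ CARD('n) * integral A (energy 1 p)"
      using \<open>B \<ge> 0\<close> by (simp add: power_mult_distrib) (simp add: B_def field_simps)
    finally show ?thesis by simp
  qed
  moreover have "C * (2 * R)\<^sup>2 > 0" using C(1) assms by simp
  ultimately show ?thesis by blast
qed

text \<open>A partial derivative at \<open>x\<close> is read off the values at the points
  \<open>x + i h e_j\<close> with i up to \<open>k\<close>, and these values are bounded by Remez.
  The spacing \<open>h\<close> produces the factor 1/h.\<close>

lemma inverse_inequality:
  fixes R \<mu> :: real and k :: nat
  assumes "0 < R" "0 < \<mu>"
  shows "\<exists>C>0. \<forall>h z x p A M. thick R \<mu> h (z::real^'n) A \<and> p \<in> Pk k \<and> x \<in> cball z (R * h) \<and> (\<forall>y\<in>A. \<bar>p y\<bar> \<le> M) \<longrightarrow>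
     norm (grad p x) \<le> C * M / h"
proof -
  \<comment> \<open>The sampling points may leave the ball around \<open>z\<close> by
    \<open>k * h\<close>.\<close>
  define R' where "R' = R + k"
  obtain C where C: "C > 0" "\<And>h z x p A M. thick R' \<mu> h (z::real^'n) A \<Longrightarrow> p \<in> Pk k \<Longrightarrow> x \<in> cball z (R' * h) \<Longrightarrow> (\<forall>y\<in>A. \<bar>p y\<bar> \<le> M) \<Longrightarrow> \<bar>p x\<bar> \<le> C * M"
    using Remez[of R' \<mu> k, where ?'n = 'n] assms by (auto simp: R'_def add_pos_nonneg)
  obtain C2 where C2: "C2 > 0" "\<And>q::real poly. \<And>M. degree q \<le> k \<Longrightarrow> (\<forall>i\<le>k. \<bar>poly q (real i)\<bar> \<le> M) \<Longrightarrow> \<bar>poly (pderiv q) 0\<bar> \<le> C2 * M"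
    using pderiv_bound_nodes[of k] by auto
  have "norm (grad p x) \<le> (CARD('n) * C2 * C) * M / h"
    if thick: "thick R \<mu> h z A" and p: "p \<in> Pk k" and x: "x \<in> cball z (R * h)" and M: "\<forall>y\<in>A. \<bar>p y\<bar> \<le> M"
   for h z x p M and A :: "(real^'n) set"
  proof -
    have h: "0 < h" and A: "A \<in> lmeasurable" "A \<subseteq> cball z (R * h)" "\<mu> * h ^ CARD('n) \<le> measure lebesgue A"
      using thick by (auto simp: thick_def)
    have "R * h \<le> R' * h" using h by (simp add: R'_def)
    then have thick': "thick R' \<mu> h z A" using thick subset_cball[of "R * h" "R' * h" z] by (auto simp: thick_def)
    have "\<bar>grad p x $ j\<bar> \<le> C2 * (C * M) / h" for j
    proof -
      obtain q where q: "degree q \<le> k" "\<And>t. p (x + t *\<^sub>R (h *\<^sub>R axis j 1)) = poly q t"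
        using Pk_line[OF p] by metis
      have "\<bar>poly (pderiv q) 0\<bar> \<le> C2 * (C * M)"
      proof (rule C2(2)[OF q(1)], intro allI impI)
        fix i assume "i \<le> k"
        have "x + real i *\<^sub>R (h *\<^sub>R axis j 1) \<in> cball z (R' * h)"
        proof -
          have "dist z (x + real i *\<^sub>R (h *\<^sub>R axis j 1)) \<le> dist z x + norm (real i *\<^sub>R (h *\<^sub>R (axis j 1 :: real^'n)))"
            using norm_triangle_ineq4[of "z - x" "real i *\<^sub>R (h *\<^sub>R axis j 1)"]
            unfolding dist_norm diff_diff_eq .
          also have "\<dots> \<le> R * h + k * h" using x \<open>i \<le> k\<close> h by (intro add_mono) (auto simp: norm_axis_1)
          finally show ?thesis by (simp add: R'_def algebra_simps)
        qed
        then show "\<bar>poly q (real i)\<bar> \<le> C * M"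
          unfolding q(2)[symmetric] by (intro C(2)[OF thick' p _ M])
      qed
      moreover have "poly (pderiv q) 0 = h * grad p x $ j"
      proof -
        have "((\<lambda>t. p (x + t *\<^sub>R (h *\<^sub>R axis j 1))) has_derivative (\<lambda>t. grad p x \<bullet> (t *\<^sub>R (h *\<^sub>R axis j 1)))) (at 0)"
          by (rule has_derivative_compose[where g = p and g' = "\<lambda>v. grad p x \<bullet> v"])
            (use Pk_has_derivative[OF p, of x] in \<open>auto intro!: derivative_eq_intros\<close>)
        then have "(poly q has_field_derivative (h * grad p x $ j)) (at 0)"
          unfolding q(2) has_field_derivative_def by (simp add: inner_axis mult_commute_abs mult_ac)
        then show ?thesis using DERIV_unique[OF poly_DERIV] by metis
      qed
      ultimately show ?thesis using h by (simp add: abs_mult pos_le_divide_eq mult.commute)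
    qed
    then have "(\<Sum>j\<in>UNIV. \<bar>grad p x $ j\<bar>) \<le> (\<Sum>j\<in>(UNIV::'n set). C2 * (C * M) / h)" by (intro sum_mono)
    then show ?thesis using norm_le_l1_cart[of "grad p x"] by (simp add: mult_ac)
  qed
  moreover have "CARD('n) * C2 * C > 0" using C C2 by simp
  ultimately show ?thesis by blast
qed

section \<open>Unisolvence of the principal lattice\<close>

text \<open>On the line through \<open>x\<close> with direction \<open>u\<close>, the polynomial
  minus its value at \<open>x\<close> vanishes at every natural parameter.\<close>

lemma Pk_periodic_const:
  assumes p: "p \<in> Pk k" and per: "\<And>x. p (x + u) = p x"
  shows "p (x + t *\<^sub>R u) = p x"
proof -
  obtain q where q: "degree q \<le> k" "\<And>t. p (x + t *\<^sub>R u) = poly q t" using Pk_line[OF p] by metis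
  have n: "p (x + real n *\<^sub>R u) = p x" for n
  proof (induction n)
    case (Suc n)
    have "p (x + real (Suc n) *\<^sub>R u) = p ((x + real n *\<^sub>R u) + u)" by (simp add: algebra_simps)
    then show ?case using per Suc by simp
  qed simp
  have "q - [:p x:] = 0"
  proof (rule ccontr)
    assume "q - [:p x:] \<noteq> 0"
    then have "finite {t. poly (q - [:p x:]) t = 0}" by (rule poly_roots_finite)
    moreover have "range real \<subseteq> {t. poly (q - [:p x:]) t = 0}" using n by (auto simp: q(2)[symmetric])
    ultimately have "finite (range real)" by (rule finite_subset[rotated])
    then show False using range_inj_infinite[of "real :: nat \<Rightarrow> real"] inj_of_nat by blast
  qed
  then have "q = [:p x:]" by (rule eq_iff_diff_eq_0[THEN iffD2])
  then have "poly q t = p x" by simp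
  then show ?thesis using q(2)[of t] by simp
qed

text \<open>The proof is by induction on \<open>k\<close>: the differences \<open>p (x + u) - p x\<close> have degree \<open>k - 1\<close> and vanish on the
  smaller lattice.  So \<open>p\<close> is periodic, hence constant, in all directions \<open>u \<in> B\<close>.\<close>

lemma Pk_unisolvent_lattice:
  fixes p :: "real^'n \<Rightarrow> real"
  assumes "finite B" "span B = UNIV" "p \<in> Pk k"
    and "\<And>\<beta>::real^'n \<Rightarrow> nat. (\<Sum>u\<in>B. \<beta> u) \<le> k \<Longrightarrow> p (a + (\<Sum>u\<in>B. real (\<beta> u) *\<^sub>R u)) = 0"
  shows "p x = 0"
  using assms(3,4)
proof (induction k arbitrary: p x)
  case 0
  have "p a = 0" using 0(2)[of "\<lambda>_. 0"] by simp
  then show ?case using Pk_0_const[OF 0(1)] by metis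
next
  case (Suc k)
  have per: "p (y + u) = p y" if "u \<in> B" for u y
  proof -
    have "(\<lambda>x. p (x + u) - p x) y = 0"
    proof (rule Suc.IH)
      show "(\<lambda>x. p (x + u) - p x) \<in> Pk k" using Pk_difference[OF Suc.prems(1), of u] by simp
      fix \<beta> :: "real^'n \<Rightarrow> nat" assume \<beta>: "sum \<beta> B \<le> k"
      \<comment> \<open>A shift by \<open>u\<close> raises one entry, so the shifted point belongs
        to the lattice of order \<open>Suc k\<close>.\<close>
      define \<beta>' where "\<beta>' = \<beta>(u := Suc (\<beta> u))"
      have "sum \<beta>' B = Suc (sum \<beta> B)" 
      proof -
        have "sum \<beta>' (B - {u}) = sum \<beta> (B - {u})" by (rule sum.cong) (auto simp: \<beta>'_def)
        then show ?thesis using assms(1) that by (simp add: sum.remove[of B u] \<beta>'_def)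
      qed
      moreover have "(\<Sum>w\<in>B. real (\<beta>' w) *\<^sub>R w) = (\<Sum>w\<in>B. real (\<beta> w) *\<^sub>R w) + u"
      proof -
        have "(\<Sum>w\<in>B - {u}. real (\<beta>' w) *\<^sub>R w) = (\<Sum>w\<in>B - {u}. real (\<beta> w) *\<^sub>R w)" by (rule sum.cong) (auto simp: \<beta>'_def)
        then show ?thesis using assms(1) that by (simp add: sum.remove[of B u] \<beta>'_def algebra_simps)
      qed
      ultimately have "p (a + (\<Sum>w\<in>B. real (\<beta> w) *\<^sub>R w) + u) = 0"
        using Suc.prems(2)[of \<beta>'] \<beta> by (simp add: add.assoc)
      then show "p (a + (\<Sum>w\<in>B. real (\<beta> w) *\<^sub>R w) + u) - p (a + (\<Sum>w\<in>B. real (\<beta> w) *\<^sub>R w)) = 0"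
        using Suc.prems(2)[of \<beta>] \<beta> by simp
    qed
    then show ?thesis by simp
  qed
  have "p (a + (\<Sum>u\<in>B'. c u *\<^sub>R u)) = p a" if "B' \<subseteq> B" for B' c
    using finite_subset[OF that assms(1)] that
  proof (induction B' rule: finite_induct)
    case (insert u B')
    have "p (a + (\<Sum>w\<in>insert u B'. c w *\<^sub>R w)) = p ((a + (\<Sum>w\<in>B'. c w *\<^sub>R w)) + c u *\<^sub>R u)"
      using insert(1,2) by (simp add: algebra_simps)
    also have "\<dots> = p (a + (\<Sum>w\<in>B'. c w *\<^sub>R w))"
      using insert.prems by (intro Pk_periodic_const[OF Suc.prems(1) per]) auto
    finally show ?case using insert by simp
  qed simp
  moreover have "x - a \<in> range (\<lambda>c. \<Sum>u\<in>B. c u *\<^sub>R u)"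
    using span_finite[OF assms(1)] assms(2) by simp
  then obtain c where "x - a = (\<Sum>u\<in>B. c u *\<^sub>R u)" by blast
  then have "x = a + (\<Sum>u\<in>B. c u *\<^sub>R u)" by (simp add: algebra_simps)
  moreover have "p a = 0" using Suc.prems(2)[of "\<lambda>_. 0"] by simp
  ultimately show ?case by simp
qed

section \<open>Barycentric coordinates and the nodes of one simplex\<close>

definition vertices :: "(real^'n) set \<Rightarrow> (real^'n) set" where
  "vertices T = {a. a extreme_point_of T}"

text \<open>Defined for every point \<open>a\<close>. If \<open>a\<close> is not a vertex of
  \<open>T\<close>, this function vanishes on \<open>T\<close>, so products and sums over all
  vertices of a mesh can be formed without asking which of them belong to \<open>T\<close>.\<close>

definition bary :: "(real^'n) set \<Rightarrow> real^'n \<Rightarrow> real^'n \<Rightarrow> real" where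
  "bary T a = (SOME f. (\<exists>w c. f = (\<lambda>x. w \<bullet> x + c)) \<and> (\<forall>b\<in>vertices T. f b = (if b = a then 1 else 0)))"

lemma simplex_vertices:
  assumes "int CARD('n) simplex (T :: (real^'n) set)"
  shows "finite (vertices T)" "\<not> affine_dependent (vertices T)" "card (vertices T) = CARD('n) + 1"
    "T = convex hull (vertices T)"
proof -
  obtain C where C: "finite C" "\<not> affine_dependent C" "int (card C) = int CARD('n) + 1" "T = convex hull C"
    using assms unfolding simplex by blast
  then have "vertices T = C"
    by (auto simp: vertices_def extreme_point_of_convex_hull_affine_independent)
  then show "finite (vertices T)" "\<not> affine_dependent (vertices T)" "card (vertices T) = CARD('n) + 1"
    "T = convex hull (vertices T)" using C by auto
qed

text \<open>The edge vectors b - a are independent, so some linear functional equals -1 on all of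
  them; adding a constant makes it 1 at \<open>a\<close>. The adjoint turns it into an inner
  product.\<close>

lemma barycentric_coordinate_exists:
  fixes C :: "(real^'n) set"
  assumes "\<not> affine_dependent C"
  shows "\<exists>w c. \<forall>b\<in>C. w \<bullet> b + c = (if b = a then 1 else 0)"
proof (cases "a \<in> C")
  case True
  have "independent ((\<lambda>x. - a + x) ` (C - {a}))"
    using assms affine_dependent_iff_dependent2[OF True] by simp
  from linear_independent_extend[OF this, of "\<lambda>_. -1"] obtain g :: "real^'n \<Rightarrow> real"
    where g: "linear g" "\<And>b. b \<in> C - {a} \<Longrightarrow> g (- a + b) = -1" by auto
  have ga: "adjoint g 1 \<bullet> y = g y" for y
    using adjoint_works[OF g(1), of y 1] by (simp add: inner_commute)
  have "adjoint g 1 \<bullet> b + (1 - g a) = (if b = a then 1 else 0)" if "b \<in> C" for b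
    using g(2)[of b] that by (auto simp: ga linear_diff[OF g(1)])
  then show ?thesis by blast
next
  case False
  then have "\<forall>b\<in>C. 0 \<bullet> b + 0 = (if b = a then 1 else 0 :: real)" by auto
  then show ?thesis by blast
qed

lemma bary:
  assumes "int CARD('n) simplex (T :: (real^'n) set)"
  shows bary_affine: "\<exists>w c. bary T a = (\<lambda>x. w \<bullet> x + c)"
    and bary_vertex: "b \<in> vertices T \<Longrightarrow> bary T a b = (if b = a then 1 else 0)"
proof -
  have "(\<exists>w c. bary T a = (\<lambda>x. w \<bullet> x + c)) \<and> (\<forall>b\<in>vertices T. bary T a b = (if b = a then 1 else 0))"
    (is "?P (bary T a)")
  proof -
    obtain w c where "\<forall>b\<in>vertices T. w \<bullet> b + c = (if b = a then 1 else 0)"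
      using barycentric_coordinate_exists[OF simplex_vertices(2)[OF assms], of a] by blast
    then have "?P (\<lambda>x. w \<bullet> x + c)" by auto
    then show ?thesis unfolding bary_def by (rule someI[where P = ?P])
  qed
  then show "\<exists>w c. bary T a = (\<lambda>x. w \<bullet> x + c)"
    "b \<in> vertices T \<Longrightarrow> bary T a b = (if b = a then 1 else 0)" by auto
qed

lemma bary_Pk: "int CARD('n) simplex (T :: (real^'n) set) \<Longrightarrow> bary T a \<in> Pk 1"
  using bary_affine[of T a] Pk_affine by fastforce

lemma bary_combination:
  assumes T: "int CARD('n) simplex (T :: (real^'n) set)" and C: "finite C" "C \<subseteq> vertices T" "sum u C = 1"
  shows "bary T a (\<Sum>b\<in>C. u b *\<^sub>R b) = (if a \<in> C then u a else 0)"
proof -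
  obtain w c where w: "bary T a = (\<lambda>x. w \<bullet> x + c)" using bary_affine[OF T] by blast
  have "bary T a (\<Sum>b\<in>C. u b *\<^sub>R b) = (\<Sum>b\<in>C. u b * bary T a b)"
  proof -
    have "(\<Sum>b\<in>C. u b * c) = c" using C(3) by (simp add: sum_distrib_right[symmetric])
    then show ?thesis by (simp add: w inner_sum_right sum.distrib distrib_left)
  qed
  also have "\<dots> = (\<Sum>b\<in>C. if b = a then u b else 0)"
    using C(2) by (intro sum.cong) (auto simp: bary_vertex[OF T])
  finally show ?thesis using C(1) by simp
qed

lemma bary_simplex:
  assumes T: "int CARD('n) simplex (T :: (real^'n) set)" and x: "x \<in> T"
  shows "bary T a x \<ge> 0" "bary T a x \<le> 1" "a \<notin> vertices T \<Longrightarrow> bary T a x = 0"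
    "(\<Sum>b\<in>vertices T. bary T b x) = 1" "x = (\<Sum>b\<in>vertices T. bary T b x *\<^sub>R b)"
proof -
  note V = simplex_vertices[OF T]
  obtain u where u: "\<And>b. b \<in> vertices T \<Longrightarrow> u b \<ge> 0" "sum u (vertices T) = 1" "x = (\<Sum>b\<in>vertices T. u b *\<^sub>R b)"
    using x V(1) by (subst (asm) V(4)) (auto simp: convex_hull_finite)
  have b: "bary T b x = (if b \<in> vertices T then u b else 0)" for b
    unfolding u(3) using u V by (intro bary_combination[OF T]) auto
  have "u b \<le> 1" if "b \<in> vertices T" for b
    using member_le_sum[of b "vertices T" u] u V that by auto
  then show "bary T a x \<ge> 0" "bary T a x \<le> 1" "a \<notin> vertices T \<Longrightarrow> bary T a x = 0"
    using u(1) by (auto simp: b)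
  show "(\<Sum>b\<in>vertices T. bary T b x) = 1" using u(2) by (simp add: b)
  have "(\<Sum>b\<in>vertices T. bary T b x *\<^sub>R b) = (\<Sum>b\<in>vertices T. u b *\<^sub>R b)"
    by (rule sum.cong) (auto simp: b)
  then show "x = (\<Sum>b\<in>vertices T. bary T b x *\<^sub>R b)" using u(3) by simp
qed

text \<open>In this form the node property depends on \<open>T\<close> only through coordinates, and
  those agree on common faces of neighbouring elements.\<close>

lemma lagrange_nodes_simplex:
  assumes T: "int CARD('n) simplex (T :: (real^'n) set)" and k: "1 \<le> k"
  shows "x \<in> lagrange_nodes k T \<longleftrightarrow> x \<in> T \<and> (\<forall>a. real k * bary T a x \<in> \<nat>)"
proof
  note V = simplex_vertices[OF T]
  assume "x \<in> lagrange_nodes k T"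
  then obtain \<beta> :: "real^'n \<Rightarrow> nat" where \<beta>: "sum \<beta> (vertices T) = k" "x = (\<Sum>a\<in>vertices T. (real (\<beta> a) / real k) *\<^sub>R a)"
    unfolding lagrange_nodes_def vertices_def by blast
  have 1: "(\<Sum>a\<in>vertices T. real (\<beta> a) / real k) = 1"
    using \<beta>(1) k by (simp add: sum_divide_distrib[symmetric] of_nat_sum[symmetric] del: of_nat_sum)
  have "x \<in> T" by (subst V(4)) (use \<beta>(2) 1 V in \<open>auto simp: convex_hull_finite intro!: exI[of _ "\<lambda>a. real (\<beta> a) / real k"]\<close>)
  moreover have "bary T a x = (if a \<in> vertices T then real (\<beta> a) / real k else 0)" for a
    unfolding \<beta>(2) using V 1 by (intro bary_combination[OF T]) auto
  ultimately show "x \<in> T \<and> (\<forall>a. real k * bary T a x \<in> \<nat>)" using k by auto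
next
  assume x: "x \<in> T \<and> (\<forall>a. real k * bary T a x \<in> \<nat>)"
  then have "\<forall>a. \<exists>n. real k * bary T a x = real n" by (auto elim: Nats_cases)
  then obtain \<beta> where \<beta>: "\<And>a. real k * bary T a x = real (\<beta> a)" by metis
  then have b: "bary T a x = real (\<beta> a) / real k" for a using k by (simp add: field_simps)
  have "real (sum \<beta> (vertices T)) = real k * (\<Sum>a\<in>vertices T. bary T a x)"
    by (simp add: sum_distrib_left \<beta>)
  also have "\<dots> = real k" using bary_simplex(4)[OF T] x by simp
  finally have "sum \<beta> (vertices T) = k" by linarith
  moreover have "x = (\<Sum>a\<in>vertices T. (real (\<beta> a) / real k) *\<^sub>R a)"
    using bary_simplex(5)[OF T, of x] x by (simp add: b)
  ultimately show "x \<in> lagrange_nodes k T" unfolding lagrange_nodes_def vertices_def by blast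
qed

text \<open>With a vertex \<open>a\<close> as origin and the edges divided by \<open>k\<close> as
  directions, the principal lattice is the lattice of \<open>Pk_unisolvent_lattice\<close>.\<close>

lemma Pk_unisolvent:
  assumes T: "int CARD('n) simplex (T :: (real^'n) set)" and k: "1 \<le> k"
    and p: "p \<in> Pk k" "\<And>j. j \<in> lagrange_nodes k T \<Longrightarrow> p j = 0"
  shows "p x = 0"
proof -
  note V = simplex_vertices[OF T]
  obtain a where a: "a \<in> vertices T" using V(3) by fastforce
  define f where "f b = (1 / real k) *\<^sub>R (b - a)" for b
  define B where "B = f ` (vertices T - {a})"
  have inj: "inj_on f X" for X using k by (auto simp: f_def inj_on_def)
  have "aff_dim (vertices T) = int CARD('n)"
    using V aff_dim_affine_independent[OF V(2)] by simp
  then have "affine hull (vertices T) = UNIV" using aff_dim_eq_full[of "vertices T"] by simp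
  then have "(\<lambda>x. a + x) ` span ((\<lambda>x. - a + x) ` (vertices T - {a})) = UNIV"
    using affine_hull_span2[OF a] by simp
  then have "span ((\<lambda>x. - a + x) ` (vertices T - {a})) = UNIV"
    by (metis (no_types, lifting) UNIV_eq_I add_left_cancel imageE rangeI)
  moreover have "(\<lambda>x. - a + x) ` (vertices T - {a}) \<subseteq> span B"
  proof
    fix y assume "y \<in> (\<lambda>x. - a + x) ` (vertices T - {a})"
    then obtain b where b: "b \<in> vertices T - {a}" "y = - a + b" by blast
    then have "f b \<in> span B" by (auto simp: B_def intro: span_base)
    then have "real k *\<^sub>R f b \<in> span B" by (rule span_scale)
    then show "y \<in> span B" using k b by (simp add: f_def)
  qed
  ultimately have "span B = UNIV" by (metis UNIV_eq_I span_mono span_span UNIV_I subsetD)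
  then show ?thesis
  proof (rule Pk_unisolvent_lattice[rotated, OF _ p(1)])
    show "finite B" using V by (simp add: B_def)
    fix \<beta> :: "real^'n \<Rightarrow> nat" assume \<beta>: "sum \<beta> B \<le> k"
    \<comment> \<open>The vertex \<open>a\<close> receives what is missing to the total
      \<open>k\<close>; this turns an exponent sum of at most \<open>k\<close> into one equal to
      \<open>k\<close>.\<close>
    define \<beta>' where "\<beta>' b = (if b = a then k - sum \<beta> B else \<beta> (f b))" for b
    have S: "sum \<beta> B = (\<Sum>b\<in>vertices T - {a}. \<beta> (f b))"
      unfolding B_def by (subst sum.reindex[OF inj]) simp
    have S': "(\<Sum>b\<in>vertices T - {a}. \<beta>' b) = sum \<beta> B" unfolding S by (rule sum.cong) (auto simp: \<beta>'_def)
    then have "sum \<beta>' (vertices T) = k" using a V \<beta> by (simp add: sum.remove[of "vertices T" a] \<beta>'_def[of a])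
    moreover have "a + (\<Sum>u\<in>B. real (\<beta> u) *\<^sub>R u) = (\<Sum>b\<in>vertices T. (real (\<beta>' b) / real k) *\<^sub>R b)"
    proof -
      have "(\<Sum>u\<in>B. real (\<beta> u) *\<^sub>R u) = (\<Sum>b\<in>vertices T - {a}. real (\<beta> (f b)) *\<^sub>R f b)"
        unfolding B_def by (subst sum.reindex[OF inj]) simp
      also have "\<dots> = (\<Sum>b\<in>vertices T - {a}. (real (\<beta>' b) / real k) *\<^sub>R b - (real (\<beta>' b) / real k) *\<^sub>R a)"
        by (rule sum.cong) (auto simp: \<beta>'_def f_def algebra_simps)
      also have "\<dots> = (\<Sum>b\<in>vertices T - {a}. (real (\<beta>' b) / real k) *\<^sub>R b) - (real (sum \<beta> B) / real k) *\<^sub>R a"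
        by (simp add: sum_subtractf scaleR_left.sum[symmetric] sum_divide_distrib[symmetric] of_nat_sum[symmetric] S' del: of_nat_sum)
      finally have "a + (\<Sum>u\<in>B. real (\<beta> u) *\<^sub>R u) =
          (\<Sum>b\<in>vertices T - {a}. (real (\<beta>' b) / real k) *\<^sub>R b) + (1 - real (sum \<beta> B) / real k) *\<^sub>R a"
        by (simp add: algebra_simps)
      moreover have "1 - real (sum \<beta> B) / real k = real (\<beta>' a) / real k"
        using \<beta> k by (simp add: \<beta>'_def of_nat_diff diff_divide_distrib)
      ultimately show ?thesis using a V by (simp add: sum.remove[of "vertices T" a])
    qed
    ultimately have "a + (\<Sum>u\<in>B. real (\<beta> u) *\<^sub>R u) \<in> lagrange_nodes k T"
      unfolding lagrange_nodes_def vertices_def by blast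
    then show "p (a + (\<Sum>u\<in>B. real (\<beta> u) *\<^sub>R u)) = 0" by (rule p(2))
  qed
qed

section \<open>The nodal basis\<close>

text \<open>Restrict \<open>p\<close> to the line from a point of \<open>U\<close> to
  \<open>z\<close>: it has infinitely many roots. Hence a polynomial is determined by its values on
  an element, and a nonzero one vanishes on no open part of it.\<close>

lemma Pk_zero_open:
  fixes p :: "real^'n \<Rightarrow> real"
  assumes p: "p \<in> Pk k" and U: "open U" "U \<noteq> {}" "\<And>x. x \<in> U \<Longrightarrow> p x = 0"
  shows "p z = 0"
proof -
  obtain y where y: "y \<in> U" using U by blast
  obtain q where q: "degree q \<le> k" "\<And>t. p (y + t *\<^sub>R (z - y)) = poly q t" using Pk_line[OF p] by metis
  have "open ((\<lambda>t. y + t *\<^sub>R (z - y)) -` U)"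
    by (intro open_vimage U continuous_intros)
  moreover have "0 \<in> (\<lambda>t. y + t *\<^sub>R (z - y)) -` U" using y by simp
  ultimately have "infinite ((\<lambda>t. y + t *\<^sub>R (z - y)) -` U)"
    using finite_imp_not_open by blast
  moreover have "(\<lambda>t. y + t *\<^sub>R (z - y)) -` U \<subseteq> {t. poly q t = 0}"
    using U(3) by (auto simp: q(2)[symmetric])
  ultimately have "infinite {t. poly q t = 0}" by (rule infinite_super[rotated])
  then have "q = 0" using poly_roots_finite by blast
  then show ?thesis using q(2)[of 1] by simp
qed

lemma simplex_interior:
  assumes "int CARD('n) simplex (T :: (real^'n) set)"
  shows "convex T" "compact T" "interior T \<noteq> {}" "closure (interior T) = T"
proof -
  show T: "convex T" "compact T" using assms convex_simplex compact_simplex by blast+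
  have "aff_dim T = int CARD('n)"
    using simplex_vertices[OF assms] aff_dim_affine_independent[OF simplex_vertices(2)[OF assms]]
    by (metis aff_dim_convex_hull add_right_cancel of_nat_1 of_nat_add)
  then have "affine hull T = UNIV" using aff_dim_eq_full[of T] by simp
  then have "interior T = rel_interior T" by (simp add: rel_interior_interior)
  moreover have "T \<noteq> {}" using \<open>aff_dim T = int CARD('n)\<close> by auto
  ultimately show "interior T \<noteq> {}" using T rel_interior_eq_empty by blast
  then show "closure (interior T) = T"
    using T by (simp add: convex_closure_interior compact_imp_closed)
qed

text \<open>The count is crude, but it depends on \<open>k\<close> and the dimension only and enters
  the final constant.\<close>

lemma finite_lagrange_nodes:
  assumes T: "int CARD('n) simplex (T :: (real^'n) set)"
  shows "finite (lagrange_nodes k T)" "card (lagrange_nodes k T) \<le> Suc k ^ Suc CARD('n)"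
proof -
  note V = simplex_vertices[OF T]
  let ?B = "PiE (vertices T) (\<lambda>_. {..k})"
  let ?f = "\<lambda>\<beta>. \<Sum>a\<in>vertices T. (real (\<beta> a) / real k) *\<^sub>R a"
  have sub: "lagrange_nodes k T \<subseteq> ?f ` ?B"
  proof
    fix x assume "x \<in> lagrange_nodes k T"
    then obtain \<beta> :: "real^'n \<Rightarrow> nat" where \<beta>: "sum \<beta> (vertices T) = k" "x = ?f \<beta>"
      unfolding lagrange_nodes_def vertices_def by blast
    have "\<beta> a \<le> k" if "a \<in> vertices T" for a
      using member_le_sum[of a "vertices T" \<beta>] that V \<beta> by auto
    then have "restrict \<beta> (vertices T) \<in> ?B" by auto
    moreover have "x = ?f (restrict \<beta> (vertices T))" unfolding \<beta>(2) by (intro sum.cong) auto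
    ultimately show "x \<in> ?f ` ?B" by blast
  qed
  have fin: "finite ?B" using V by (intro finite_PiE) auto
  then show "finite (lagrange_nodes k T)" using sub finite_surj by blast
  have "card (lagrange_nodes k T) \<le> card ?B" using sub fin by (rule surj_card_le[rotated])
  also have "card ?B = Suc k ^ Suc CARD('n)" using V by (simp add: card_PiE)
  finally show "card (lagrange_nodes k T) \<le> Suc k ^ Suc CARD('n)" .
qed

section \<open>Hat functions and Lagrange basis of a mesh\<close>

locale simplicial_mesh =
  fixes \<T> :: "(real^'n) set set" and k :: nat
  assumes triangulation: "triangulation \<T>"
    and simplex: "T \<in> \<T> \<Longrightarrow> int CARD('n) simplex T"
    and degree_pos: "1 \<le> k"
begin

lemma finite_mesh: "finite \<T>"
  using triangulation unfolding triangulation_def by blast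

lemma face_Int: "T \<in> \<T> \<Longrightarrow> T' \<in> \<T> \<Longrightarrow> T \<inter> T' face_of T"
  using triangulation unfolding triangulation_def by blast

text \<open>The point lies in the common face, which is the convex hull of its extreme points, and
  these are vertices of both simplices. One convex combination therefore yields the coordinates in
  both.\<close>

lemma bary_agree:
  assumes T: "T \<in> \<T>" "T' \<in> \<T>" and x: "x \<in> T" "x \<in> T'"
  shows "bary T a x = bary T' a x"
proof -
  define F where "F = T \<inter> T'"
  have F: "F face_of T" "F face_of T'" using face_Int[OF T(1,2)] face_Int[OF T(2,1)] by (simp_all add: F_def Int_commute)
  have sub: "vertices F \<subseteq> vertices T" "vertices F \<subseteq> vertices T'"
    using extreme_point_of_face[OF F(1)] extreme_point_of_face[OF F(2)] by (auto simp: vertices_def)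
  have fin: "finite (vertices F)" using sub simplex_vertices(1)[OF simplex[OF T(1)]] finite_subset by blast
  have "compact F" "convex F"
    using simplex_interior(1,2)[OF simplex] T by (auto simp: F_def intro: compact_Int convex_Int)
  then have "F = convex hull (vertices F)" unfolding vertices_def by (rule Krein_Milman_Minkowski)
  then have "x \<in> convex hull (vertices F)" using x by (simp add: F_def)
  then obtain u where u: "sum u (vertices F) = 1" "x = (\<Sum>b\<in>vertices F. u b *\<^sub>R b)"
    using fin by (auto simp: convex_hull_finite)
  show ?thesis
    unfolding u(2) using bary_combination[OF simplex[OF T(1)] fin sub(1) u(1)]
      bary_combination[OF simplex[OF T(2)] fin sub(2) u(1)] by simp
qed

definition hat :: "real^'n \<Rightarrow> real^'n \<Rightarrow> real" where
  "hat a x = bary (SOME T. T \<in> \<T> \<and> x \<in> T) a x"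

lemma hat_eq: "T \<in> \<T> \<Longrightarrow> x \<in> T \<Longrightarrow> hat a x = bary T a x"
  unfolding hat_def by (rule someI2[of "\<lambda>T. T \<in> \<T> \<and> x \<in> T" T]) (auto intro: bary_agree)

definition mesh_vertices :: "(real^'n) set" where
  "mesh_vertices = (\<Union>T\<in>\<T>. vertices T)"

lemma finite_mesh_vertices: "finite mesh_vertices"
  using finite_mesh simplex_vertices(1)[OF simplex] by (auto simp: mesh_vertices_def)

lemma hat_props:
  assumes T: "T \<in> \<T>" "x \<in> T"
  shows "0 \<le> hat a x" "hat a x \<le> 1" "(\<Sum>a\<in>mesh_vertices. hat a x) = 1"
    "(\<Sum>a\<in>mesh_vertices. hat a x *\<^sub>R a) = x"
proof -
  note b = bary_simplex[OF simplex[OF T(1)] T(2)]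
  show "0 \<le> hat a x" "hat a x \<le> 1" using b T by (simp_all add: hat_eq)
  have sub: "vertices T \<subseteq> mesh_vertices" using T by (auto simp: mesh_vertices_def)
  have "(\<Sum>a\<in>mesh_vertices. hat a x) = (\<Sum>a\<in>vertices T. bary T a x)"
    using b(3) T sub finite_mesh_vertices by (intro sum.mono_neutral_cong_right) (auto simp: hat_eq)
  then show "(\<Sum>a\<in>mesh_vertices. hat a x) = 1" using b(4) by simp
  have "(\<Sum>a\<in>mesh_vertices. hat a x *\<^sub>R a) = (\<Sum>a\<in>vertices T. bary T a x *\<^sub>R a)"
    using b(3) T sub finite_mesh_vertices by (intro sum.mono_neutral_cong_right) (auto simp: hat_eq)
  then show "(\<Sum>a\<in>mesh_vertices. hat a x *\<^sub>R a) = x" using b(5) by simp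
qed

definition nodes :: "(real^'n) set" where
  "nodes = (\<Union>T\<in>\<T>. lagrange_nodes k T)"

text \<open>The nodes are conforming: a node of one element is a node of every element that contains
  it, because \<open>hat\<close> does not depend on the element.\<close>

lemma lagrange_nodes_eq: "T \<in> \<T> \<Longrightarrow> lagrange_nodes k T = nodes \<inter> T"
proof -
  have char: "x \<in> lagrange_nodes k T \<longleftrightarrow> x \<in> T \<and> (\<forall>a. real k * hat a x \<in> \<nat>)" if "T \<in> \<T>" for T x
    using lagrange_nodes_simplex[OF simplex[OF that] degree_pos, of x] hat_eq[OF that] by auto
  then show "T \<in> \<T> \<Longrightarrow> lagrange_nodes k T = nodes \<inter> T"
    unfolding nodes_def by blast
qed

lemma nodes_in_mesh: "i \<in> nodes \<Longrightarrow> \<exists>T\<in>\<T>. i \<in> T"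
  using lagrange_nodes_eq unfolding nodes_def by blast

text \<open>The floor only changes the type: at a node, \<open>real k * hat a i\<close> is a natural
  number.\<close>

definition multi :: "real^'n \<Rightarrow> real^'n \<Rightarrow> nat" where
  "multi i a = nat \<lfloor>real k * hat a i\<rfloor>"

lemma multi_props:
  assumes "i \<in> nodes"
  shows "real (multi i a) = real k * hat a i" "(\<Sum>a\<in>mesh_vertices. multi i a) = k"
proof -
  obtain T where T: "T \<in> \<T>" "i \<in> lagrange_nodes k T" using assms by (auto simp: nodes_def)
  then have i: "i \<in> T" "\<And>a. real k * hat a i \<in> \<nat>"
    using lagrange_nodes_simplex[OF simplex[OF T(1)] degree_pos, of i] hat_eq[OF T(1)] by auto
  show eq: "real (multi i a) = real k * hat a i" for a
    using i(2)[of a] by (auto simp: multi_def elim: Nats_cases)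
  have "real (\<Sum>a\<in>mesh_vertices. multi i a) = real k * (\<Sum>a\<in>mesh_vertices. hat a i)"
    by (simp add: eq sum_distrib_left)
  then show "(\<Sum>a\<in>mesh_vertices. multi i a) = k"
    using hat_props(3)[OF T(1) i(1)] by (simp del: of_nat_sum)
qed

text \<open>The Lagrange basis in barycentric coordinates.  The product runs over all vertices of the mesh, which
  makes \<open>psi i\<close> well defined across elements; vertices outside an element contribute nothing to
  the nodes in it.\<close>

definition psi :: "real^'n \<Rightarrow> real^'n \<Rightarrow> real" where
  "psi i x = (\<Prod>a\<in>mesh_vertices. \<Prod>l<multi i a. (real k * hat a x - real l) / (real (multi i a) - real l))"

lemma psi_poly:
  assumes "T \<in> \<T>" "i \<in> nodes"
  shows "\<exists>p\<in>Pk k. \<forall>x\<in>T. psi i x = p x"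
proof -
  let ?p = "\<lambda>x. \<Prod>a\<in>mesh_vertices. \<Prod>l<multi i a. (real k * bary T a x - real l) / (real (multi i a) - real l)"
  have "?p \<in> Pk (\<Sum>a\<in>mesh_vertices. \<Sum>l<multi i a. 1)"
  proof (intro Pk_prod finite_mesh_vertices finite_lessThan)
    fix a l
    have "(\<lambda>x. (1 / (real (multi i a) - real l)) * (real k * bary T a x - real l)) \<in> Pk 1"
      by (intro Pk_cmult Pk_diff Pk_const bary_Pk simplex assms)
    then show "(\<lambda>x. (real k * bary T a x - real l) / (real (multi i a) - real l)) \<in> Pk 1" by simp
  qed
  then have "?p \<in> Pk k" using multi_props(2)[OF assms(2)] by simp
  moreover have "\<forall>x\<in>T. psi i x = ?p x" using hat_eq[OF assms(1)] by (simp add: psi_def)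
  ultimately show ?thesis by (intro bexI[of _ ?p])
qed

text \<open>Distinct nodes have distinct multi-indices with the same sum \<open>k\<close>, so some
  vertex \<open>a\<close> satisfies \<open>multi j a < multi i a\<close>. The factor with
  \<open>l = multi j a\<close> then vanishes at \<open>j\<close>.\<close>

lemma psi_delta:
  assumes "i \<in> nodes" "j \<in> nodes"
  shows "psi i j = (if j = i then 1 else 0)"
proof (cases "j = i")
  case True
  then show ?thesis by (auto simp: psi_def multi_props(1)[OF assms(1), symmetric] intro!: prod.neutral)
next
  case False
  have eq: "hat a i = real (multi i a) / real k" "hat a j = real (multi j a) / real k" for a
    using multi_props(1)[OF assms(1), of a] multi_props(1)[OF assms(2), of a] degree_pos by simp_all
  obtain Ti Tj where T: "Ti \<in> \<T>" "i \<in> Ti" "Tj \<in> \<T>" "j \<in> Tj"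
    using nodes_in_mesh assms by metis
  have "\<exists>a\<in>mesh_vertices. multi j a \<noteq> multi i a"
  proof (rule ccontr)
    assume "\<not> ?thesis"
    then have "(\<Sum>a\<in>mesh_vertices. hat a i *\<^sub>R a) = (\<Sum>a\<in>mesh_vertices. hat a j *\<^sub>R a)"
      by (intro sum.cong) (auto simp: eq)
    then show False using hat_props(4)[OF T(1,2)] hat_props(4)[OF T(3,4)] False by simp
  qed
  have "\<exists>a\<in>mesh_vertices. multi j a < multi i a"
  proof (rule ccontr)
    assume "\<not> ?thesis"
    then have le: "\<forall>a\<in>mesh_vertices. multi i a \<le> multi j a" by (simp add: not_less)
    with \<open>\<exists>a\<in>mesh_vertices. multi j a \<noteq> multi i a\<close>
    have "\<exists>a\<in>mesh_vertices. multi i a < multi j a" by (metis le_neq_implies_less)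
    then have "(\<Sum>a\<in>mesh_vertices. multi i a) < (\<Sum>a\<in>mesh_vertices. multi j a)"
      by (rule sum_strict_mono_ex1[OF finite_mesh_vertices le])
    then show False by (simp add: multi_props(2)[OF assms(1)] multi_props(2)[OF assms(2)])
  qed
  then obtain a where a: "a \<in> mesh_vertices" "multi j a < multi i a" by blast
  then have "(\<Prod>l<multi i a. (real k * hat a j - real l) / (real (multi i a) - real l)) = 0"
    by (intro prod_zero) (auto simp flip: multi_props(1)[OF assms(2)])
  then show ?thesis using False a(1) finite_mesh_vertices by (auto simp: psi_def intro!: prod_zero)
qed

text \<open>There are \<open>k\<close> factors in all, each with numerator at most \<open>k\<close>
  and denominator at least 1. The bound is blind to the shape of the element.\<close>

lemma psi_bound:
  assumes "T \<in> \<T>" "x \<in> T" "i \<in> nodes"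
  shows "\<bar>psi i x\<bar> \<le> real k ^ k"
proof -
  have "\<bar>psi i x\<bar> = (\<Prod>a\<in>mesh_vertices. \<Prod>l<multi i a. \<bar>(real k * hat a x - real l) / (real (multi i a) - real l)\<bar>)"
    by (simp add: psi_def abs_prod)
  also have "\<dots> \<le> (\<Prod>a\<in>mesh_vertices. \<Prod>l<multi i a. real k)"
  proof (intro prod_mono conjI prod_nonneg ballI abs_ge_zero)
    fix a l assume a: "a \<in> mesh_vertices" and l: "l \<in> {..<multi i a}"
    have "multi i a \<le> k"
      using member_le_sum[of a mesh_vertices "multi i"] a finite_mesh_vertices multi_props(2)[OF assms(3)] by simp
    moreover have "0 \<le> real k * hat a x" "real k * hat a x \<le> real k"
      using hat_props(1,2)[OF assms(1,2)] by (auto intro: mult_left_le)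
    moreover have "real l + 1 \<le> real (multi i a)" using l by simp
    ultimately have "\<bar>real k * hat a x - real l\<bar> \<le> real k" "1 \<le> real (multi i a) - real l"
      unfolding abs_le_iff by linarith+
    then show "\<bar>(real k * hat a x - real l) / (real (multi i a) - real l)\<bar> \<le> real k"
      by (auto simp: abs_divide divide_le_eq intro: order_trans[OF _ mult_left_mono[of 1, simplified]])
  qed
  also have "\<dots> = real k ^ k"
    by (simp add: power_sum[symmetric] multi_props(2)[OF assms(3)])
  finally show ?thesis .
qed

lemma psi_continuous: "i \<in> nodes \<Longrightarrow> continuous_on (\<Union>\<T>) (psi i)"
proof -
  assume i: "i \<in> nodes"
  have "continuous_on (\<Union>T\<in>\<T>. T) (psi i)"
  proof (rule continuous_on_closed_Union[OF finite_mesh])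
    fix T assume T: "T \<in> \<T>"
    show "closed T" using simplex_interior(2)[OF simplex[OF T]] by (rule compact_imp_closed)
    obtain p where p: "p \<in> Pk k" "\<forall>x\<in>T. psi i x = p x" using psi_poly[OF T i] by blast
    then show "continuous_on T (psi i)" using Pk_continuous[OF p(1), of T] by (simp cong: continuous_on_cong)
  qed
  then show ?thesis by simp
qed

lemma nodal_expansion:
  assumes T: "T \<in> \<T>" "x \<in> T" and p: "p \<in> Pk k"
  shows "p x = (\<Sum>j\<in>lagrange_nodes k T. p j * psi j x)"
proof -
  have sub: "lagrange_nodes k T \<subseteq> nodes" using T by (auto simp: nodes_def)
  \<comment> \<open>\<open>psi i\<close> is a polynomial on each element only; unisolvence is
    applied to the polynomials \<open>q i\<close> that represent it on \<open>T\<close>.\<close>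
  obtain q where q: "\<And>i. i \<in> nodes \<Longrightarrow> q i \<in> Pk k" "\<And>i x. i \<in> nodes \<Longrightarrow> x \<in> T \<Longrightarrow> psi i x = q i x"
    using psi_poly[OF T(1)] by metis
  have "(\<lambda>x. p x - (\<Sum>j\<in>lagrange_nodes k T. p j * q j x)) x = 0"
  proof (rule Pk_unisolvent[OF simplex[OF T(1)] degree_pos])
    show "(\<lambda>x. p x - (\<Sum>j\<in>lagrange_nodes k T. p j * q j x)) \<in> Pk k"
      using p q(1) sub by (intro Pk_diff Pk_sum Pk_cmult) auto
    fix i assume i: "i \<in> lagrange_nodes k T"
    then have "i \<in> T" using lagrange_nodes_eq[OF T(1)] by blast
    then have "q j i = (if j = i then 1 else 0)" if "j \<in> lagrange_nodes k T" for j
      using q(2)[of j i] psi_delta[of j i] that i subsetD[OF sub] by auto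
    then have "(\<Sum>j\<in>lagrange_nodes k T. p j * q j i) = (\<Sum>j\<in>lagrange_nodes k T. if j = i then p i else 0)"
      by (intro sum.cong) auto
    then show "p i - (\<Sum>j\<in>lagrange_nodes k T. p j * q j i) = 0"
      using i finite_lagrange_nodes(1)[OF simplex[OF T(1)]] by simp
  qed
  moreover have "(\<Sum>j\<in>lagrange_nodes k T. p j * q j x) = (\<Sum>j\<in>lagrange_nodes k T. p j * psi j x)"
    using sub q(2) T(2) by (intro sum.cong) auto
  ultimately show ?thesis by simp
qed

lemma psi_zero:
  assumes "T \<in> \<T>" "x \<in> T" "i \<in> nodes" "i \<notin> T"
  shows "psi i x = 0"
proof -
  obtain p where p: "p \<in> Pk k" "\<forall>x\<in>T. psi i x = p x" using psi_poly[OF assms(1,3)] by blast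
  have "p j = 0" if "j \<in> lagrange_nodes k T" for j
    using that p(2) psi_delta[OF assms(3), of j] assms(4) lagrange_nodes_eq[OF assms(1)] by auto
  then show ?thesis using nodal_expansion[OF assms(1,2) p(1)] p(2) assms(2) by simp
qed

text \<open>Passes from nodes to the whole element with a constant that depends only on
  \<open>k\<close> and the dimension.\<close>

lemma nodal_bound:
  assumes T: "T \<in> \<T>" "x \<in> T" and p: "p \<in> Pk k" and M: "\<And>j. j \<in> lagrange_nodes k T \<Longrightarrow> \<bar>p j\<bar> \<le> M"
  shows "\<bar>p x\<bar> \<le> real (Suc k ^ Suc CARD('n)) * real k ^ k * M"
proof -
  \<comment> \<open>Without nodes, the expansion of the constant 1 would be 0. A node is what shows
    that \<open>M\<close> is nonnegative.\<close>
  have ne: "lagrange_nodes k T \<noteq> {}"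
  proof
    assume "lagrange_nodes k T = {}"
    then show False using nodal_expansion[OF T Pk_const[of 1]] by simp
  qed
  then have "M \<ge> 0" using M by (metis abs_ge_zero ex_in_conv order_trans)
  have "\<bar>p x\<bar> \<le> (\<Sum>j\<in>lagrange_nodes k T. \<bar>p j\<bar> * \<bar>psi j x\<bar>)"
    unfolding nodal_expansion[OF T p] abs_mult[symmetric] by (rule sum_abs)
  also have "\<dots> \<le> (\<Sum>j\<in>lagrange_nodes k T. M * real k ^ k)"
    using M \<open>M \<ge> 0\<close> psi_bound[OF T] lagrange_nodes_eq[OF T(1)] by (intro sum_mono mult_mono) auto
  also have "\<dots> = real (card (lagrange_nodes k T)) * (M * real k ^ k)" by simp
  also have "\<dots> \<le> real (Suc k ^ Suc CARD('n)) * (M * real k ^ k)"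
    using finite_lagrange_nodes(2)[OF simplex[OF T(1)], of k] \<open>M \<ge> 0\<close>
    by (intro mult_right_mono) (auto simp del: power_Suc of_nat_power)
  finally show ?thesis by (simp add: mult_ac)
qed

section \<open>Evaluation of extensions, basis functions, supports and degrees of freedom\<close>

lemma poly_ext_eq:
  assumes "T \<in> \<T>" "p \<in> Pk k" "\<And>x. x \<in> T \<Longrightarrow> v x = p x"
  shows "poly_ext k T v = p"
  unfolding poly_ext_def
proof (rule the_equality)
  fix q assume q: "q \<in> Pk k \<and> (\<forall>x\<in>T. q x = v x)"
  have "q x - p x = 0" for x
    by (rule Pk_zero_open[OF Pk_diff[of q k p] open_interior simplex_interior(3)[OF simplex[OF assms(1)]]])
      (use q assms interior_subset in \<open>auto simp: subset_iff\<close>)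
  then show "q = p" by auto
qed (use assms in auto)

lemma active_space_polynomial:
  assumes "v \<in> active_space k \<T> \<Omega>" "T \<in> active_mesh \<T> \<Omega>"
  shows "\<exists>p\<in>Pk k. \<forall>x\<in>T. v x = p x"
proof -
  obtain w where w: "w \<in> fe_space k \<T>" "v = (\<lambda>x. if x \<in> active_domain \<T> \<Omega> then w x else 0)"
    using assms(1) by (auto simp: active_space_def)
  have T: "T \<in> \<T>" "T \<subseteq> active_domain \<T> \<Omega>"
    using assms(2) by (auto simp: active_mesh_def active_domain_def)
  obtain p where "p \<in> Pk k" "\<forall>x\<in>T. w x = p x" using w(1) T(1) by (auto simp: fe_space_def)
  then show ?thesis using w(2) T(2) by (intro bexI[of _ p]) auto
qed

text \<open>Justifies the definite description in \<open>fe_basis_def\<close>. On active elements it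
  is unisolvence; elsewhere both functions are 0 by the extension convention.\<close>

lemma active_space_unique:
  assumes "v \<in> active_space k \<T> \<Omega>" "w \<in> active_space k \<T> \<Omega>" "\<And>j. j \<in> node_set k \<T> \<Omega> \<Longrightarrow> v j = w j"
  shows "v = w"
proof
  fix x
  show "v x = w x"
  proof (cases "x \<in> active_domain \<T> \<Omega>")
    case True
    then obtain T where T: "T \<in> active_mesh \<T> \<Omega>" "x \<in> T" by (auto simp: active_domain_def)
    then have T': "T \<in> \<T>" by (simp add: active_mesh_def)
    have "\<exists>p\<in>Pk k. \<forall>x\<in>T. v x = p x" if "v \<in> active_space k \<T> \<Omega>" for v
      using active_space_polynomial[OF that T(1)] .
    then obtain p q where pq: "p \<in> Pk k" "\<forall>x\<in>T. v x = p x" "q \<in> Pk k" "\<forall>x\<in>T. w x = q x"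
      using assms(1,2) by metis
    have "p x - q x = 0"
    proof (rule Pk_unisolvent[OF simplex[OF T'] degree_pos Pk_diff[OF pq(1,3)]])
      fix j assume "j \<in> lagrange_nodes k T"
      then have "j \<in> T" "j \<in> node_set k \<T> \<Omega>"
        using lagrange_nodes_eq[OF T'] T by (auto simp: node_set_def)
      then show "p j - q j = 0" using assms(3)[of j] pq(2,4) by simp
    qed
    then show ?thesis using pq T by simp
  next
    case False
    then show ?thesis using assms(1,2) by (auto simp: active_space_def)
  qed
qed

lemma node_set_subset: "node_set k \<T> \<Omega> \<subseteq> nodes"
  by (auto simp: node_set_def nodes_def active_mesh_def)

lemma node_set_Int: "T \<in> active_mesh \<T> \<Omega> \<Longrightarrow> node_set k \<T> \<Omega> \<inter> T = lagrange_nodes k T"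
  using lagrange_nodes_eq by (auto simp: node_set_def active_mesh_def)

lemma fe_basis_eq:
  assumes i: "i \<in> node_set k \<T> \<Omega>"
  shows "fe_basis k \<T> \<Omega> i = (\<lambda>x. if x \<in> active_domain \<T> \<Omega> then psi i x else 0)"
  unfolding fe_basis_def
proof (rule the_equality, intro conjI ballI)
  let ?f = "\<lambda>x. if x \<in> active_domain \<T> \<Omega> then psi i x else 0"
  have in_nodes: "i \<in> nodes" using i node_set_subset by blast
  have "psi i \<in> fe_space k \<T>"
    using psi_continuous[OF in_nodes] psi_poly[OF _ in_nodes] by (auto simp: fe_space_def)
  then show f: "?f \<in> active_space k \<T> \<Omega>" by (auto simp: active_space_def)
  show delta: "?f j = (if j = i then 1 else 0)" if j: "j \<in> node_set k \<T> \<Omega>" for j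
  proof -
    have "j \<in> active_domain \<T> \<Omega>"
      using j node_set_Int unfolding node_set_def active_domain_def by blast
    moreover have "j \<in> nodes" using j node_set_subset by blast
    ultimately show ?thesis using psi_delta[OF in_nodes, of j] by simp
  qed
  fix v assume "v \<in> active_space k \<T> \<Omega> \<and> (\<forall>j\<in>node_set k \<T> \<Omega>. v j = (if j = i then 1 else 0))"
  then have "v \<in> active_space k \<T> \<Omega>" "v j = ?f j" if "j \<in> node_set k \<T> \<Omega>" for j
    using delta[OF that] that by auto
  then show "v = ?f" using f i by (intro active_space_unique) blast+
qed

text \<open>Turns every support condition of the definitions and assumptions into membership of the
  node. If \<open>i\<close> is outside \<open>T\<close>, the basis function vanishes on
  \<open>T\<close>; if \<open>i\<close> is in \<open>T\<close>, it is a nonzero polynomial there and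
  cannot vanish on an open part of \<open>T\<close>.\<close>

lemma subset_supp_iff:
  assumes T: "T \<in> active_mesh \<T> \<Omega>" and i: "i \<in> node_set k \<T> \<Omega>"
  shows "T \<subseteq> supp (fe_basis k \<T> \<Omega> i) \<longleftrightarrow> i \<in> T"
proof -
  define Z where "Z = {x. fe_basis k \<T> \<Omega> i x \<noteq> 0}"
  have T': "T \<in> \<T>" using T by (simp add: active_mesh_def)
  have dom: "T \<subseteq> active_domain \<T> \<Omega>" using T by (auto simp: active_domain_def)
  have in_nodes: "i \<in> nodes" using i node_set_subset by blast
  note int = simplex_interior[OF simplex[OF T']]
  have Z: "x \<in> Z \<longleftrightarrow> psi i x \<noteq> 0" if "x \<in> T" for x
    using that dom by (auto simp: Z_def fe_basis_eq[OF i])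
  have "T \<subseteq> closure Z \<longleftrightarrow> i \<in> T"
  proof
    assume sub: "T \<subseteq> closure Z"
    show "i \<in> T"
    proof (rule ccontr)
      assume "i \<notin> T"
      then have "interior T \<inter> Z = {}"
        using Z psi_zero[OF T' _ in_nodes] interior_subset by blast
      then have "interior T \<inter> closure Z = {}" using open_Int_closure_eq_empty[of "interior T" Z] by simp
      then show False using int(3) sub interior_subset by blast
    qed
  next
    assume iT: "i \<in> T"
    obtain p where p: "p \<in> Pk k" "\<forall>x\<in>T. psi i x = p x" using psi_poly[OF T' in_nodes] by blast
    show "T \<subseteq> closure Z"
    proof (rule ccontr)
      assume "\<not> T \<subseteq> closure Z"
      then obtain x where x: "x \<in> T" "x \<notin> closure Z" by blast
      have "(- closure Z) \<inter> interior T \<noteq> {}"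
        using x int(4) open_Int_closure_eq_empty[of "- closure Z" "interior T"] by auto
      moreover have "p y = 0" if "y \<in> (- closure Z) \<inter> interior T" for y
      proof -
        have "y \<in> T" "y \<notin> Z" using that interior_subset closure_subset by blast+
        then show ?thesis using Z p(2) by auto
      qed
      moreover have "open ((- closure Z) \<inter> interior T)" by auto
      ultimately have "p i = 0" using Pk_zero_open[OF p(1)] by metis
      then show False using p(2) iT psi_delta[OF in_nodes in_nodes] by simp
    qed
  qed
  then show ?thesis by (simp add: supp_def Z_def)
qed

lemma elem_indices_eq: "T \<in> active_mesh \<T> \<Omega> \<Longrightarrow> elem_indices k \<T> \<Omega> T = lagrange_nodes k T"
  using subset_supp_iff[of T \<Omega>] node_set_Int[of T \<Omega>] by (auto simp: elem_indices_def)

text \<open>The element degrees of freedom are point evaluations: the nodal values are coefficients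
  by \<open>nodal_expansion\<close>, and evaluating any expansion at \<open>i\<close> isolates its
  coefficient at \<open>i\<close>.\<close>

lemma elem_dof_eq:
  assumes T: "T \<in> active_mesh \<T> \<Omega>" and i: "i \<in> lagrange_nodes k T" and p: "p \<in> Pk k"
  shows "elem_dof k \<T> \<Omega> i T p = p i"
proof -
  have T': "T \<in> \<T>" using T by (simp add: active_mesh_def)
  have dom: "T \<subseteq> active_domain \<T> \<Omega>" using T by (auto simp: active_domain_def)
  have nodes: "lagrange_nodes k T \<subseteq> node_set k \<T> \<Omega>" "lagrange_nodes k T \<subseteq> nodes"
    using T T' by (auto simp: node_set_def nodes_def)
  have basis: "fe_basis k \<T> \<Omega> j x = psi j x" if "j \<in> lagrange_nodes k T" "x \<in> T" for j x
    using subsetD[OF dom that(2)] fe_basis_eq[OF subsetD[OF nodes(1) that(1)]] by simp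
  have sum_eq: "(\<Sum>j\<in>elem_indices k \<T> \<Omega> T. a j * fe_basis k \<T> \<Omega> j x) = (\<Sum>j\<in>lagrange_nodes k T. a j * psi j x)"
    if "x \<in> T" for a x
    unfolding elem_indices_eq[OF T] using that basis by (intro sum.cong) auto
  show ?thesis
    unfolding elem_dof_def
  proof (rule the_equality)
    show "\<exists>a. a i = p i \<and> (\<forall>x\<in>T. p x = (\<Sum>j\<in>elem_indices k \<T> \<Omega> T. a j * fe_basis k \<T> \<Omega> j x))"
      using nodal_expansion[OF T' _ p] sum_eq by (intro exI[of _ p]) auto
  next
    fix c assume "\<exists>a. a i = c \<and> (\<forall>x\<in>T. p x = (\<Sum>j\<in>elem_indices k \<T> \<Omega> T. a j * fe_basis k \<T> \<Omega> j x))"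
    then obtain a where a: "a i = c" "\<And>x. x \<in> T \<Longrightarrow> p x = (\<Sum>j\<in>lagrange_nodes k T. a j * psi j x)"
      using sum_eq by auto
    have "i \<in> T" using i lagrange_nodes_eq[OF T'] by blast
    then have "p i = (\<Sum>j\<in>lagrange_nodes k T. a j * psi j i)" by (rule a(2))
    also have "\<dots> = (\<Sum>j\<in>lagrange_nodes k T. if j = i then a i else 0)"
      using psi_delta subsetD[OF nodes(2)] subsetD[OF nodes(2) i] by (intro sum.cong) auto
    finally show "c = p i" using a(1) i finite_lagrange_nodes(1)[OF simplex[OF T']] by simp
  qed
qed

end

section \<open>Integrals over the mesh\<close>

lemma energy_cong_open:
  assumes p: "p \<in> Pk k" and U: "open U" "x \<in> U" "\<And>y. y \<in> U \<Longrightarrow> v y = p y"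
  shows "energy m v x = energy m p x"
proof -
  have "(v has_derivative (\<lambda>w. grad p x \<bullet> w)) (at x)"
    using Pk_has_derivative[OF p, of x] by (rule has_derivative_transform_within_open) (use U in auto)
  then have "grad v x = grad p x" by (rule grad_eqI)
  then show ?thesis using U by (simp add: energy_def)
qed

lemma nabla_norm_sq:
  assumes "energy m v absolutely_integrable_on X"
  shows "(nabla_norm m X v)\<^sup>2 = integral X (energy m v)"
proof -
  have "integral X (energy m v) = (LINT x:X|lebesgue. energy m v x)"
    using assms by (rule set_lebesgue_integral_eq_integral(2)[symmetric])
  moreover have "(LINT x:X|lebesgue. energy m v x) \<ge> 0"
    unfolding set_lebesgue_integral_def by (intro integral_nonneg_AE) (simp add: energy_nonneg)
  ultimately show ?thesis
    by (auto simp: nabla_norm_def L2_norm_def energy_def[abs_def])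
qed

context simplicial_mesh
begin

lemma element_lmeasurable:
  assumes "T \<in> \<T>"
  shows "T \<in> lmeasurable" "bounded T"
  using simplex_interior(2)[OF simplex[OF assms]] by (simp_all add: compact_imp_bounded lmeasurable_compact)

text \<open>The intersection is a face of both and differs from at least one of them, so its
  dimension is less than full.\<close>

lemma negligible_Int:
  assumes T: "T \<in> \<T>" "T' \<in> \<T>" "T \<noteq> T'"
  shows "negligible (T \<inter> T')"
proof -
  have conv: "convex T" "convex T'" using simplex_interior(1)[OF simplex] T by auto
  have "aff_dim (T \<inter> T') < int CARD('n)"
  proof (cases "T \<inter> T' = T")
    case True
    then have "T \<inter> T' \<noteq> T'" using T(3) by auto
    then show ?thesis
      using face_of_aff_dim_lt[OF conv(2), of "T \<inter> T'"] face_Int[OF T(2,1)] aff_dim_le_DIM[of T']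
      by (simp add: Int_commute)
  next
    case False
    then show ?thesis
      using face_of_aff_dim_lt[OF conv(1), of "T \<inter> T'"] face_Int[OF T(1,2)] aff_dim_le_DIM[of T] by simp
  qed
  then have "interior (T \<inter> T') = {}" using aff_dim_nonempty_interior[of "T \<inter> T'"] by fastforce
  then show ?thesis using negligible_convex_interior[OF convex_Int[OF conv]] by blast
qed

text \<open>Volume packing: the elements overlap in null sets only, so their volumes add up to at
  most that of the ball.\<close>

lemma card_elements_in_ball:
  assumes "\<A> \<subseteq> \<T>" "\<And>T. T \<in> \<A> \<Longrightarrow> T \<subseteq> cball y r" "\<And>T. T \<in> \<A> \<Longrightarrow> V \<le> measure lebesgue T" "0 \<le> r"
  shows "real (card \<A>) * V \<le> unit_ball_vol (real CARD('n)) * r ^ CARD('n)"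
proof -
  have fin: "finite \<A>" using assms(1) finite_mesh finite_subset by blast
  have "real (card \<A>) * V \<le> (\<Sum>T\<in>\<A>. measure lebesgue T)"
    using sum_mono[of \<A> "\<lambda>_. V" "measure lebesgue"] assms(3) by simp
  also have "\<dots> = measure lebesgue (\<Union>\<A>)"
    using assms(1) element_lmeasurable(1) negligible_Int
    by (intro measure_negligible_finite_Union[symmetric] fin) (auto simp: pairwise_def subset_iff)
  also have "\<dots> \<le> measure lebesgue (cball y r)"
    using assms(1,2) element_lmeasurable(1) fin
    by (intro measure_mono_fmeasurable sets.finite_Union lmeasurable_cball) (auto simp: fmeasurable_def subset_iff)
  also have "\<dots> = unit_ball_vol (real CARD('n)) * r ^ CARD('n)"
    using content_cball[OF assms(4), of y] by simp
  finally show ?thesis .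
qed

text \<open>Near an interior point of \<open>T\<close> the functions \<open>v\<close> and
  \<open>p\<close> coincide, hence so do their gradients. On the frontier \<open>grad v\<close> may
  be anything, but the frontier of a convex set is negligible.\<close>

lemma energy_element:
  assumes T: "T \<in> \<T>" and X: "X \<in> sets lebesgue" and p: "p \<in> Pk k" "\<And>x. x \<in> T \<Longrightarrow> v x = p x"
  shows "energy m v absolutely_integrable_on (T \<inter> X)"
    "integral (T \<inter> X) (energy m v) = integral (T \<inter> X) (energy m p)"
proof -
  have fr: "negligible (frontier T)"
    using simplex_interior(1)[OF simplex[OF T]] by (rule negligible_convex_frontier)
  have eq: "energy m v x = energy m p x" if "x \<in> (T \<inter> X) - frontier T" for x
  proof (rule energy_cong_open[OF p(1) open_interior])
    show "x \<in> interior T" using that closure_subset by (auto simp: frontier_def)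
    show "v y = p y" if "y \<in> interior T" for y using that p(2) interior_subset by blast
  qed
  have "T \<inter> X \<in> lmeasurable"
    using element_lmeasurable(1)[OF T] X by (rule fmeasurable_Int_fmeasurable)
  then have "energy m p absolutely_integrable_on (T \<inter> X)"
    using energy_integrable[OF p(1)] element_lmeasurable(2)[OF T] bounded_subset by blast
  then show "energy m v absolutely_integrable_on (T \<inter> X)"
    by (rule absolutely_integrable_spike[OF _ fr eq])
  show "integral (T \<inter> X) (energy m v) = integral (T \<inter> X) (energy m p)"
    by (rule integral_spike[OF fr eq, symmetric])
qed

lemma energy_sum:
  assumes v: "v \<in> active_space k \<T> \<Omega>" and X: "X \<in> sets lebesgue" "X \<subseteq> active_domain \<T> \<Omega>"
  shows "(nabla_norm m X v)\<^sup>2 = (\<Sum>T\<in>active_mesh \<T> \<Omega>. integral (T \<inter> X) (energy m v))"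
proof -
  have fin: "finite (active_mesh \<T> \<Omega>)" using finite_mesh by (simp add: active_mesh_def)
  have "(energy m v has_integral (\<Sum>T\<in>active_mesh \<T> \<Omega>. integral (T \<inter> X) (energy m v)))
      (\<Union>T\<in>active_mesh \<T> \<Omega>. T \<inter> X)"
  proof (rule has_integral_UN[OF fin])
    fix T assume T: "T \<in> active_mesh \<T> \<Omega>"
    then obtain p where p: "p \<in> Pk k" "\<forall>x\<in>T. v x = p x" using active_space_polynomial[OF v] by blast
    have "T \<in> \<T>" using T by (simp add: active_mesh_def)
    then have "energy m v absolutely_integrable_on (T \<inter> X)" by (rule energy_element(1)[OF _ X(1) p(1) bspec[OF p(2)]])
    then show "(energy m v has_integral integral (T \<inter> X) (energy m v)) (T \<inter> X)"
      by (intro integrable_integral) (simp add: absolutely_integrable_on_def)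
  next
    have "negligible ((T \<inter> X) \<inter> (T' \<inter> X))" if "T \<in> \<T>" "T' \<in> \<T>" "T \<noteq> T'" for T T'
      using negligible_Int[OF that] by (rule negligible_subset) auto
    then show "pairwise (\<lambda>T T'. negligible ((T \<inter> X) \<inter> (T' \<inter> X))) (active_mesh \<T> \<Omega>)"
      unfolding pairwise_def active_mesh_def by blast
  qed
  moreover have "(\<Union>T\<in>active_mesh \<T> \<Omega>. T \<inter> X) = X" using X(2) by (auto simp: active_domain_def)
  ultimately have hi: "(energy m v has_integral (\<Sum>T\<in>active_mesh \<T> \<Omega>. integral (T \<inter> X) (energy m v))) X"
    by simp
  then have "energy m v absolutely_integrable_on X"
    by (intro nonnegative_absolutely_integrable_1 energy_nonneg) (auto simp: integrable_on_def)
  then show ?thesis using nabla_norm_sq integral_unique[OF hi] by metis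
qed

end

section \<open>Chains of elements\<close>

text \<open>The triangle inequality through points chosen in consecutive intersections. With
  \<open>f\<close> the identity it bounds distances along a path; with \<open>f = v\<close> it
  bounds increments of \<open>v\<close>, and a shared intermediate point is where continuity
  enters.\<close>

lemma chain_dist:
  fixes f :: "'a \<Rightarrow> 'b::metric_space"
  assumes "P \<noteq> []" "successively (\<lambda>K K'. K \<inter> K' \<noteq> {}) P"
    and "\<And>K x y. K \<in> set P \<Longrightarrow> x \<in> K \<Longrightarrow> y \<in> K \<Longrightarrow> dist (f x) (f y) \<le> B" "0 \<le> B"
    and "x \<in> hd P" "K \<in> set P" "y \<in> K"
  shows "dist (f x) (f y) \<le> real (length P) * B"
  using assms
proof (induction P arbitrary: x)
  case (Cons K0 P)
  show ?case
  proof (cases "K = K0")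
    case True
    then have "dist (f x) (f y) \<le> B" using Cons.prems by auto
    moreover have "B \<le> real (length (K0 # P)) * B" using Cons.prems(4) by (simp add: distrib_right)
    ultimately show ?thesis by linarith
  next
    case False
    then have K: "K \<in> set P" using Cons.prems by auto
    then have ne: "P \<noteq> []" by auto
    then obtain z where z: "z \<in> K0" "z \<in> hd P" using Cons.prems(2) by (auto simp: successively_Cons)
    have "dist (f z) (f y) \<le> real (length P) * B"
      using Cons.prems K ne z by (intro Cons.IH) (auto simp: successively_Cons)
    moreover have "dist (f x) (f z) \<le> B" using Cons.prems z by auto
    ultimately show ?thesis using dist_triangle[of "f x" "f y" "f z"] by (simp add: distrib_right)
  qed
qed simp

lemma elem_path_dist:
  fixes f :: "real^'n \<Rightarrow> 'b::metric_space"
  assumes P: "elem_path \<M> N T T' P"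
    and f: "\<And>K x y. K \<in> set P \<Longrightarrow> x \<in> K \<Longrightarrow> y \<in> K \<Longrightarrow> dist (f x) (f y) \<le> B" "0 \<le> B"
    and x: "x \<in> T" "K \<in> set P" "y \<in> K"
  shows "dist (f x) (f y) \<le> real N * B"
proof -
  have "successively (\<lambda>K K'. \<exists>F. F facet_of K \<and> F facet_of K') P" using P by (simp add: elem_path_def)
  then have "successively (\<lambda>K K'. K \<inter> K' \<noteq> {}) P"
  proof (rule successively_mono)
    fix K K' :: "(real^'n) set"
    assume "\<exists>F. F facet_of K \<and> F facet_of K'"
    then obtain F where "F facet_of K" "F facet_of K'" by blast
    then have "F \<subseteq> K" "F \<subseteq> K'" "F \<noteq> {}" by (simp_all add: facet_of_imp_subset) (simp add: facet_of_def)
    then show "K \<inter> K' \<noteq> {}" by blast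
  qed
  then have "dist (f x) (f y) \<le> real (length P) * B"
    using P f x by (intro chain_dist) (auto simp: elem_path_def)
  also have "\<dots> \<le> real N * B" using P f(2) by (intro mult_right_mono) (auto simp: elem_path_def)
  finally show ?thesis .
qed

section \<open>Local and global estimates\<close>

locale cut_mesh = simplicial_mesh \<T> k for \<T> :: "(real^'n) set set" and k :: nat +
  fixes \<Omega> :: "(real^'n) set" and h c \<mu> \<gamma> :: real and N m :: nat
    and S :: "(real^'n) set \<Rightarrow> (real^'n) set" and Ti :: "real^'n \<Rightarrow> (real^'n) set"
    and v :: "real^'n \<Rightarrow> real"
  assumes closed_Omega: "closed \<Omega>" and Omega_covered: "\<Omega> \<subseteq> \<Union>\<T>"
    and h_pos: "0 < h" and c_pos: "0 < c" and \<mu>_pos: "0 < \<mu>"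
    and element_dist: "T \<in> \<T> \<Longrightarrow> x \<in> T \<Longrightarrow> y \<in> T \<Longrightarrow> dist x y \<le> c * h"
    and element_volume: "T \<in> \<T> \<Longrightarrow> \<mu> * h ^ CARD('n) \<le> measure lebesgue T"
    and large_volume: "K \<in> large_elems \<gamma> \<T> \<Omega> \<Longrightarrow> \<mu> * h ^ CARD('n) \<le> measure lebesgue (K \<inter> \<Omega>)"
    and S_large: "T \<in> small_elems \<gamma> \<T> \<Omega> \<Longrightarrow> S T \<in> large_elems \<gamma> \<T> \<Omega>"
    and Ti_supp: "i \<in> small_indices k \<gamma> \<T> \<Omega> \<Longrightarrow>
       Ti i \<in> active_mesh \<T> \<Omega> \<and> Ti i \<subseteq> supp (fe_basis k \<T> \<Omega> i)"
    and A2: "assumption_A2 N \<gamma> \<T> \<Omega> S"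
    and A3: "assumption_A3 N k \<gamma> \<T> \<Omega> S"
    and v_space: "v \<in> active_space k \<T> \<Omega>"
begin

abbreviation "Act \<equiv> active_mesh \<T> \<Omega>"
abbreviation "Large \<equiv> large_elems \<gamma> \<T> \<Omega>"
abbreviation "Small \<equiv> small_elems \<gamma> \<T> \<Omega>"
abbreviation "IS \<equiv> small_indices k \<gamma> \<T> \<Omega>"

text \<open>Two paths of at most \<open>N\<close> elements, one diameter to reach the node inside
  \<open>T\<close>, and one for a large element that contains the node.\<close>

definition "R = (2 * real N + 2) * c"
definition "near T K \<longleftrightarrow> (\<forall>x\<in>T. \<forall>y\<in>K. dist x y \<le> R * h)"
definition "q T = poly_ext k T v"
text \<open>The stabilized quantity in evaluated form, see \<open>elem_dof_jump\<close>: the value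
  of \<open>v\<close> at the node minus that of the extension from \<open>S (Ti i)\<close>.\<close>

definition "dof i = v i - q (S (Ti i)) i"
definition "E K = integral (K \<inter> \<Omega>) (energy m v)"
definition "G T = (\<Sum>K | K \<in> Large \<and> near T K. E K)"
definition "D T = (\<Sum>i | i \<in> IS \<and> i \<in> T. (dof i)\<^sup>2)"
text \<open>The power h^(d-2m) as a quotient of natural powers, since the exponent is negative for d
  = 1 and m = 1.\<close>

definition "H = h ^ CARD('n) / h ^ (2 * m)"

lemma H_pos: "H > 0"
  using h_pos by (simp add: H_def)

lemma R_ge: "c \<le> R" "0 < R"
  using c_pos by (simp_all add: R_def distrib_right add_nonneg_pos)

lemma Act_mesh: "T \<in> Act \<Longrightarrow> T \<in> \<T>"
  by (simp add: active_mesh_def)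

lemma Large_Act: "K \<in> Large \<Longrightarrow> K \<in> Act"
  by (simp add: large_elems_def)

lemma Small_Act: "T \<in> Small \<Longrightarrow> T \<in> Act"
  by (simp add: small_elems_def)

lemma Large_mesh: "K \<in> Large \<Longrightarrow> K \<in> \<T>"
  using Large_Act Act_mesh by blast

lemma finite_Act: "finite Act" and finite_Large: "finite Large"
  using finite_mesh by (simp_all add: active_mesh_def large_elems_def)

lemma finite_IS: "finite IS"
proof -
  have "finite (node_set k \<T> \<Omega>)"
    using finite_Act finite_lagrange_nodes(1)[OF simplex[OF Act_mesh]] by (auto simp: node_set_def)
  then show ?thesis by (simp add: small_indices_def)
qed

lemma q: 
  assumes "T \<in> Act"
  shows "q T \<in> Pk k" "x \<in> T \<Longrightarrow> v x = q T x"
proof -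
  obtain p where p: "p \<in> Pk k" "\<forall>x\<in>T. v x = p x" using active_space_polynomial[OF v_space assms] by blast
  then have "q T = p" unfolding q_def using poly_ext_eq[OF Act_mesh[OF assms]] by blast
  then show "q T \<in> Pk k" "x \<in> T \<Longrightarrow> v x = q T x" using p by auto
qed

lemma IS_props:
  assumes "i \<in> IS"
  shows "i \<in> node_set k \<T> \<Omega>" "Ti i \<in> Small" "i \<in> Ti i" "i \<in> lagrange_nodes k (Ti i)"
proof -
  show i: "i \<in> node_set k \<T> \<Omega>" using assms by (simp add: small_indices_def)
  have "Ti i \<notin> Large" using assms Ti_supp[OF assms] by (auto simp: small_indices_def)
  then show "Ti i \<in> Small" using Ti_supp[OF assms] by (simp add: small_elems_def)
  show "i \<in> Ti i" using subset_supp_iff[OF _ i, of "Ti i"] Ti_supp[OF assms] by blast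
  then show "i \<in> lagrange_nodes k (Ti i)" using node_set_Int[of "Ti i" \<Omega>] Ti_supp[OF assms] i by blast
qed

lemma elem_dof_jump:
  assumes i: "i \<in> IS"
  shows "elem_dof k \<T> \<Omega> i (Ti i) (elem_jump k v (Ti i) (S (Ti i))) = dof i"
proof -
  note I = IS_props[OF i]
  have act: "Ti i \<in> Act" "S (Ti i) \<in> Act" using I(2) S_large Small_Act Large_Act by blast+
  have "elem_jump k v (Ti i) (S (Ti i)) = (\<lambda>x. q (Ti i) x - q (S (Ti i)) x)"
    by (simp add: elem_jump_def q_def)
  moreover have "\<dots> \<in> Pk k" using q(1) act by (intro Pk_diff) auto
  ultimately show ?thesis
    using elem_dof_eq[OF act(1) I(4)] q(2)[OF act(1) I(3)] by (simp add: dof_def)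
qed

lemma nodal_stab_eq:
  "nodal_stab k \<gamma> \<tau> \<T> \<Omega> S Ti h m v v = \<tau> * (H * (\<Sum>i\<in>IS. (dof i)\<^sup>2))"
proof -
  have "h powi (int CARD('n) - int (2 * m)) = H"
    unfolding H_def using h_pos by (subst power_int_diff) (simp_all only: power_int_of_nat, simp)
  then have "h powi (int CARD('n) - 2 * int m) = H" by simp
  then show ?thesis
    using elem_dof_jump by (simp add: nodal_stab_def sum_distrib_left power2_eq_square mult_ac)
qed

lemma E_eq: "K \<in> Act \<Longrightarrow> E K = integral (K \<inter> \<Omega>) (energy m (q K))"
  unfolding E_def using closed_Omega
  by (intro energy_element(2) Act_mesh q) auto

lemma E_nonneg: "K \<in> Act \<Longrightarrow> 0 \<le> E K"
  using energy_element(1)[OF Act_mesh _ q, where X = \<Omega> and m = m] closed_Omega energy_nonneg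
  unfolding E_def by (intro integral_nonneg) (auto simp: absolutely_integrable_on_def)

lemma E_le_G: "K \<in> Large \<Longrightarrow> near T K \<Longrightarrow> E K \<le> G T"
  unfolding G_def using finite_Large E_nonneg[OF Large_Act] by (intro member_le_sum) auto

lemma G_nonneg: "0 \<le> G T" and D_nonneg: "0 \<le> D T"
  unfolding G_def D_def using E_nonneg[OF Large_Act] by (auto intro: sum_nonneg)

lemma near_self: "T \<in> \<T> \<Longrightarrow> near T T"
proof -
  have "c * h \<le> R * h" using R_ge h_pos by (intro mult_right_mono) auto
  then show "T \<in> \<T> \<Longrightarrow> near T T" unfolding near_def using element_dist order_trans by blast
qed

lemma nearI:
  assumes "T \<in> \<T>" "j \<in> T" "\<And>y. y \<in> K \<Longrightarrow> dist j y \<le> 2 * (real N * (c * h)) + c * h"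
  shows "near T K"
  unfolding near_def
proof (intro ballI)
  fix x y assume "x \<in> T" "y \<in> K"
  then have "dist x j \<le> c * h" "dist j y \<le> 2 * (real N * (c * h)) + c * h"
    using assms element_dist by auto
  then show "dist x y \<le> R * h"
    using dist_triangle[of x y j] by (simp add: R_def algebra_simps)
qed

lemma thick_large: "K \<in> Large \<Longrightarrow> near T K \<Longrightarrow> j \<in> T \<Longrightarrow> thick R \<mu> h j (K \<inter> \<Omega>)"
  using large_volume[of K] h_pos closed_Omega element_lmeasurable(1)[OF Large_mesh, of K]
  by (auto simp: thick_def near_def intro: fmeasurable_Int_fmeasurable)

lemma thick_element: "T \<in> \<T> \<Longrightarrow> j \<in> T \<Longrightarrow> thick R \<mu> h j T"
  using element_volume[of T] h_pos element_lmeasurable(1)[of T] near_self[of T]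
  by (auto simp: thick_def near_def)

lemma path_dist:
  assumes P: "elem_path \<M> N T1 T2 P" "\<M> \<subseteq> \<T>" and x: "x \<in> T1" "K \<in> set P" "y \<in> K"
  shows "dist x y \<le> real N * (c * h)"
proof -
  have "set P \<subseteq> \<T>" using P by (auto simp: elem_path_def)
  then show ?thesis
    using element_dist h_pos c_pos by (intro elem_path_dist[OF P(1) _ _ x, of "\<lambda>x. x"]) auto
qed

lemma path_small_small:
  assumes i: "i \<in> node_set k \<T> \<Omega>" and T: "T1 \<in> Small" "T2 \<in> Small" "i \<in> T1" "i \<in> T2"
  shows "\<exists>P. elem_path Large N (S T1) (S T2) P"
proof -
  have "T1 \<subseteq> supp (fe_basis k \<T> \<Omega> i)" "T2 \<subseteq> supp (fe_basis k \<T> \<Omega> i)"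
    using subset_supp_iff[OF Small_Act i] T by blast+
  then show ?thesis
    using A3[unfolded assumption_A3_def, THEN bspec, OF i, THEN conjunct1, THEN bspec, OF T(1), THEN bspec, OF T(2)] by simp
qed

lemma path_large_small:
  assumes i: "i \<in> node_set k \<T> \<Omega>" and T: "T1 \<in> Large" "T2 \<in> Small" "i \<in> T1" "i \<in> T2"
  shows "\<exists>P. elem_path Large N T1 (S T2) P"
proof -
  have "T1 \<subseteq> supp (fe_basis k \<T> \<Omega> i)" "T2 \<subseteq> supp (fe_basis k \<T> \<Omega> i)"
    using subset_supp_iff[OF Small_Act i] subset_supp_iff[OF Large_Act i] T by blast+
  then show ?thesis
    using A3[unfolded assumption_A3_def, THEN bspec, OF i, THEN conjunct2, THEN bspec, OF T(1), THEN bspec, OF T(2)] by simp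
qed

lemma path_last: "elem_path \<M> N T1 T2 P \<Longrightarrow> T2 \<in> set P"
  by (auto simp: elem_path_def)

lemma node_in_large:
  assumes T: "T \<in> Act" and j: "j \<in> lagrange_nodes k T" "j \<notin> IS"
  shows "\<exists>K\<in>Large. j \<in> K"
proof -
  have jn: "j \<in> node_set k \<T> \<Omega>" using node_set_Int[OF T] j by blast
  then obtain K where "K \<in> Large" "K \<subseteq> supp (fe_basis k \<T> \<Omega> j)"
    using j(2) by (auto simp: small_indices_def)
  then show ?thesis using subset_supp_iff[OF Large_Act jn] by blast
qed

text \<open>The path of A2 may run through small elements, where nothing is known about
  \<open>v\<close>; here it yields distances.\<close>

lemma S_Ti_near:
  assumes T: "T \<in> \<T>" "j \<in> T" "j \<in> IS"
  shows "S (Ti j) \<in> Large" "near T (S (Ti j))" "y \<in> S (Ti j) \<Longrightarrow> dist j y \<le> real N * (c * h)"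
proof -
  note I = IS_props[OF T(3)]
  show "S (Ti j) \<in> Large" using S_large I(2) .
  obtain P where P: "elem_path Act N (Ti j) (S (Ti j)) P" using A2 I(2) unfolding assumption_A2_def by blast
  have dist: "dist j y \<le> real N * (c * h)" if "y \<in> S (Ti j)" for y
    using path_dist[OF P _ I(3) path_last[OF P] that] Act_mesh by blast
  then show "y \<in> S (Ti j) \<Longrightarrow> dist j y \<le> real N * (c * h)" .
  have "0 \<le> real N * (c * h)" "0 \<le> c * h" using c_pos h_pos by auto
  then have "dist j y \<le> 2 * (real N * (c * h)) + c * h" if "y \<in> S (Ti j)" for y
    using dist[OF that] by linarith
  then show "near T (S (Ti j))" by (rule nearI[OF T(1,2)])
qed

text \<open>One large element per node is enough: \<open>S (Ti j)\<close> for a stabilized node,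
  otherwise a large element that contains the node. The factors 2 come from squaring a sum of two
  terms.\<close>

lemma nodal_deviation_0:
  assumes m: "m = 0" and T: "T \<in> Small" and j: "j \<in> lagrange_nodes k T"
    and Co: "\<And>z x p A. thick R \<mu> h (z::real^'n) A \<Longrightarrow> p \<in> Pk k \<Longrightarrow> x \<in> cball z (R * h) \<Longrightarrow>
       (p x)\<^sup>2 \<le> Co / H * integral A (energy m p)" "0 \<le> Co"
  shows "(v j)\<^sup>2 \<le> 2 * (Co / H * G T) + 2 * (if j \<in> IS then (dof j)\<^sup>2 else 0)"
proof -
  have T': "T \<in> \<T>" "T \<in> Act" using T Small_Act Act_mesh by blast+
  have jT: "j \<in> T" using j node_set_Int[OF T'(2)] by blast
  have bound: "(q K j)\<^sup>2 \<le> Co / H * G T" if K: "K \<in> Large" "near T K" for K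
  proof -
    have "(q K j)\<^sup>2 \<le> Co / H * E K"
      using Co(1)[OF thick_large[OF K jT] q(1)[OF Large_Act[OF K(1)]], of j] R_ge h_pos
      by (simp add: E_eq[OF Large_Act[OF K(1)]])
    also have "\<dots> \<le> Co / H * G T" using E_le_G[OF K] Co(2) H_pos by (intro mult_left_mono) auto
    finally show ?thesis .
  qed
  have nn: "0 \<le> Co / H * G T" using Co(2) H_pos G_nonneg by simp
  show ?thesis
  proof (cases "j \<in> IS")
    case True
    have "v j = dof j + q (S (Ti j)) j" by (simp add: dof_def)
    then have "(v j)\<^sup>2 \<le> 2 * (dof j)\<^sup>2 + 2 * (q (S (Ti j)) j)\<^sup>2"
      using sum_squares_bound[of "dof j" "q (S (Ti j)) j"] by (simp add: power2_sum)
    then show ?thesis using bound[OF S_Ti_near(1,2)[OF T'(1) jT True]] True by simp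
  next
    case False
    then obtain K where K: "K \<in> Large" "j \<in> K" using node_in_large[OF T'(2) j] by blast
    have "0 \<le> real N * (c * h)" using c_pos h_pos by auto
    then have "dist j y \<le> 2 * (real N * (c * h)) + c * h" if "y \<in> K" for y
      using element_dist[OF Large_mesh[OF K(1)] K(2) that] by linarith
    then have "near T K" by (rule nearI[OF T'(1) jT])
    then have "(v j)\<^sup>2 \<le> Co / H * G T" using bound[OF K(1)] q(2)[OF Large_Act K(2)] K(1) by simp
    then show ?thesis using False nn by simp
  qed
qed

text \<open>The reference value \<open>v y0\<close> is the same for all nodes of \<open>T\<close>,
  so every large element from which a nodal value is obtained has to be joined to
  \<open>S T\<close>. Each element on the way costs one increment \<open>B\<close>.\<close>

lemma nodal_deviation_1:
  assumes T: "T \<in> Small" and j: "j \<in> lagrange_nodes k T" and y0: "y0 \<in> S T"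
    and Co: "\<And>z x y p A. thick R \<mu> h (z::real^'n) A \<Longrightarrow> p \<in> Pk k \<Longrightarrow> x \<in> cball z (R * h) \<Longrightarrow> y \<in> cball z (R * h) \<Longrightarrow>
       (p x - p y)\<^sup>2 \<le> Co / H * integral A (energy m p)" "0 \<le> Co"
  shows "(v j - v y0)\<^sup>2 \<le> 2 * (real N + 1)\<^sup>2 * (Co / H * G T) + 2 * (if j \<in> IS then (dof j)\<^sup>2 else 0)"
proof -
  have T': "T \<in> \<T>" "T \<in> Act" using T Small_Act Act_mesh by blast+
  have jT: "j \<in> T" "j \<in> node_set k \<T> \<Omega>" using j node_set_Int[OF T'(2)] by blast+
  define B where "B = sqrt (Co / H * G T)"
  have B2: "B\<^sup>2 = Co / H * G T" and "0 \<le> B" using Co(2) H_pos G_nonneg by (auto simp: B_def)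
  \<comment> \<open>The node \<open>j\<close> need not lie in \<open>K\<close>: there the extended
    polynomial is evaluated.\<close>
  have osc: "\<bar>q K x - q K y\<bar> \<le> B"
    if K: "K \<in> Large" "near T K" and xy: "x \<in> insert j K" "y \<in> K" for K x y
  proof -
    have "x \<in> cball j (R * h)" "y \<in> cball j (R * h)"
      using K(2) xy jT R_ge h_pos by (auto simp: near_def)
    then have "(q K x - q K y)\<^sup>2 \<le> Co / H * E K"
      using Co(1)[OF thick_large[OF K jT(1)] q(1)[OF Large_Act[OF K(1)]], of x y]
      by (simp add: E_eq[OF Large_Act[OF K(1)]])
    also have "\<dots> \<le> Co / H * G T" using E_le_G[OF K] Co(2) H_pos by (intro mult_left_mono) auto
    finally show ?thesis unfolding B_def by (rule real_le_rsqrt[of "\<bar>_\<bar>", simplified])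
  qed
  have path: "\<bar>v x - v y0\<bar> \<le> real N * B"
    if P: "elem_path Large N K (S T) P" and K: "x \<in> K" and near: "\<And>K'. K' \<in> set P \<Longrightarrow> near T K'" for P K x
  proof -
    have "dist (v x) (v y0) \<le> real N * B"
    proof (rule elem_path_dist[OF P _ \<open>0 \<le> B\<close> K path_last[OF P] y0])
      fix K' x y assume K': "K' \<in> set P" "x \<in> K'" "y \<in> K'"
      then have "K' \<in> Large" using P by (auto simp: elem_path_def)
      then show "dist (v x) (v y) \<le> B"
        using osc[OF _ near, of K' x y] K' q(2)[OF Large_Act] by (simp add: dist_real_def)
    qed
    then show ?thesis by (simp add: dist_real_def)
  qed
  have ch: "0 \<le> real N * (c * h)" "0 \<le> c * h" using c_pos h_pos by auto
  have sub: "Large \<subseteq> \<T>" using Large_mesh by blast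
  show ?thesis
  proof (cases "j \<in> IS")
    case True
    let ?K = "S (Ti j)"
    note K = S_Ti_near[OF T'(1) jT(1) True]
    obtain P where P: "elem_path Large N ?K (S T) P"
      using path_small_small[OF jT(2) IS_props(2)[OF True] T IS_props(3)[OF True] jT(1)] by blast
    \<comment> \<open>An intermediate point in \<open>S (Ti j)\<close>. The polynomial of that
      element leads from \<open>j\<close> to \<open>z\<close>, and the path of A3 leads on to
      \<open>y0\<close>.\<close>
    obtain z where z: "z \<in> ?K" using simplex_interior(3)[OF simplex[OF Large_mesh[OF K(1)]]] interior_subset by blast
    have "near T K'" if "K' \<in> set P" for K'
    proof (rule nearI[OF T'(1) jT(1)])
      fix y assume "y \<in> K'"
      then have "dist z y \<le> real N * (c * h)" using path_dist[OF P sub z that] by blast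
      then show "dist j y \<le> 2 * (real N * (c * h)) + c * h"
        using K(3)[OF z] dist_triangle[of j y z] ch by linarith
    qed
    then have "\<bar>v z - v y0\<bar> \<le> real N * B" by (rule path[OF P z])
    moreover have "\<bar>q ?K j - v z\<bar> \<le> B" using osc[OF K(1,2) _ z, of j] q(2)[OF Large_Act[OF K(1)] z] by simp
    moreover have "v j - v y0 = dof j + (q ?K j - v z) + (v z - v y0)" by (simp add: dof_def)
    ultimately have "\<bar>v j - v y0\<bar> \<le> \<bar>dof j\<bar> + (real N + 1) * B" by (simp add: distrib_right)
    then have "(v j - v y0)\<^sup>2 \<le> (\<bar>dof j\<bar> + (real N + 1) * B)\<^sup>2" by (metis abs_ge_zero power2_abs power_mono)
    also have "\<dots> \<le> 2 * (dof j)\<^sup>2 + 2 * ((real N + 1) * B)\<^sup>2"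
      using sum_squares_bound[of "\<bar>dof j\<bar>" "(real N + 1) * B"] by (simp add: power2_sum)
    finally show ?thesis using True by (simp add: power_mult_distrib B2)
  next
    case False
    then obtain K where K: "K \<in> Large" "j \<in> K" using node_in_large[OF T'(2) j] by blast
    then obtain P where P: "elem_path Large N K (S T) P"
      using path_large_small[OF jT(2) K(1) T K(2) jT(1)] by blast
    have "near T K'" if "K' \<in> set P" for K'
    proof (rule nearI[OF T'(1) jT(1)])
      fix y assume "y \<in> K'"
      then show "dist j y \<le> 2 * (real N * (c * h)) + c * h"
        using path_dist[OF P sub K(2) that, of y] ch by linarith
    qed
    then have "\<bar>v j - v y0\<bar> \<le> real N * B" by (rule path[OF P K(2)])
    then have "(v j - v y0)\<^sup>2 \<le> (real N * B)\<^sup>2" by (metis abs_ge_zero power2_abs power_mono)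
    \<comment> \<open>Weakened to the constant of the stabilized case.\<close>
    also have "\<dots> \<le> 2 * ((real N + 1) * B)\<^sup>2"
    proof -
      have "(real N * B)\<^sup>2 \<le> ((real N + 1) * B)\<^sup>2" using \<open>0 \<le> B\<close> by (intro power_mono mult_right_mono) auto
      then show ?thesis using zero_le_power2[of "(real N + 1) * B"] by linarith
    qed
    finally show ?thesis using False by (simp add: power_mult_distrib B2)
  qed
qed

section \<open>The estimate on one element\<close>

lemma integral_energy_le:
  assumes T: "T \<in> \<T>" and p: "p \<in> Pk k" and B: "\<And>x. x \<in> T \<Longrightarrow> energy m p x \<le> B"
  shows "integral T (energy m p) \<le> unit_ball_vol (real CARD('n)) * c ^ CARD('n) * h ^ CARD('n) * B"
proof -
  note M = element_lmeasurable[OF T]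
  obtain x where x: "x \<in> T" using simplex_interior(3)[OF simplex[OF T]] interior_subset by blast
  have "0 \<le> B" using B[OF x] energy_nonneg order_trans by blast
  have "integral T (energy m p) \<le> integral T (\<lambda>_. B)"
    using energy_integrable[OF p M] B M
    by (intro integral_le integrable_on_const) (auto simp: absolutely_integrable_on_def)
  also have "\<dots> = B * measure lebesgue T"
    using lmeasure_integral[OF M(1)] integral_mult_right[of T B "\<lambda>_. 1"] by simp
  also have "\<dots> \<le> B * measure lebesgue (cball x (c * h))"
    using M element_dist[OF T x] \<open>0 \<le> B\<close>
    by (intro mult_left_mono measure_mono_fmeasurable lmeasurable_cball) (auto simp: fmeasurable_def)
  also have "\<dots> = B * (unit_ball_vol (real CARD('n)) * (c * h) ^ CARD('n))"
    using content_cball[of "c * h" x] c_pos h_pos by simp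
  finally show ?thesis by (simp add: power_mult_distrib mult_ac)
qed

text \<open>The constants of the polynomial estimates enter as hypotheses, because they have to be
  chosen before \<open>h\<close>, the domain and \<open>v\<close>, all of which are fixed in the
  locale. In \<open>C\<close>, the summand \<open>V * Ce\<close> covers large elements; the other
  one multiplies the inverse inequality, the nodal bound and the deviation of the nodal
  values.\<close>

lemma element_estimate:
  assumes m: "m \<in> {0, 1}" and T: "T \<in> Act"
    and Ce: "\<And>z x p A. thick R \<mu> h (z::real^'n) A \<Longrightarrow> p \<in> Pk k \<Longrightarrow> x \<in> cball z (R * h) \<Longrightarrow>
       energy m p x \<le> Ce / h ^ CARD('n) * integral A (energy m p)" "0 \<le> Ce"
    and Co: "\<And>z x y p A. thick R \<mu> h (z::real^'n) A \<Longrightarrow> p \<in> Pk k \<Longrightarrow> x \<in> cball z (R * h) \<Longrightarrow> y \<in> cball z (R * h) \<Longrightarrow>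
       (p x - p y)\<^sup>2 \<le> Co * h\<^sup>2 / h ^ CARD('n) * integral A (energy 1 p)" "0 \<le> Co"
    and Ci: "\<And>z x p A M. thick R \<mu> h (z::real^'n) A \<Longrightarrow> p \<in> Pk k \<Longrightarrow> x \<in> cball z (R * h) \<Longrightarrow> \<forall>y\<in>A. \<bar>p y\<bar> \<le> M \<Longrightarrow>
       norm (grad p x) \<le> Ci * M / h" "0 \<le> Ci"
    and V: "V = unit_ball_vol (real CARD('n)) * c ^ CARD('n)"
    and Cn: "Cn = real (Suc k ^ Suc CARD('n)) * real k ^ k"
    and C: "C = V * Ce + V * (1 + Ci\<^sup>2) * Cn\<^sup>2 * (2 * (real N + 1)\<^sup>2 * (Ce + Co) + 2)"
  shows "integral T (energy m v) \<le> C * (G T + H * D T)"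
proof -
  have T': "T \<in> \<T>" using T Act_mesh by blast
  have Vn: "0 \<le> V" using c_pos by (simp add: V)
  have vq: "integral T (energy m v) = integral T (energy m (q T))"
    using energy_element(2)[OF T' _ q(1)[OF T] q(2)[OF T], where X = UNIV] by simp
  have nn: "0 \<le> G T" "0 \<le> H * D T" using G_nonneg D_nonneg H_pos by simp_all
  show ?thesis
  proof (cases "T \<in> Large")
    case True
    have "energy m (q T) x \<le> Ce / h ^ CARD('n) * G T" if x: "x \<in> T" for x
    proof -
      have "energy m (q T) x \<le> Ce / h ^ CARD('n) * E T"
        using Ce(1)[OF thick_large[OF True near_self[OF T'] x] q(1)[OF T], of x] R_ge h_pos by (simp add: E_eq[OF T])
      also have "\<dots> \<le> Ce / h ^ CARD('n) * G T"
        using E_le_G[OF True near_self[OF T']] Ce(2) h_pos by (intro mult_left_mono) auto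
      finally show ?thesis .
    qed
    from integral_energy_le[OF T' q(1)[OF T] this]
    have "integral T (energy m v) \<le> V * Ce * G T" using h_pos by (simp add: vq V field_simps)
    also have "\<dots> \<le> C * G T" using Vn Ce(2) Co(2) nn by (intro mult_right_mono) (auto simp: C)
    also have "\<dots> \<le> C * (G T + H * D T)"
      using Vn Ce(2) Co(2) nn by (intro mult_left_mono) (auto simp: C)
    finally show ?thesis .
  next
    case False
    then have small: "T \<in> Small" using T by (simp add: small_elems_def)
    \<comment> \<open>One bound for the squared nodal deviations in both cases: \<open>Ce\<close>
      serves m = 0 and \<open>Co\<close> serves m = 1.\<close>
    define W where "W = 2 * (real N + 1)\<^sup>2 * ((Ce + Co) / H * G T) + 2 * D T"
    have "0 \<le> W" unfolding W_def using Ce(2) Co(2) H_pos G_nonneg D_nonneg by simp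
    have D: "(if j \<in> IS then (dof j)\<^sup>2 else 0) \<le> D T" if "j \<in> T" for j
      unfolding D_def using that finite_IS
      by (auto intro: sum_nonneg member_le_sum[where f = "\<lambda>i. (dof i)\<^sup>2"])
    have nodes_T: "lagrange_nodes k T \<subseteq> T" using node_set_Int[OF T] by blast
    \<comment> \<open>The constant to be subtracted: 0 for m = 0, and \<open>v y0\<close> with
      \<open>y0\<close> in \<open>S T\<close> for m = 1.\<close>
    have "\<exists>a. (m = 0 \<longrightarrow> a = 0) \<and> (\<forall>j\<in>lagrange_nodes k T. (v j - a)\<^sup>2 \<le> W)"
    proof (cases "m = 0")
      case True
      have Ce': "(p x)\<^sup>2 \<le> Ce / H * integral A (energy m p)"
        if "thick R \<mu> h (z::real^'n) A" "p \<in> Pk k" "x \<in> cball z (R * h)" for z x p A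
        using Ce(1)[OF that] True unfolding H_def by (simp add: energy_def)
      have "(v j - 0)\<^sup>2 \<le> W" if j: "j \<in> lagrange_nodes k T" for j
      proof -
        have "(v j)\<^sup>2 \<le> 2 * (Ce / H * G T) + 2 * (if j \<in> IS then (dof j)\<^sup>2 else 0)"
          by (rule nodal_deviation_0[OF True small j Ce' Ce(2)])
        also have "\<dots> \<le> W"
        proof -
          have "Ce / H * G T \<le> (Ce + Co) / H * G T"
            using Co(2) H_pos nn by (intro mult_right_mono divide_right_mono) auto
          also have "\<dots> \<le> (real N + 1)\<^sup>2 * ((Ce + Co) / H * G T)"
          proof -
            have "1 \<le> (real N + 1)\<^sup>2" "0 \<le> (Ce + Co) / H * G T"
              using Ce(2) Co(2) H_pos nn by (simp_all add: one_le_power)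
            from mult_right_mono[OF this] show ?thesis by simp
          qed
          finally show ?thesis unfolding W_def using D[of j] j nodes_T by auto
        qed
        finally show ?thesis by simp
      qed
      then show ?thesis by blast
    next
      case False
      then have m1: "m = 1" using m by simp
      have Co': "(p x - p y)\<^sup>2 \<le> Co / H * integral A (energy m p)"
        if "thick R \<mu> h (z::real^'n) A" "p \<in> Pk k" "x \<in> cball z (R * h)" "y \<in> cball z (R * h)" for z x y p A
        using Co(1)[OF that] m1 unfolding H_def by simp
      have "S T \<in> \<T>" using S_large[OF small] Large_mesh by blast
      then obtain y0 where y0: "y0 \<in> S T" using simplex_interior(3)[OF simplex] interior_subset by blast
      have "(v j - v y0)\<^sup>2 \<le> W" if j: "j \<in> lagrange_nodes k T" for j
      proof -
        have "(v j - v y0)\<^sup>2 \<le> 2 * (real N + 1)\<^sup>2 * (Co / H * G T) + 2 * (if j \<in> IS then (dof j)\<^sup>2 else 0)"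
          by (rule nodal_deviation_1[OF small j y0 Co' Co(2)])
        also have "\<dots> \<le> W" unfolding W_def using D[of j] j nodes_T Ce(2) H_pos nn
          by (intro add_mono mult_left_mono mult_right_mono divide_right_mono) auto
        finally show ?thesis .
      qed
      then show ?thesis using False by blast
    qed
    then obtain a where a: "m = 0 \<Longrightarrow> a = 0" "\<And>j. j \<in> lagrange_nodes k T \<Longrightarrow> (v j - a)\<^sup>2 \<le> W" by blast
    define p where "p x = q T x - a" for x
    have p: "p \<in> Pk k" unfolding p_def[abs_def] using q(1)[OF T] by (intro Pk_diff Pk_const)
    have p_bound: "\<bar>p x\<bar> \<le> Cn * sqrt W" if "x \<in> T" for x
      unfolding Cn
    proof (rule nodal_bound[OF T' that p])
      fix j assume j: "j \<in> lagrange_nodes k T"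
      then have "(p j)\<^sup>2 \<le> W" using a(2)[OF j] q(2)[OF T, of j] nodes_T by (auto simp: p_def)
      then show "\<bar>p j\<bar> \<le> sqrt W" by (intro real_le_rsqrt) simp
    qed
    \<comment> \<open>For m = 0 the polynomials \<open>p\<close> and \<open>q T\<close> are equal,
      for m = 1 they have the same gradient. The factor \<open>1 + Ci\<^sup>2\<close> covers both
      cases.\<close>
    have "energy m (q T) x \<le> (1 + Ci\<^sup>2) * Cn\<^sup>2 * W / h ^ (2 * m)" if x: "x \<in> T" for x
    proof (cases "m = 0")
      case True
      then have "energy m (q T) x = \<bar>p x\<bar>\<^sup>2" using a(1) by (simp add: energy_def p_def)
      also have "\<dots> \<le> (Cn * sqrt W)\<^sup>2" using p_bound[OF x] by (intro power_mono) auto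
      also have "\<dots> = Cn\<^sup>2 * W" using \<open>0 \<le> W\<close> by (simp add: power_mult_distrib)
      also have "\<dots> \<le> (1 + Ci\<^sup>2) * (Cn\<^sup>2 * W)" using \<open>0 \<le> W\<close> by (simp add: distrib_right)
      finally show ?thesis using True by (simp add: mult_ac)
    next
      case False
      then have m1: "m = 1" using m by simp
      have "(q T has_derivative (\<lambda>w. grad p x \<bullet> w)) (at x)"
        using has_derivative_add[OF Pk_has_derivative[OF p, of x] has_derivative_const[of a]] by (simp add: p_def)
      then have "energy m (q T) x = (norm (grad p x))\<^sup>2" using m1 by (simp add: energy_def grad_eqI)
      also have "\<dots> \<le> (Ci * (Cn * sqrt W) / h)\<^sup>2"
        using Ci(1)[OF thick_element[OF T' x] p, of x] p_bound R_ge h_pos by (intro power_mono) auto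
      also have "\<dots> = Ci\<^sup>2 * Cn\<^sup>2 * W / h\<^sup>2" using \<open>0 \<le> W\<close> by (simp add: power_mult_distrib power_divide)
      also have "\<dots> \<le> (1 + Ci\<^sup>2) * Cn\<^sup>2 * W / h\<^sup>2"
        using \<open>0 \<le> W\<close> by (intro divide_right_mono mult_right_mono) auto
      finally show ?thesis using m1 by simp
    qed
    from integral_energy_le[OF T' q(1)[OF T] this]
    have "integral T (energy m v) \<le> V * (1 + Ci\<^sup>2) * Cn\<^sup>2 * (H * W)" by (simp add: vq V H_def mult_ac)
    also have "H * W = 2 * (real N + 1)\<^sup>2 * (Ce + Co) * G T + 2 * (H * D T)"
      using H_pos unfolding W_def by (simp add: field_simps)
    also have "\<dots> \<le> (2 * (real N + 1)\<^sup>2 * (Ce + Co) + 2) * (G T + H * D T)"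
      using nn Ce(2) Co(2) by (simp add: distrib_right distrib_left)
    also have "V * (1 + Ci\<^sup>2) * Cn\<^sup>2 * \<dots> \<le> C * (G T + H * D T)"
      unfolding C mult.assoc[symmetric] using nn Vn Ce(2) by (intro mult_right_mono) auto
    finally show ?thesis using Vn by (simp add: mult_left_mono)
  qed
qed

section \<open>Summation over the elements\<close>

text \<open>After exchanging the sums, each \<open>f i\<close> is counted once for every element
  related to \<open>i\<close>. These elements lie in one ball, so volume packing bounds their number
  independently of \<open>h\<close>. The relation is nearness to a large element in one application
  and containing a node in the other.\<close>

lemma overlap_sum:
  assumes fin: "finite J" and f: "\<And>i. i \<in> J \<Longrightarrow> 0 \<le> f i"
    and P: "\<And>i. i \<in> J \<Longrightarrow> \<exists>y. \<forall>T\<in>Act. P T i \<longrightarrow> T \<subseteq> cball y (R * h)"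
  shows "(\<Sum>T\<in>Act. \<Sum>i | i \<in> J \<and> P T i. f i) \<le> unit_ball_vol (real CARD('n)) * R ^ CARD('n) / \<mu> * (\<Sum>i\<in>J. f i)"
proof -
  have "(\<Sum>T\<in>Act. \<Sum>i | i \<in> J \<and> P T i. f i) = (\<Sum>T\<in>Act. \<Sum>i\<in>J. if P T i then f i else 0)"
    using fin by (simp add: sum.inter_filter)
  also have "\<dots> = (\<Sum>i\<in>J. \<Sum>T\<in>Act. if P T i then f i else 0)" by (rule sum.swap)
  also have "\<dots> = (\<Sum>i\<in>J. real (card {T\<in>Act. P T i}) * f i)"
    using finite_Act by (simp add: sum.inter_filter[symmetric])
  also have "\<dots> \<le> (\<Sum>i\<in>J. unit_ball_vol (real CARD('n)) * R ^ CARD('n) / \<mu> * f i)"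
  proof (intro sum_mono mult_right_mono f)
    fix i assume "i \<in> J"
    then obtain y where y: "\<And>T. T \<in> Act \<Longrightarrow> P T i \<Longrightarrow> T \<subseteq> cball y (R * h)" using P by blast
    have "real (card {T\<in>Act. P T i}) * (\<mu> * h ^ CARD('n)) \<le> unit_ball_vol (real CARD('n)) * (R * h) ^ CARD('n)"
      using y Act_mesh element_volume R_ge h_pos by (intro card_elements_in_ball) auto
    then have "(real (card {T\<in>Act. P T i}) * \<mu>) * h ^ CARD('n) \<le> (unit_ball_vol (real CARD('n)) * R ^ CARD('n)) * h ^ CARD('n)"
      by (simp add: power_mult_distrib mult_ac)
    then have "real (card {T\<in>Act. P T i}) * \<mu> \<le> unit_ball_vol (real CARD('n)) * R ^ CARD('n)"
      using h_pos by (simp only: mult_le_cancel_right_pos zero_less_power)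
    then show "real (card {T\<in>Act. P T i}) \<le> unit_ball_vol (real CARD('n)) * R ^ CARD('n) / \<mu>"
      using \<mu>_pos by (simp add: pos_le_divide_eq)
  qed
  finally show ?thesis by (simp add: sum_distrib_left)
qed

lemma global_estimate:
  assumes C: "\<And>T. T \<in> Act \<Longrightarrow> integral T (energy m v) \<le> C * (G T + H * D T)" "0 \<le> C"
  shows "(nabla_norm m (active_domain \<T> \<Omega>) v)\<^sup>2 \<le> C * (unit_ball_vol (real CARD('n)) * R ^ CARD('n) / \<mu>) *
     ((nabla_norm m \<Omega> v)\<^sup>2 + H * (\<Sum>i\<in>IS. (dof i)\<^sup>2))"
proof -
  define M where "M = unit_ball_vol (real CARD('n)) * R ^ CARD('n) / \<mu>"
  have "0 \<le> M" unfolding M_def using R_ge \<mu>_pos by simp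
  have dom: "active_domain \<T> \<Omega> \<in> sets lebesgue"
    unfolding active_domain_def using finite_Act element_lmeasurable(1)[OF Act_mesh]
    by (intro sets.finite_Union) (auto simp: fmeasurable_def)
  have Om: "\<Omega> \<in> sets lebesgue" "\<Omega> \<subseteq> active_domain \<T> \<Omega>"
    using closed_Omega Omega_covered by (auto simp: active_domain_def active_mesh_def)
  have "(\<Sum>K\<in>Large. E K) \<le> (\<Sum>K\<in>Act. E K)"
    using finite_Act Large_Act E_nonneg by (intro sum_mono2) auto
  also have "\<dots> = (nabla_norm m \<Omega> v)\<^sup>2" using energy_sum[OF v_space Om] by (simp add: E_def)
  finally have EL: "(\<Sum>K\<in>Large. E K) \<le> (nabla_norm m \<Omega> v)\<^sup>2" .
  have "(nabla_norm m (active_domain \<T> \<Omega>) v)\<^sup>2 = (\<Sum>T\<in>Act. integral (T \<inter> active_domain \<T> \<Omega>) (energy m v))"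
    by (rule energy_sum[OF v_space dom]) simp
  also have "\<dots> = (\<Sum>T\<in>Act. integral T (energy m v))"
    by (intro sum.cong refl arg_cong2[where f = integral]) (auto simp: active_domain_def)
  also have "\<dots> \<le> (\<Sum>T\<in>Act. C * (G T + H * D T))" by (intro sum_mono C)
  also have "\<dots> = C * ((\<Sum>T\<in>Act. G T) + H * (\<Sum>T\<in>Act. D T))"
    by (simp add: sum_distrib_left sum.distrib distrib_left)
  also have "\<dots> \<le> C * (M * (nabla_norm m \<Omega> v)\<^sup>2 + H * (M * (\<Sum>i\<in>IS. (dof i)\<^sup>2)))"
  proof (intro mult_left_mono add_mono C(2))
    have "(\<Sum>T\<in>Act. G T) \<le> M * (\<Sum>K\<in>Large. E K)"
      unfolding G_def M_def
    proof (rule overlap_sum[OF finite_Large E_nonneg[OF Large_Act]])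
      fix K assume "K \<in> Large"
      then obtain y where "y \<in> K" using simplex_interior(3)[OF simplex[OF Large_mesh]] interior_subset by blast
      then show "\<exists>y. \<forall>T\<in>Act. near T K \<longrightarrow> T \<subseteq> cball y (R * h)"
        by (intro exI[of _ y]) (auto simp: near_def dist_commute)
    qed
    also have "\<dots> \<le> M * (nabla_norm m \<Omega> v)\<^sup>2" using EL \<open>0 \<le> M\<close> by (rule mult_left_mono)
    finally show "(\<Sum>T\<in>Act. G T) \<le> M * (nabla_norm m \<Omega> v)\<^sup>2" .
    show "(\<Sum>T\<in>Act. D T) \<le> M * (\<Sum>i\<in>IS. (dof i)\<^sup>2)"
      unfolding D_def M_def
    proof (rule overlap_sum[OF finite_IS])
      fix i
      show "\<exists>y. \<forall>T\<in>Act. i \<in> T \<longrightarrow> T \<subseteq> cball y (R * h)"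
        using near_self[OF Act_mesh] by (intro exI[of _ i]) (auto simp: near_def)
    qed simp
  qed (use H_pos in simp)
  also have "\<dots> = C * M * ((nabla_norm m \<Omega> v)\<^sup>2 + H * (\<Sum>i\<in>IS. (dof i)\<^sup>2))" by (simp add: algebra_simps)
  finally show ?thesis by (simp add: M_def)
qed

end

section \<open>Choice of the constants\<close>

theorem lemma3p5:
  fixes \<Omega>0 :: "(real^'n) set" and \<T>0 :: "real \<Rightarrow> (real^'n) set set"
    and h0 \<gamma> \<tau> :: real and k N m :: nat
  assumes "closed_domain \<Omega>0"
    and "0 < h0" and "quasiuniform_family h0 \<Omega>0 \<T>0"
    and "1 \<le> k" and "0 < \<gamma>" and "\<gamma> \<le> 1" and "0 < \<tau>" and "m \<in> {0, 1}"
  shows "\<exists>C>0. \<forall>\<Omega> h S Ti.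
    closed_domain \<Omega> \<and> \<Omega> \<subseteq> \<Omega>0 \<and> 0 < h \<and> h \<le> h0 \<and>
    (\<forall>T\<in>small_elems \<gamma> (\<T>0 h) \<Omega>. S T \<in> large_elems \<gamma> (\<T>0 h) \<Omega>) \<and>
    (\<forall>i\<in>small_indices k \<gamma> (\<T>0 h) \<Omega>.
       Ti i \<in> active_mesh (\<T>0 h) \<Omega> \<and> Ti i \<subseteq> supp (fe_basis k (\<T>0 h) \<Omega> i)) \<and>
    assumption_A2 N \<gamma> (\<T>0 h) \<Omega> S \<and>
    assumption_A3 N k \<gamma> (\<T>0 h) \<Omega> S \<longrightarrow>
    (\<forall>v\<in>active_space k (\<T>0 h) \<Omega>.
       (nabla_norm m (active_domain (\<T>0 h) \<Omega>) v)\<^sup>2 \<le>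
       C * ((nabla_norm m \<Omega> v)\<^sup>2 + nodal_stab k \<gamma> \<tau> (\<T>0 h) \<Omega> S Ti h m v v))"
proof -
  obtain c1 c2 \<sigma> where c: "c1 > 0" "c2 > 0" "\<sigma> > 0"
    and mesh: "\<And>h. 0 < h \<Longrightarrow> h \<le> h0 \<Longrightarrow> triangulation (\<T>0 h)"
      "\<And>h T. 0 < h \<Longrightarrow> h \<le> h0 \<Longrightarrow> T \<in> \<T>0 h \<Longrightarrow> int CARD('n) simplex T"
      "\<And>h. 0 < h \<Longrightarrow> h \<le> h0 \<Longrightarrow> \<Union>(\<T>0 h) = \<Omega>0"
    and shape: "\<And>h T. 0 < h \<Longrightarrow> h \<le> h0 \<Longrightarrow> T \<in> \<T>0 h \<Longrightarrow>
      c1 * h \<le> diameter T \<and> diameter T \<le> c2 * h \<and> (\<exists>x. cball x (\<sigma> * diameter T) \<subseteq> T)"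
    using assms(3) unfolding quasiuniform_family_def by auto
  define V1 where "V1 = unit_ball_vol (real CARD('n))"
  \<comment> \<open>The volume of an inscribed ball of radius \<open>\<sigma> * c1 * h\<close>,
    without its power of \<open>h\<close>, times \<gamma>. It bounds from below both the cut part of
    a large element and, since \<gamma> is at most 1, every whole element.\<close>
  define \<mu> where "\<mu> = \<gamma> * (V1 * (\<sigma> * c1) ^ CARD('n))"
  \<comment> \<open>The number \<open>R\<close> of the locale, written out because the polynomial
    constants are fixed before the locale is interpreted.\<close>
  define \<rho> where "\<rho> = (2 * real N + 2) * c2"
  have "V1 > 0" by (simp add: V1_def)
  then have pos: "0 < \<mu>" "0 < \<rho>" using c assms(5) by (simp_all add: \<mu>_def \<rho>_def add_nonneg_pos)
  obtain Ce where Ce: "Ce > 0" "\<And>h z x p A. thick \<rho> \<mu> h (z::real^'n) A \<Longrightarrow> p \<in> Pk k \<Longrightarrow> x \<in> cball z (\<rho> * h) \<Longrightarrow>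
       energy m p x \<le> Ce / h ^ CARD('n) * integral A (energy m p)"
    using energy_bound[OF pos(2,1), of k m, where ?'n = 'n] by auto
  obtain Co where Co: "Co > 0" "\<And>h z x y p A. thick \<rho> \<mu> h (z::real^'n) A \<Longrightarrow> p \<in> Pk k \<Longrightarrow> x \<in> cball z (\<rho> * h) \<Longrightarrow> y \<in> cball z (\<rho> * h) \<Longrightarrow>
       (p x - p y)\<^sup>2 \<le> Co * h\<^sup>2 / h ^ CARD('n) * integral A (energy 1 p)"
    using increment_bound[OF pos(2,1), of k, where ?'n = 'n] by auto
  obtain Ci where Ci: "Ci > 0" "\<And>h z x p A M. thick \<rho> \<mu> h (z::real^'n) A \<Longrightarrow> p \<in> Pk k \<Longrightarrow> x \<in> cball z (\<rho> * h) \<Longrightarrow>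
       \<forall>y\<in>A. \<bar>p y\<bar> \<le> M \<Longrightarrow> norm (grad p x) \<le> Ci * M / h"
    using inverse_inequality[OF pos(2,1), of k, where ?'n = 'n] by auto
  define V where "V = V1 * c2 ^ CARD('n)"
  define Cn where "Cn = real (Suc k ^ Suc CARD('n)) * real k ^ k"
  define C1 where "C1 = V * Ce + V * (1 + Ci\<^sup>2) * Cn\<^sup>2 * (2 * (real N + 1)\<^sup>2 * (Ce + Co) + 2)"
  define C2 where "C2 = C1 * (V1 * \<rho> ^ CARD('n) / \<mu>)"
  have "0 < V" using \<open>V1 > 0\<close> c by (simp add: V_def)
  then have "0 < C1" unfolding C1_def using Ce(1) Co(1) by (intro add_pos_nonneg mult_nonneg_nonneg) auto
  then have "0 < C2" unfolding C2_def using \<open>V1 > 0\<close> pos by simp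
  \<comment> \<open>The form carries the weight \<tau>, so passing from the squared degrees of
    freedom to it costs a division by \<tau>.\<close>
  define C where "C = C2 * (1 + 1 / \<tau>)"
  show ?thesis
  proof (intro exI[of _ C] conjI allI impI ballI)
    show "0 < C" using \<open>0 < C2\<close> assms(7) by (simp add: C_def add_pos_pos)
    fix \<Omega> h S Ti v
    assume A: "closed_domain \<Omega> \<and> \<Omega> \<subseteq> \<Omega>0 \<and> 0 < h \<and> h \<le> h0 \<and>
      (\<forall>T\<in>small_elems \<gamma> (\<T>0 h) \<Omega>. S T \<in> large_elems \<gamma> (\<T>0 h) \<Omega>) \<and>
      (\<forall>i\<in>small_indices k \<gamma> (\<T>0 h) \<Omega>.
         Ti i \<in> active_mesh (\<T>0 h) \<Omega> \<and> Ti i \<subseteq> supp (fe_basis k (\<T>0 h) \<Omega> i)) \<and>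
      assumption_A2 N \<gamma> (\<T>0 h) \<Omega> S \<and> assumption_A3 N k \<gamma> (\<T>0 h) \<Omega> S"
      and v: "v \<in> active_space k (\<T>0 h) \<Omega>"
    then have h: "0 < h" "h \<le> h0" by blast+
    have volume: "V1 * (\<sigma> * c1) ^ CARD('n) * h ^ CARD('n) \<le> measure lebesgue T" if T: "T \<in> \<T>0 h" for T
    proof -
      obtain x where x: "cball x (\<sigma> * diameter T) \<subseteq> T" using shape[OF h T] by blast
      have "\<sigma> * (c1 * h) \<le> \<sigma> * diameter T" using shape[OF h T] c by (intro mult_left_mono) auto
      then have "cball x (\<sigma> * (c1 * h)) \<subseteq> T" using x subset_cball by (metis order_trans)
      then have "measure lebesgue (cball x (\<sigma> * (c1 * h))) \<le> measure lebesgue T"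
        using simplex_interior(2)[OF mesh(2)[OF h T]] by (intro measure_mono_fmeasurable) (auto simp: lmeasurable_compact)
      then show ?thesis
        using content_cball[of "\<sigma> * (c1 * h)" x] c h by (simp add: V1_def power_mult_distrib mult_ac)
    qed
    interpret cut_mesh "\<T>0 h" k \<Omega> h c2 \<mu> \<gamma> N m S Ti v
    proof
      show "closed \<Omega>" using A by (auto simp: closed_domain_def)
      show "\<Omega> \<subseteq> \<Union>(\<T>0 h)" using A mesh(3)[OF h] by blast
      show "dist x y \<le> c2 * h" if "T \<in> \<T>0 h" "x \<in> T" "y \<in> T" for T x y
        using diameter_bounded_bound[OF compact_imp_bounded[OF simplex_interior(2)[OF mesh(2)[OF h that(1)]]] that(2,3)]
          shape[OF h that(1)] by linarith
      show "\<mu> * h ^ CARD('n) \<le> measure lebesgue T" if "T \<in> \<T>0 h" for T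
      proof -
        have "0 \<le> V1 * (\<sigma> * c1) ^ CARD('n) * h ^ CARD('n)" using \<open>V1 > 0\<close> c h by simp
        from mult_right_mono[OF assms(6) this] show ?thesis
          using volume[OF that] by (simp add: \<mu>_def mult_ac)
      qed
      show "\<mu> * h ^ CARD('n) \<le> measure lebesgue (K \<inter> \<Omega>)" if "K \<in> large_elems \<gamma> (\<T>0 h) \<Omega>" for K
      proof -
        have K: "K \<in> \<T>0 h" "\<gamma> * measure lebesgue K \<le> measure lebesgue (K \<inter> \<Omega>)"
          using that by (auto simp: large_elems_def active_mesh_def)
        have "\<gamma> * (V1 * (\<sigma> * c1) ^ CARD('n) * h ^ CARD('n)) \<le> \<gamma> * measure lebesgue K"
          using assms(5) by (intro mult_left_mono volume K) simp
        with K(2) show ?thesis by (simp add: \<mu>_def mult_ac)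
      qed
    qed (use A v mesh[OF h] h c pos assms(4) in auto)
    have \<rho>: "R = \<rho>" by (simp add: R_def \<rho>_def)
    have "integral T (energy m v) \<le> C1 * (G T + H * D T)" if "T \<in> active_mesh (\<T>0 h) \<Omega>" for T
    proof (rule element_estimate[OF assms(8) that, where Ce = Ce and Co = Co and Ci = Ci and Cn = Cn and V = V])
      show "V = unit_ball_vol (real CARD('n)) * c2 ^ CARD('n)" by (simp add: V_def V1_def)
    qed (use Ce Co Ci in \<open>simp_all add: \<rho> Cn_def C1_def\<close>)
    then have "(nabla_norm m (active_domain (\<T>0 h) \<Omega>) v)\<^sup>2 \<le> C2 *
       ((nabla_norm m \<Omega> v)\<^sup>2 + H * (\<Sum>i\<in>small_indices k \<gamma> (\<T>0 h) \<Omega>. (dof i)\<^sup>2))"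
      using global_estimate[of C1] \<open>0 < C1\<close> by (simp add: C2_def V1_def \<rho>)
    also have "H * (\<Sum>i\<in>small_indices k \<gamma> (\<T>0 h) \<Omega>. (dof i)\<^sup>2) =
        nodal_stab k \<gamma> \<tau> (\<T>0 h) \<Omega> S Ti h m v v / \<tau>"
      using nodal_stab_eq[of \<tau>] assms(7) by simp
    also have "C2 * ((nabla_norm m \<Omega> v)\<^sup>2 + \<dots>) \<le>
        C * ((nabla_norm m \<Omega> v)\<^sup>2 + nodal_stab k \<gamma> \<tau> (\<T>0 h) \<Omega> S Ti h m v v)"
    proof -
      have "0 \<le> nodal_stab k \<gamma> \<tau> (\<T>0 h) \<Omega> S Ti h m v v"
        unfolding nodal_stab_eq using assms(7) H_pos by (simp add: sum_nonneg)
      then have "(nabla_norm m \<Omega> v)\<^sup>2 + nodal_stab k \<gamma> \<tau> (\<T>0 h) \<Omega> S Ti h m v v / \<tau> \<le>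
          (1 + 1 / \<tau>) * ((nabla_norm m \<Omega> v)\<^sup>2 + nodal_stab k \<gamma> \<tau> (\<T>0 h) \<Omega> S Ti h m v v)"
        using assms(7) by (simp add: distrib_right distrib_left)
      then show ?thesis unfolding C_def mult.assoc using \<open>0 < C2\<close> by (intro mult_left_mono) auto
    qed
    finally show "(nabla_norm m (active_domain (\<T>0 h) \<Omega>) v)\<^sup>2 \<le>
        C * ((nabla_norm m \<Omega> v)\<^sup>2 + nodal_stab k \<gamma> \<tau> (\<T>0 h) \<Omega> S Ti h m v v)" .
  qed
qed

end
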